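(* Let $\beta>0$ and let $\bm{R}(t)=(R_1(t),R_2(t))\in\mathbb{R}^2\setminus\{\bm 0\}$ be the solution of the stochastic differential equation $$d\bm{R}=\frac{\beta}{|\bm{R}|^2}\,\bm{R}^\perp\,dt+\sqrt{2}\,d\bm{W},\qquad \bm{R}^\perp=(-R_2,R_1),$$ started at a deterministic point $\bm{R}(0)=\bm{r}_0\neq\bm 0$ with $|\bm{r}_0|=r_0>0$, where $\bm{W}$ is a vector of two independent standard Brownian motions. Let $\Theta(t)\in(-\infty,\infty)$ be the total winding angle about the origin accumulated by $\bm{R}$ up to time $t$. Then, as $t\to\infty$, $$\frac{\beta\,\log^2\!\left(\dfrac{4t}{r_0^2\,e^{\gamma}}\right)}{8\,\Theta(t)}\ \xrightarrow{\ d\ }\ \mathrm{Gamma}\left(\tfrac12,\tfrac12\right),$$ where $\gamma$ is the Euler--Mascheroni constant. Equivalently, $$\frac{8\,\Theta(t)}{\beta\,\log^2\!\left(\dfrac{4t}{r_0^2\,e^{\gamma}}\right)}\ \xrightarrow{\ d\ }\ X,$$ where $X$ has probability density $p_X(x)=\frac{1}{\sqrt{2\pi}}\,x^{-3/2}e^{-1/(2x)}$ for $x>0$ and $p_X(x)=0$ for $x\le 0$.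
   Context: The total winding angle $\Theta(t)$ is the continuous real-valued process with $\Theta(0)=0$ such that, in polar coordinates, $\bm{R}(t)=|\bm{R}(t)|(\cos(\theta_0+\Theta(t)),\sin(\theta_0+\Theta(t)))$, where $\theta_0$ is the polar angle of $\bm{r}_0$ (the angle is not reduced modulo $2\pi$; the process avoids the origin with probability one, so this is well defined). $\xrightarrow{d}$ denotes convergence in distribution. $\mathrm{Gamma}(\tfrac12,\tfrac12)$ is the Gamma distribution with shape $\tfrac12$ and rate $\tfrac12$, i.e. with density $\frac{1}{\sqrt{2\pi}}\,y^{-1/2}e^{-y/2}$ on $y>0$. *)

theory Defs
  imports "HOL-Probability.Probability"
begin

section \<open>Convergence in distribution along a filter\<close>

text \<open>The library notion \<open>weak_conv_m\<close> covers sequences of laws only; here the index runs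
  along an arbitrary filter (below: \<open>t\<close> real, \<open>t \<rightarrow> \<infinity>\<close>).\<close>

definition conv_in_distribution ::
    "'a measure \<Rightarrow> ('i \<Rightarrow> 'a \<Rightarrow> real) \<Rightarrow> real measure \<Rightarrow> 'i filter \<Rightarrow> bool" where
  "conv_in_distribution M X \<mu> G \<longleftrightarrow>
     (\<forall>x. isCont (cdf \<mu>) x \<longrightarrow> ((\<lambda>i. cdf (distr M borel (X i)) x) \<longlongrightarrow> cdf \<mu> x) G)"

lemma conv_in_distribution_sequentially:
  "conv_in_distribution M X \<mu> sequentially \<longleftrightarrow> weak_conv_m (\<lambda>n. distr M borel (X n)) \<mu>"
  by (simp add: conv_in_distribution_def weak_conv_m_def weak_conv_def)

section \<open>The limit laws\<close>

text \<open>Shape \<open>a\<close> and rate \<open>b\<close>.\<close>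

definition gamma_density :: "real \<Rightarrow> real \<Rightarrow> real \<Rightarrow> real" where
  "gamma_density a b y =
     (if 0 < y then b powr a / Gamma a * y powr (a - 1) * exp (- b * y) else 0)"

definition gamma_distribution :: "real \<Rightarrow> real \<Rightarrow> real measure" where
  "gamma_distribution a b = density lborel (\<lambda>y. ennreal (gamma_density a b y))"

lemma gamma_density_half_half:
  "gamma_density (1/2) (1/2) y =
     (if 0 < y then 1 / sqrt (2 * pi) * y powr (- 1/2) * exp (- y / 2) else 0)"
  by (simp add: gamma_density_def Gamma_one_half_real powr_half_sqrt real_sqrt_mult real_sqrt_divide)

definition limit_density :: "real \<Rightarrow> real" where
  "limit_density x =
     (if 0 < x then 1 / sqrt (2 * pi) * x powr (- 3/2) * exp (- 1 / (2 * x)) else 0)"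

section \<open>Brownian motion\<close>

text \<open>All processes are indexed by \<open>real\<close>; only times \<open>t \<ge> 0\<close> are constrained.\<close>

definition standard_brownian_motion :: "'a measure \<Rightarrow> (real \<Rightarrow> 'a \<Rightarrow> real) \<Rightarrow> bool" where
  "standard_brownian_motion M B \<longleftrightarrow>
     prob_space M \<and>
     (\<forall>t\<ge>0. B t \<in> borel_measurable M) \<and>
     (AE \<omega> in M. B 0 \<omega> = 0) \<and>
     (AE \<omega> in M. continuous_on {0..} (\<lambda>t. B t \<omega>)) \<and>
     (\<forall>s t. 0 \<le> s \<and> s < t \<longrightarrow>
        distributed M lborel (\<lambda>\<omega>. B t \<omega> - B s \<omega>) (\<lambda>x. ennreal (normal_density 0 (sqrt (t - s)) x))) \<and>
     (\<forall>(n::nat) (\<tau>::nat \<Rightarrow> real). 0 \<le> \<tau> 0 \<and> (\<forall>i<n. \<tau> i \<le> \<tau> (Suc i)) \<longrightarrow>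
        prob_space.indep_vars M (\<lambda>_. borel) (\<lambda>i \<omega>. B (\<tau> (Suc i)) \<omega> - B (\<tau> i) \<omega>) {..<n})"

text \<open>Two independent standard Brownian motions, jointly a Brownian motion relative to the
  filtration \<open>F\<close>. The usual conditions on \<open>F\<close> are not required.\<close>

definition planar_brownian_motion ::
    "'a measure \<Rightarrow> (real \<Rightarrow> 'a measure) \<Rightarrow> (real \<Rightarrow> 'a \<Rightarrow> real^2) \<Rightarrow> bool" where
  "planar_brownian_motion M F W \<longleftrightarrow>
     filtration (space M) F \<and> (\<forall>t\<ge>0. sets (F t) \<subseteq> sets M) \<and>
     standard_brownian_motion M (\<lambda>t \<omega>. W t \<omega> $ 1) \<and>
     standard_brownian_motion M (\<lambda>t \<omega>. W t \<omega> $ 2) \<and>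
     prob_space.indep_var M
       (PiM {0..} (\<lambda>_. borel)) (\<lambda>\<omega>. \<lambda>t\<in>{0..}. W t \<omega> $ 1)
       (PiM {0..} (\<lambda>_. borel)) (\<lambda>\<omega>. \<lambda>t\<in>{0..}. W t \<omega> $ 2) \<and>
     (\<forall>t\<ge>0. W t \<in> borel_measurable (F t)) \<and>
     (\<forall>s t. 0 \<le> s \<and> s < t \<longrightarrow>
        prob_space.indep_set M (sets (F s))
          (sets (vimage_algebra (space M) (\<lambda>\<omega>. W t \<omega> - W s \<omega>) borel)))"

section \<open>The stochastic differential equation\<close>

definition perp :: "real^2 \<Rightarrow> real^2" where
  "perp x = vector [- (x $ 2), x $ 1]"

definition vortex_drift :: "real \<Rightarrow> real^2 \<Rightarrow> real^2" where
  "vortex_drift \<beta> x = (\<beta> / (norm x)\<^sup>2) *\<^sub>R perp x"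

text \<open>The noise is additive, so the equation involves no stochastic integral: its integrated form
  is an identity between paths. Along a continuous path avoiding the origin the drift is
  continuous in time, hence integrable on \<open>{0..t}\<close>.\<close>

definition vortex_sde_solution ::
    "'a measure \<Rightarrow> (real \<Rightarrow> 'a measure) \<Rightarrow> (real \<Rightarrow> 'a \<Rightarrow> real^2) \<Rightarrow> real \<Rightarrow> real^2
      \<Rightarrow> (real \<Rightarrow> 'a \<Rightarrow> real^2) \<Rightarrow> bool" where
  "vortex_sde_solution M F W \<beta> r\<^sub>0 R \<longleftrightarrow>
     planar_brownian_motion M F W \<and>
     (\<forall>t\<ge>0. R t \<in> borel_measurable (F t)) \<and>
     (AE \<omega> in M.
        continuous_on {0..} (\<lambda>t. R t \<omega>) \<and>
        (\<forall>t\<ge>0. R t \<omega> \<noteq> 0) \<and>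
        R 0 \<omega> = r\<^sub>0 \<and>
        (\<forall>t\<ge>0. R t \<omega> = r\<^sub>0 + integral {0..t} (\<lambda>s. vortex_drift \<beta> (R s \<omega>)) + sqrt 2 *\<^sub>R W t \<omega>))"

section \<open>The total winding angle\<close>

definition polar_angle :: "real^2 \<Rightarrow> real \<Rightarrow> bool" where
  "polar_angle x \<theta> \<longleftrightarrow> x = norm x *\<^sub>R vector [cos \<theta>, sin \<theta>]"

text \<open>The lift does not depend on which polar angle \<open>\<theta>\<^sub>0\<close> of the starting point is used.\<close>

definition total_winding_angle ::
    "'a measure \<Rightarrow> real \<Rightarrow> (real \<Rightarrow> 'a \<Rightarrow> real^2) \<Rightarrow> (real \<Rightarrow> 'a \<Rightarrow> real) \<Rightarrow> bool" where
  "total_winding_angle M \<theta>\<^sub>0 R \<Theta> \<longleftrightarrow>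
     (\<forall>t\<ge>0. \<Theta> t \<in> borel_measurable M) \<and>
     (AE \<omega> in M.
        \<Theta> 0 \<omega> = 0 \<and>
        continuous_on {0..} (\<lambda>t. \<Theta> t \<omega>) \<and>
        (\<forall>t\<ge>0. polar_angle (R t \<omega>) (\<theta>\<^sub>0 + \<Theta> t \<omega>)))"

end

theory Submission
  imports Defs "HOL-Complex_Analysis.Complex_Analysis" "HOL-Real_Asymp.Real_Asymp"
begin

text \<open>The plane is identified with the complex numbers. The drift turns \<open>R\<close> about the origin at angular speed
  \<open>\<beta> / |R|\<^sup>2\<close>, so up to the winding of the noise \<open>\<Theta>(t)\<close> is \<open>\<beta>\<close> times the clock \<open>A(t) = \<integral> ds / |R(s)|\<^sup>2\<close>. In this
  clock \<open>log |R|\<close> is \<open>\<surd>2\<close> times a Brownian motion, and \<open>log |R(t)|\<close> is close to \<open>(log t) / 2\<close>; hence \<open>A(t)\<close> is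
  about the time at which a Brownian motion first climbs by \<open>(log t) / (2 \<surd>2)\<close>, that is
  \<open>(log t)\<^sup>2 / (8 N\<^sup>2)\<close> for a standard normal \<open>N\<close>. The winding of the noise is only of the order \<open>\<surd>A\<close>.

  The proof replaces the time change by one complex martingale. For real \<open>\<mu>\<close> let \<open>\<kappa>\<^sup>2 = \<mu>\<^sup>2 - i \<beta> \<mu>\<close> with
  \<open>Re \<kappa> > 0\<close>; then \<open>|R|\<^sup>\<kappa> exp (i \<mu> \<Theta>)\<close> is annihilated by the generator, so its mean remains \<open>r\<^sub>0\<^sup>\<kappa>\<close>, where
  \<open>r\<^sub>0\<close> stands for the initial radius. Since \<open>|R(t)|\<close> has the order \<open>\<surd>t\<close> and \<open>\<kappa>\<close> tends to \<open>0\<close>, the factor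
  \<open>|R(t)|\<^sup>\<kappa>\<close> may be replaced by the number \<open>(\<surd>t)\<^sup>\<kappa>\<close>, so that \<open>E exp (i \<mu> \<Theta>(t))\<close> is asymptotically
  \<open>(r\<^sub>0 / \<surd>t)\<^sup>\<kappa>\<close>. With \<open>\<mu> = 8 \<xi> / (\<beta> L\<^sup>2)\<close> and \<open>L = log (4 t / (r\<^sub>0\<^sup>2 e\<^sup>\<gamma>))\<close> one has
  \<open>\<kappa> L / 2 \<longlonglongrightarrow> \<surd>(- 2 i \<xi>)\<close>, which gives the limit \<open>exp (- \<surd>(- 2 i \<xi>))\<close>. This is the characteristic function of
  \<open>1 / N\<^sup>2\<close> (\<open>char_limit_law\<close>), and Levy's continuity theorem yields the convergence of the rescaled angle. The
  statement about the reciprocal follows because the limit law has no atoms and gives no mass to the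
  negative half-line.

  The noise is additive, and the martingale identity can be obtained without stochastic integrals, on
  a grid of mesh \<open>h\<close>. Rotate each increment of \<open>W\<close> back by the angle that the drift has accumulated so
  far. The rotated increments form a walk \<open>Y\<close>, and because the complex Gaussian law is
  rotation invariant, \<open>Y\<close> at a grid time has the same law as \<open>\<surd>2 W\<close> started at a deterministic point (\<open>walk_law\<close>).
  Path by path, \<open>Y\<close> rotated forward again is uniformly close to \<open>R\<close>, and the turning of \<open>Y\<close> plus the
  drift angle converges to \<open>\<Theta>\<close> (\<open>turning_tendsto_angle\<close>). One step of the walk changes the mean of
  \<open>|Y|\<^sup>\<kappa> exp (i \<mu> ...)\<close> relatively by \<open>O((h / |Y|\<^sup>2)\<^sup>p)\<close> with \<open>p = 1 + Re \<kappa> / 4\<close> (\<open>spiral_step\<close>). This exponent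
  exceeds \<open>1\<close>, so the errors of all steps together vanish with the mesh, and it is small enough that the
  negative power of \<open>|Y|\<close> which appears is integrable in the plane, uniformly in time
  (\<open>cgauss_inverse_moment\<close>). In this way neither stopping times nor estimates near the origin are required;
  the result is \<open>winding_char_bound\<close>.\<close>

section \<open>The limit law\<close>

text \<open>The primitive based at \<open>0\<close> is odd, so its limits at both ends are known from the Gaussian integral over
  the half-line.\<close>

definition gauss_prim :: "real \<Rightarrow> real" where
  "gauss_prim y = (LBINT u=0..y. std_normal_density u)"

lemma DERIV_gauss_prim: "(gauss_prim has_real_derivative std_normal_density y) (at y)"
proof -
  have c: "continuous_on {- \<bar>y\<bar> - 1..\<bar>y\<bar> + 1} std_normal_density"
    unfolding std_normal_density_def by (intro continuous_intros) auto
  have "((\<lambda>u. LBINT v=ereal 0..ereal u. std_normal_density v) has_vector_derivative std_normal_density y)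
          (at y within {- \<bar>y\<bar> - 1..\<bar>y\<bar> + 1})"
    by (rule interval_integral_FTC2[OF _ _ c]) auto
  then have "((\<lambda>u. LBINT v=ereal 0..ereal u. std_normal_density v) has_vector_derivative std_normal_density y)
          (at y within {- \<bar>y\<bar> - 1<..<\<bar>y\<bar> + 1})"
    by (rule has_vector_derivative_within_subset) auto
  then have "((\<lambda>u. LBINT v=ereal 0..ereal u. std_normal_density v) has_vector_derivative std_normal_density y) (at y)"
    by (subst (asm) at_within_open) auto
  then show ?thesis
    unfolding gauss_prim_def [abs_def] has_real_derivative_iff_has_vector_derivative zero_ereal_def .
qed

lemma gauss_prim_0 [simp]: "gauss_prim 0 = 0"
  by (simp add: gauss_prim_def zero_ereal_def[symmetric])

lemma gauss_prim_minus: "gauss_prim (- y) = - gauss_prim y"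
proof -
  define H where "H y = gauss_prim y + gauss_prim (- y)" for y
  have "(H has_real_derivative 0) (at y)" for y
  proof -
    have "((\<lambda>y. gauss_prim (- y)) has_real_derivative - std_normal_density (- y)) (at y)"
      using DERIV_chain2[OF DERIV_gauss_prim[of "- y"] DERIV_minus[OF DERIV_ident]] by simp
    from DERIV_add[OF DERIV_gauss_prim[of y] this] show ?thesis
      unfolding H_def by (simp add: std_normal_density_def)
  qed
  then have "H y = H 0" by (intro DERIV_isconst_all allI)
  then show ?thesis by (simp add: H_def)
qed

lemma gauss_prim_at_top: "(gauss_prim \<longlongrightarrow> 1/2) at_top"
proof -
  have "has_bochner_integral lborel (\<lambda>x. indicator {0..} x *\<^sub>R exp (- x\<^sup>2)) (sqrt pi / 2)"
    by (rule gaussian_moment_0)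
  then have "has_bochner_integral lborel (\<lambda>x. indicator {0..} (0 + (1 / sqrt 2) * x) *\<^sub>R exp (- (0 + (1 / sqrt 2) * x)\<^sup>2)) ((sqrt pi / 2) /\<^sub>R \<bar>1 / sqrt 2\<bar>)"
    by (subst (asm) lborel_has_bochner_integral_real_affine_iff[where c="1 / sqrt 2" and t=0]) auto
  then have "has_bochner_integral lborel (\<lambda>x. (1 / sqrt (2 * pi)) *\<^sub>R (indicator {0..} (0 + (1 / sqrt 2) * x) *\<^sub>R exp (- (0 + (1 / sqrt 2) * x)\<^sup>2))) ((1 / sqrt (2 * pi)) *\<^sub>R ((sqrt pi / 2) /\<^sub>R \<bar>1 / sqrt 2\<bar>))"
    by (rule has_bochner_integral_scaleR_right)
  also have "(\<lambda>x. (1 / sqrt (2 * pi)) *\<^sub>R (indicator {0..} (0 + (1 / sqrt 2) * x) *\<^sub>R exp (- (0 + (1 / sqrt 2) * x)\<^sup>2)))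
      = (\<lambda>x. indicator {0..} x *\<^sub>R std_normal_density x)"
    by (auto simp: fun_eq_iff std_normal_density_def indicator_def power_divide zero_le_divide_iff)
  also have "(1 / sqrt (2 * pi)) *\<^sub>R ((sqrt pi / 2) /\<^sub>R \<bar>1 / sqrt 2\<bar>) = (1/2 :: real)"
    by (simp add: real_sqrt_mult field_simps)
  finally have hb: "has_bochner_integral lborel (\<lambda>x. indicator {0..} x *\<^sub>R std_normal_density x) (1/2)" .
  then have "set_integrable lborel {0..} std_normal_density"
    by (auto simp: set_integrable_def has_bochner_integral_iff)
  from tendsto_set_lebesgue_integral_at_top[OF _ this]
  have "((\<lambda>b. LINT x:{0..b}|lborel. std_normal_density x) \<longlongrightarrow> (LINT x:{0..}|lborel. std_normal_density x)) at_top"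
    by auto
  moreover have "(LINT x:{0..}|lborel. std_normal_density x) = 1/2"
    using hb by (auto simp: set_lebesgue_integral_def has_bochner_integral_iff)
  moreover have "\<forall>\<^sub>F b in at_top. (LINT x:{0..b}|lborel. std_normal_density x) = gauss_prim b"
    using eventually_ge_at_top[of 0]
    by eventually_elim (simp add: gauss_prim_def interval_integral_Icc zero_ereal_def)
  ultimately show ?thesis
    by (auto elim: Lim_transform_eventually)
qed

lemma gauss_prim_at_bot: "(gauss_prim \<longlongrightarrow> - 1/2) at_bot"
proof -
  have "((\<lambda>y. - gauss_prim (- y)) \<longlongrightarrow> - (1/2)) at_bot"
    by (intro tendsto_minus filterlim_compose[OF gauss_prim_at_top] filterlim_uminus_at_top_at_bot)
  then show ?thesis by (simp add: gauss_prim_minus)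
qed

lemma isCont_gauss_prim: "isCont gauss_prim y"
  using DERIV_gauss_prim DERIV_isCont by blast

lemmas tendsto_gauss_prim = isCont_tendsto_compose[OF isCont_gauss_prim]

text \<open>A primitive of \<open>limit_density x * exp (- a\<^sup>2 x / 2)\<close>: in the exponents \<open>- (1 / \<surd>x \<mp> a \<surd>x)\<^sup>2 / 2\<close> the mixed terms
  are the constants \<open>\<plusminus> a\<close>, and the unwanted parts of the two inner derivatives cancel.\<close>

definition levy_prim :: "real \<Rightarrow> real \<Rightarrow> real" where
  "levy_prim a x = - (exp (- a) * gauss_prim (1 / sqrt x - a * sqrt x) + exp a * gauss_prim (1 / sqrt x + a * sqrt x))"

lemma limit_density_eq:
  "0 < x \<Longrightarrow> limit_density x = 1 / sqrt (2 * pi) * (1 / (x * sqrt x)) * exp (- 1 / (2 * x))"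
proof -
  assume x: "0 < x"
  have "x powr (-3/2) = x powr (-1 + -1/2)"
    by simp
  also have "\<dots> = x powr (-1) * x powr (-1/2)"
    by (rule powr_add)
  also have "x powr (-1/2) = 1 / sqrt x"
    using x by (simp add: powr_minus_divide powr_half_sqrt)
  finally show ?thesis using x by (simp add: limit_density_def powr_minus_divide)
qed

lemma limit_density_nonneg: "0 \<le> limit_density x"
  by (simp add: limit_density_def)

lemma DERIV_levy_prim:
  assumes x: "0 < x"
  shows "(levy_prim a has_real_derivative limit_density x * exp (- a\<^sup>2 / 2 * x)) (at x)"
proof -
  have d1: "((\<lambda>x. 1 / sqrt x - a * sqrt x) has_real_derivative (- 1 / (2 * x * sqrt x) - a / (2 * sqrt x))) (at x)"
    using x by (auto intro!: derivative_eq_intros simp: field_simps)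
  have d2: "((\<lambda>x. 1 / sqrt x + a * sqrt x) has_real_derivative (- 1 / (2 * x * sqrt x) + a / (2 * sqrt x))) (at x)"
    using x by (auto intro!: derivative_eq_intros simp: field_simps)
  have e1: "exp (- a) * std_normal_density (1 / sqrt x - a * sqrt x) = 1 / sqrt (2 * pi) * exp (- 1 / (2 * x)) * exp (- a\<^sup>2 / 2 * x)"
    using x by (simp add: std_normal_density_def power2_diff power_mult_distrib power_divide field_simps power2_eq_square flip: exp_add)
  have e2: "exp a * std_normal_density (1 / sqrt x + a * sqrt x) = 1 / sqrt (2 * pi) * exp (- 1 / (2 * x)) * exp (- a\<^sup>2 / 2 * x)"
    using x by (simp add: std_normal_density_def power2_sum power_mult_distrib power_divide field_simps power2_eq_square flip: exp_add)
  have "(levy_prim a has_real_derivative - (exp (- a) * (std_normal_density (1 / sqrt x - a * sqrt x) * (- 1 / (2 * x * sqrt x) - a / (2 * sqrt x)))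
       + exp a * (std_normal_density (1 / sqrt x + a * sqrt x) * (- 1 / (2 * x * sqrt x) + a / (2 * sqrt x))))) (at x)"
    unfolding levy_prim_def [abs_def]
    by (intro DERIV_minus DERIV_add DERIV_cmult DERIV_chain2[OF DERIV_gauss_prim d1] DERIV_chain2[OF DERIV_gauss_prim d2])
  also have "- (exp (- a) * (std_normal_density (1 / sqrt x - a * sqrt x) * (- 1 / (2 * x * sqrt x) - a / (2 * sqrt x)))
       + exp a * (std_normal_density (1 / sqrt x + a * sqrt x) * (- 1 / (2 * x * sqrt x) + a / (2 * sqrt x)))) =
       1 / sqrt (2 * pi) * exp (- 1 / (2 * x)) * exp (- a\<^sup>2 / 2 * x) * (1 / (x * sqrt x))"
    unfolding mult.assoc[symmetric] e1 e2 using x by (simp add: field_simps)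
  finally show ?thesis using x by (simp add: limit_density_eq mult_ac)
qed

lemma levy_prim_at_0: "(levy_prim a \<longlongrightarrow> - ((exp a + exp (- a)) / 2)) (at_right 0)"
proof -
  have 1: "filterlim (\<lambda>x::real. 1 / sqrt x - a * sqrt x) at_top (at_right 0)" by real_asymp
  have 2: "filterlim (\<lambda>x::real. 1 / sqrt x + a * sqrt x) at_top (at_right 0)" by real_asymp
  have "(levy_prim a \<longlongrightarrow> - (exp (- a) * (1/2) + exp a * (1/2))) (at_right 0)"
    unfolding levy_prim_def [abs_def]
    by (intro tendsto_intros filterlim_compose[OF gauss_prim_at_top 1] filterlim_compose[OF gauss_prim_at_top 2])
  then show ?thesis by (simp add: field_simps)
qed

lemma levy_prim_at_top:
  assumes "0 \<le> a"
  shows "(levy_prim a \<longlongrightarrow> exp (- a) - (exp a + exp (- a)) / 2) at_top"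
proof (cases "a = 0")
  case True
  have "((\<lambda>x::real. 1 / sqrt x) \<longlongrightarrow> 0) at_top" by real_asymp
  from tendsto_gauss_prim[OF this] have "((\<lambda>x. - (gauss_prim (1 / sqrt x) + gauss_prim (1 / sqrt x))) \<longlongrightarrow> - (0 + 0)) at_top"
    by (intro tendsto_intros) auto
  with True show ?thesis by (simp add: levy_prim_def [abs_def])
next
  case False
  with assms have a: "a > 0" by simp
  have 1: "filterlim (\<lambda>x::real. 1 / sqrt x - a * sqrt x) at_bot at_top" using a by real_asymp
  have 2: "filterlim (\<lambda>x::real. 1 / sqrt x + a * sqrt x) at_top at_top" using a by real_asymp
  have "(levy_prim a \<longlongrightarrow> - (exp (- a) * (-1/2) + exp a * (1/2))) at_top"
    unfolding levy_prim_def [abs_def]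
    by (intro tendsto_intros filterlim_compose[OF gauss_prim_at_bot 1] filterlim_compose[OF gauss_prim_at_top 2])
  moreover have "- (exp (- a) * (-1/2) + exp a * (1/2)) = exp (- a) - (exp a + exp (- a)) / 2"
    by (simp add: field_simps)
  ultimately show ?thesis by simp
qed

lemma tendsto_real_of_ereal_iff:
  "((f \<circ> real_of_ereal) \<longlongrightarrow> A) (at_right (ereal a)) \<longleftrightarrow> (f \<longlongrightarrow> A) (at_right a)"
  "((f \<circ> real_of_ereal) \<longlongrightarrow> A) (at_left (ereal a)) \<longleftrightarrow> (f \<longlongrightarrow> A) (at_left a)"
  "((f \<circ> real_of_ereal) \<longlongrightarrow> A) (at_left \<infinity>) \<longleftrightarrow> (f \<longlongrightarrow> A) at_top"
  by (simp_all add: ereal_tendsto_simps1)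

lemma isCont_limit_density: "0 < x \<Longrightarrow> isCont limit_density x"
proof -
  assume x: "0 < x"
  have "isCont (\<lambda>x. 1 / sqrt (2 * pi) * x powr (- 3/2) * exp (- 1 / (2 * x))) x"
    using x by (intro continuous_intros) auto
  moreover have "\<forall>\<^sub>F y in nhds x. limit_density y = 1 / sqrt (2 * pi) * y powr (- 3/2) * exp (- 1 / (2 * y))"
    using eventually_nhds_in_open[of "{0<..}" x] x by (auto elim!: eventually_mono simp: limit_density_def)
  ultimately show ?thesis by (simp add: isCont_cong)
qed

text \<open>For a nonnegative density the one-sided limits of a primitive already imply integrability.\<close>

lemma FTC_halfline:
  fixes f F :: "real \<Rightarrow> real"
  assumes nn: "\<And>x. 0 \<le> f x" and z: "\<And>x. x \<le> 0 \<Longrightarrow> f x = 0"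
    and D: "\<And>x. 0 < x \<Longrightarrow> (F has_real_derivative f x) (at x)"
    and c: "\<And>x. 0 < x \<Longrightarrow> isCont f x"
    and A: "(F \<longlongrightarrow> A) (at_right 0)"
  shows cdf_density_halfline: "0 < x \<Longrightarrow> cdf (density lborel (\<lambda>x. ennreal (f x))) x = F x - A"
    and has_integral_halfline: "(F \<longlongrightarrow> B) at_top \<Longrightarrow> has_bochner_integral lborel f (B - A)"
proof -
  assume B: "(F \<longlongrightarrow> B) at_top"
  have "set_integrable lborel (einterval (ereal 0) \<infinity>) f" "(LBINT x=ereal 0..\<infinity>. f x) = B - A"
    by (rule interval_integral_FTC_nonneg[where F=F and A=A and B=B];
        simp add: tendsto_real_of_ereal_iff D c nn A B)+
  moreover have "(\<lambda>x. indicator (einterval (ereal 0) \<infinity>) x *\<^sub>R f x) = f"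
    using z by (auto simp: indicator_def einterval_def fun_eq_iff not_less)
  ultimately show "has_bochner_integral lborel f (B - A)"
    unfolding set_integrable_def interval_lebesgue_integral_def set_lebesgue_integral_def
    by (simp add: has_bochner_integral_iff)
next
  assume x: "0 < x"
  have lim: "(F \<longlongrightarrow> F x) (at_left x)"
    using DERIV_isCont[OF D[OF x]] by (simp add: isCont_def filterlim_at_split)
  have i: "set_integrable lborel (einterval (ereal 0) (ereal x)) f"
    and v: "(LBINT y=ereal 0..ereal x. f y) = F x - A"
    by (rule interval_integral_FTC_nonneg[where F=F and A=A and B="F x"];
        simp add: tendsto_real_of_ereal_iff D c nn A lim x)+
  have "f \<in> borel_measurable borel"
  proof -
    have "continuous_on {0<..} f" using c by (auto intro: continuous_at_imp_continuous_on)
    then have "(\<lambda>x. indicator {0<..} x *\<^sub>R f x) \<in> borel_measurable borel"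
      by (rule borel_measurable_continuous_on_indicator[rotated]) simp
    also have "(\<lambda>x. indicator {0<..} x *\<^sub>R f x) = f"
      using z by (auto simp: indicator_def fun_eq_iff not_less)
    finally show ?thesis .
  qed
  note [measurable] = this
  have "emeasure (density lborel (\<lambda>x. ennreal (f x))) {..x} = (\<integral>\<^sup>+y. ennreal (f y) * indicator {..x} y \<partial>lborel)"
    by (rule emeasure_density) simp_all
  also have "\<dots> = (\<integral>\<^sup>+y. ennreal (indicator (einterval (ereal 0) (ereal x)) y *\<^sub>R f y) \<partial>lborel)"
  proof (rule nn_integral_cong_AE, rule AE_mp[OF AE_lborel_singleton[of x]], rule AE_I2, rule impI)
    fix y assume "y \<noteq> x"
    then have e: "indicator (einterval (ereal 0) (ereal x)) y *\<^sub>R f y = (if y \<le> x then f y else 0)"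
      using z[of y] by (cases "0 < y") (simp_all add: indicator_def einterval_def)
    show "ennreal (f y) * indicator {..x} y = ennreal (indicator (einterval (ereal 0) (ereal x)) y *\<^sub>R f y)"
      unfolding e by (simp add: indicator_def)
  qed
  also have "\<dots> = ennreal (LINT y|lborel. indicator (einterval (ereal 0) (ereal x)) y *\<^sub>R f y)"
    using i unfolding set_integrable_def
    by (rule nn_integral_eq_integral) (simp add: nn)
  also have "(LINT y|lborel. indicator (einterval (ereal 0) (ereal x)) y *\<^sub>R f y) = F x - A"
    using v x by (simp add: interval_lebesgue_integral_def set_lebesgue_integral_def)
  finally have "emeasure (density lborel (\<lambda>x. ennreal (f x))) {..x} = ennreal (F x - A)" .
  moreover have "0 \<le> F x - A"
  proof -
    have "0 \<le> (LINT y|lborel. indicator (einterval (ereal 0) (ereal x)) y *\<^sub>R f y)"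
      by (intro integral_nonneg_AE) (auto simp: nn)
    then show ?thesis using v x by (simp add: interval_lebesgue_integral_def set_lebesgue_integral_def)
  qed
  ultimately show "cdf (density lborel (\<lambda>x. ennreal (f x))) x = F x - A"
    by (simp add: cdf_def measure_def)
qed

lemma limit_density_neg: "x \<le> 0 \<Longrightarrow> limit_density x = 0"
  by (simp add: limit_density_def)

text \<open>This is the Laplace transform of the limit law at the real point \<open>a\<^sup>2 / 2\<close>.\<close>

lemma limit_density_tilted:
  assumes a: "0 \<le> a"
  shows "has_bochner_integral lborel (\<lambda>x. limit_density x * exp (- a\<^sup>2 / 2 * x)) (exp (- a))"
proof -
  have "has_bochner_integral lborel (\<lambda>x. limit_density x * exp (- a\<^sup>2 / 2 * x))
      ((exp (- a) - (exp a + exp (- a)) / 2) - (- ((exp a + exp (- a)) / 2)))"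
    by (rule has_integral_halfline[OF _ _ DERIV_levy_prim _ levy_prim_at_0 levy_prim_at_top[OF a]])
       (auto intro!: continuous_intros isCont_limit_density simp: limit_density_nonneg limit_density_neg)
  then show ?thesis by simp
qed

lemma cdf_limit_law:
  assumes x: "0 < x"
  shows "cdf (density lborel (\<lambda>x. ennreal (limit_density x))) x = 1 - 2 * gauss_prim (1 / sqrt x)"
proof -
  have "cdf (density lborel (\<lambda>x. ennreal (limit_density x))) x = levy_prim 0 x - (- ((exp 0 + exp (- 0)) / 2))"
    by (rule cdf_density_halfline[OF limit_density_nonneg _ _ _ levy_prim_at_0 x])
       (use DERIV_levy_prim[of _ 0] in \<open>auto intro!: isCont_limit_density simp: limit_density_neg\<close>)
  then show ?thesis by (simp add: levy_prim_def)
qed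

lemma cdf_gamma_half:
  assumes x: "0 < x"
  shows "cdf (gamma_distribution (1/2) (1/2)) x = 2 * gauss_prim (sqrt x)"
proof -
  let ?g = "gamma_density (1/2) (1/2)"
  have g: "?g y = std_normal_density (sqrt y) / sqrt y" if "0 < y" for y
    using that unfolding gamma_density_half_half
    by (simp add: std_normal_density_def powr_minus_divide powr_half_sqrt)
  have D: "((\<lambda>y. 2 * gauss_prim (sqrt y)) has_real_derivative ?g y) (at y)" if "0 < y" for y
  proof -
    have "((\<lambda>y. 2 * gauss_prim (sqrt y)) has_real_derivative 2 * (std_normal_density (sqrt y) * (inverse (sqrt y) / 2))) (at y)"
      by (intro DERIV_cmult DERIV_chain2[OF DERIV_gauss_prim] DERIV_real_sqrt that)
    then show ?thesis using that by (simp add: g field_simps)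
  qed
  have lim: "((\<lambda>y. 2 * gauss_prim (sqrt y)) \<longlongrightarrow> 2 * gauss_prim (sqrt 0)) (at_right 0)"
    by (intro tendsto_intros tendsto_gauss_prim)
  have ct: "isCont ?g y" if "0 < y" for y
  proof -
    have "isCont (\<lambda>y. std_normal_density (sqrt y) / sqrt y) y"
      using that unfolding std_normal_density_def by (intro continuous_intros) auto
    moreover have e: "\<forall>\<^sub>F z in nhds y. ?g z = std_normal_density (sqrt z) / sqrt z"
      using eventually_nhds_in_open[of "{0<..}" y] that by (auto elim!: eventually_mono simp: g)
    ultimately show ?thesis by (simp only: isCont_cong[OF e])
  qed
  have "cdf (gamma_distribution (1/2) (1/2)) x = 2 * gauss_prim (sqrt x) - 2 * gauss_prim (sqrt 0)"
    unfolding gamma_distribution_def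
    by (rule cdf_density_halfline[OF _ _ D ct lim x]) (auto simp: gamma_density_half_half simp del: One_nat_def)
  then show ?thesis by simp
qed

lemma cdf_gamma_half_nonpos: "x \<le> 0 \<Longrightarrow> cdf (gamma_distribution (1/2) (1/2)) x = 0"
proof -
  assume x: "x \<le> 0"
  have [measurable]: "gamma_density (1/2) (1/2) \<in> borel_measurable borel"
    unfolding gamma_density_def [abs_def] by measurable
  have "emeasure (gamma_distribution (1/2) (1/2)) {..x} = (\<integral>\<^sup>+y. ennreal (gamma_density (1/2) (1/2) y) * indicator {..x} y \<partial>lborel)"
    unfolding gamma_distribution_def by (subst emeasure_density) auto
  also have "\<dots> = (\<integral>\<^sup>+(y::real). 0 \<partial>lborel)"
    using x by (intro nn_integral_cong) (auto simp: indicator_def gamma_density_half_half)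
  finally show ?thesis by (simp add: cdf_def measure_def)
qed

lemma cdf_limit_law_0: "cdf (density lborel (\<lambda>x. ennreal (limit_density x))) 0 = 0"
proof -
  have [measurable]: "limit_density \<in> borel_measurable borel"
    unfolding limit_density_def [abs_def] by measurable
  have "emeasure (density lborel (\<lambda>x. ennreal (limit_density x))) {..0} = (\<integral>\<^sup>+y. ennreal (limit_density y) * indicator {..0} y \<partial>lborel)"
    by (subst emeasure_density) auto
  also have "\<dots> = (\<integral>\<^sup>+(y::real). 0 \<partial>lborel)"
    by (intro nn_integral_cong) (auto simp: indicator_def limit_density_def)
  finally show ?thesis by (simp add: cdf_def measure_def)
qed

lemma measurable_limit_density [measurable]: "limit_density \<in> borel_measurable borel"
  unfolding limit_density_def [abs_def] by measurable

lemma integrable_limit_density: "integrable lborel limit_density"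
  and integral_limit_density: "(LINT x|lborel. limit_density x) = 1"
  using limit_density_tilted[of 0] by (simp_all add: has_bochner_integral_iff)

lemma norm_exp_minus_1_le: "norm (exp z - 1) \<le> norm z * exp (norm z)" for z :: complex
proof -
  have "norm (exp z - exp 0) \<le> exp (norm z) * norm (z - 0)"
  proof (rule field_differentiable_bound[where S="cball 0 (norm z)" and f'=exp])
    fix w :: complex assume "w \<in> cball 0 (norm z)"
    then show "norm (exp w) \<le> exp (norm z)"
      using abs_Re_le_cmod[of w] by (simp add: dist_norm)
  qed (auto intro!: derivative_eq_intros)
  then show ?thesis by (simp add: mult.commute)
qed

definition levy_laplace :: "complex \<Rightarrow> complex" where
  "levy_laplace s = (LINT x|lborel. limit_density x *\<^sub>R exp (- (s * of_real x)))"

lemma norm_levy_integrand: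
  assumes "0 \<le> Re s"
  shows "norm (limit_density x *\<^sub>R exp (- (s * of_real x))) \<le> limit_density x"
proof (cases "x > 0")
  case True
  then have "exp (- (Re s * x)) \<le> 1" using assms by simp
  from mult_left_mono[OF this limit_density_nonneg[of x]]
  show ?thesis by (simp add: limit_density_nonneg)
qed (simp add: limit_density_neg)

lemma integrable_levy_integrand:
  assumes "0 \<le> Re s"
  shows "integrable lborel (\<lambda>x. limit_density x *\<^sub>R exp (- (s * of_real x)))"
  by (rule Bochner_Integration.integrable_bound[OF integrable_limit_density])
     (use norm_levy_integrand[OF assms] limit_density_nonneg in auto)

text \<open>Differentiation under the integral sign: near \<open>s\<close> the difference quotients of the exponential are dominated
  by \<open>x exp (- \<rho> x)\<close> with \<open>\<rho> = Re s / 2\<close>, hence by the constant \<open>1 / \<rho>\<close>.\<close>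

lemma levy_laplace_DERIV:
  assumes s: "0 < Re s"
  shows "\<exists>D. (levy_laplace has_field_derivative D) (at s)"
proof -
  define \<rho> where "\<rho> = Re s / 2"
  have \<rho>: "\<rho> > 0" using s by (simp add: \<rho>_def)
  define D where "D = (LINT x|lborel. limit_density x *\<^sub>R (- of_real x * exp (- (s * of_real x))))"
  have "((\<lambda>d. (levy_laplace (s + d) - levy_laplace s) / d) \<longlongrightarrow> D) (at 0)"
    unfolding tendsto_at_iff_sequentially comp_def
  proof (intro allI impI)
    fix X :: "nat \<Rightarrow> complex" assume X0: "\<forall>i. X i \<in> UNIV - {0}" and X: "X \<longlonglongrightarrow> 0"
    from X \<rho> have "\<forall>\<^sub>F n in sequentially. norm (X n) < \<rho>"
      using tendstoD[of X 0 sequentially \<rho>] by simp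
    then obtain N where N: "\<And>n. n \<ge> N \<Longrightarrow> norm (X n) < \<rho>"
      by (auto simp: eventually_sequentially)
    define Y where "Y n = X (n + N)" for n
    have Y0: "Y n \<noteq> 0" and YN: "norm (Y n) \<le> \<rho>" for n
      using X0 N[of "n + N"] by (auto simp: Y_def less_imp_le)
    have Y: "Y \<longlonglongrightarrow> 0" unfolding Y_def using X by (rule LIMSEQ_ignore_initial_segment)
    have Re_Y: "0 \<le> Re (s + Y n)" for n
      using YN[of n] abs_Re_le_cmod[of "Y n"] s by (simp add: \<rho>_def)
    have eq: "(levy_laplace (s + Y n) - levy_laplace s) / Y n
       = (LINT x|lborel. limit_density x *\<^sub>R ((exp (- ((s + Y n) * of_real x)) - exp (- (s * of_real x))) / Y n))" for n
    proof -
      have "levy_laplace (s + Y n) - levy_laplace s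
        = (LINT x|lborel. limit_density x *\<^sub>R exp (- ((s + Y n) * of_real x)) - limit_density x *\<^sub>R exp (- (s * of_real x)))"
        unfolding levy_laplace_def using s
        by (intro Bochner_Integration.integral_diff[symmetric] integrable_levy_integrand Re_Y) simp
      then have "(levy_laplace (s + Y n) - levy_laplace s) / Y n
        = (LINT x|lborel. (limit_density x *\<^sub>R exp (- ((s + Y n) * of_real x)) - limit_density x *\<^sub>R exp (- (s * of_real x))) / Y n)"
        by (simp only: Bochner_Integration.integral_divide_zero)
      also have "\<dots> = (LINT x|lborel. limit_density x *\<^sub>R ((exp (- ((s + Y n) * of_real x)) - exp (- (s * of_real x))) / Y n))"
        by (intro Bochner_Integration.integral_cong refl) (simp only: scaleR_conv_of_real ring_distribs diff_divide_distrib times_divide_eq_right)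
      finally show ?thesis .
    qed
    have "(\<lambda>n. LINT x|lborel. limit_density x *\<^sub>R ((exp (- ((s + Y n) * of_real x)) - exp (- (s * of_real x))) / Y n)) \<longlonglongrightarrow> D"
      unfolding D_def
    proof (rule integral_dominated_convergence)
      show "integrable lborel (\<lambda>x. limit_density x * (1 / \<rho>))"
        using integrable_limit_density by simp
      show "AE x in lborel. (\<lambda>n. limit_density x *\<^sub>R ((exp (- ((s + Y n) * of_real x)) - exp (- (s * of_real x))) / Y n))
          \<longlonglongrightarrow> limit_density x *\<^sub>R (- of_real x * exp (- (s * of_real x)))"
      proof (intro AE_I2 tendsto_scaleR tendsto_const)
        fix x :: real
        have "((\<lambda>u. exp (- (u * of_real x))) has_field_derivative (- of_real x * exp (- (s * of_real x)))) (at s)"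
          by (auto intro!: derivative_eq_intros)
        then have "((\<lambda>d. (exp (- ((s + d) * of_real x)) - exp (- (s * of_real x))) / d) \<longlongrightarrow> - of_real x * exp (- (s * of_real x))) (at 0)"
          by (simp add: DERIV_def)
        then show "(\<lambda>n. (exp (- ((s + Y n) * of_real x)) - exp (- (s * of_real x))) / Y n) \<longlonglongrightarrow> - of_real x * exp (- (s * of_real x))"
          using Y Y0 unfolding tendsto_at_iff_sequentially comp_def by auto
      qed
      show "AE x in lborel. norm (limit_density x *\<^sub>R ((exp (- ((s + Y n) * of_real x)) - exp (- (s * of_real x))) / Y n)) \<le> limit_density x * (1 / \<rho>)" for n
      proof (intro AE_I2)
        fix x :: real
        show "norm (limit_density x *\<^sub>R ((exp (- ((s + Y n) * of_real x)) - exp (- (s * of_real x))) / Y n)) \<le> limit_density x * (1 / \<rho>)"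
        proof (cases "x > 0")
          case True
          have "exp (- ((s + Y n) * of_real x)) - exp (- (s * of_real x)) = exp (- (s * of_real x)) * (exp (- (Y n * of_real x)) - 1)"
            by (simp add: algebra_simps flip: exp_add)
          then have "norm ((exp (- ((s + Y n) * of_real x)) - exp (- (s * of_real x))) / Y n) = exp (- (Re s * x)) * norm (exp (- (Y n * of_real x)) - 1) / norm (Y n)"
            by (simp add: norm_mult norm_divide)
          also have "\<dots> \<le> exp (- (Re s * x)) * (norm (- (Y n * of_real x)) * exp (norm (- (Y n * of_real x)))) / norm (Y n)"
            by (intro divide_right_mono mult_left_mono norm_exp_minus_1_le) auto
          also have "\<dots> = x * exp (- (Re s * x) + norm (Y n) * x)"
            using True Y0[of n] by (simp only: exp_add) (simp add: norm_mult)
          also have "\<dots> \<le> x * exp (- (\<rho> * x))"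
          proof -
            have "norm (Y n) * x \<le> \<rho> * x" using True YN by (intro mult_right_mono) auto
            then show ?thesis using True by (simp add: \<rho>_def algebra_simps)
          qed
          also have "\<dots> \<le> 1 / \<rho>"
          proof -
            have "\<rho> * x \<le> exp (\<rho> * x)" using exp_ge_add_one_self[of "\<rho> * x"] by linarith
            then show ?thesis using \<rho> by (simp add: exp_minus field_simps)
          qed
          finally have "norm ((exp (- ((s + Y n) * of_real x)) - exp (- (s * of_real x))) / Y n) \<le> 1 / \<rho>" .
          from mult_left_mono[OF this limit_density_nonneg[of x]] show ?thesis
            by (simp only: norm_scaleR abs_of_nonneg[OF limit_density_nonneg])
        qed (simp add: limit_density_neg)
      qed
    qed auto
    then have "(\<lambda>n. (levy_laplace (s + Y n) - levy_laplace s) / Y n) \<longlonglongrightarrow> D" by (simp only: eq)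
    then have "(\<lambda>n. (levy_laplace (s + X (n + N)) - levy_laplace s) / X (n + N)) \<longlonglongrightarrow> D" unfolding Y_def .
    then show "(\<lambda>n. (levy_laplace (s + X n) - levy_laplace s) / X n) \<longlonglongrightarrow> D" by (rule LIMSEQ_offset)
  qed
  then show ?thesis by (auto simp: DERIV_def)
qed

text \<open>Both sides are holomorphic in the right half-plane and agree on the positive real axis.\<close>

lemma levy_laplace_interior:
  assumes s: "0 < Re s"
  shows "levy_laplace s = exp (- csqrt (2 * s))"
proof -
  let ?S = "{z. Re z > 0}"
  have h: "levy_laplace holomorphic_on ?S"
    using levy_laplace_DERIV by (subst holomorphic_on_open) (auto simp: open_halfspace_Re_gt)
  have np: "2 * z \<notin> \<real>\<^sub>\<le>\<^sub>0" if "Re z > 0" for z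
    using that by (auto simp: complex_nonpos_Reals_iff)
  have "levy_laplace s - exp (- csqrt (2 * s)) = 0"
  proof (rule analytic_continuation[where f="\<lambda>z. levy_laplace z - exp (- csqrt (2 * z))" and S="?S" and U="of_real ` {0<..}" and \<xi>=1])
    show "(\<lambda>z. levy_laplace z - exp (- csqrt (2 * z))) holomorphic_on ?S"
      using np by (intro holomorphic_intros h) auto
    show "open ?S" by (simp add: open_halfspace_Re_gt)
    show "connected ?S" by (simp add: convex_connected convex_halfspace_Re_gt)
    show "of_real ` {0<..} \<subseteq> ?S" by auto
    show "(1::complex) islimpt of_real ` {0<..}"
    proof -
      have "(\<lambda>n. 1 + complex_of_real (1 / real (Suc n))) \<longlonglongrightarrow> 1 + complex_of_real 0"
        by (intro tendsto_intros LIMSEQ_Suc[OF lim_1_over_n])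
      moreover have "\<forall>n. 1 + complex_of_real (1 / real (Suc n)) \<in> of_real ` {0<..} - {1}"
      proof
        fix n
        have "1 + complex_of_real (1 / real (Suc n)) = of_real (1 + 1 / real (Suc n))" by simp
        moreover have "1 + 1 / real (Suc n) > 0" by (simp add: add_pos_pos)
        moreover have "1 + complex_of_real (1 / real (Suc n)) \<noteq> 1" by (metis add_cancel_right_right divide_eq_0_iff of_nat_eq_0_iff of_real_eq_0_iff nat.distinct(1) zero_neq_one)
        ultimately show "1 + complex_of_real (1 / real (Suc n)) \<in> of_real ` {0<..} - {1}" by blast
      qed
      ultimately show ?thesis unfolding islimpt_sequential
        by (intro exI[of _ "\<lambda>n. 1 + complex_of_real (1 / real (Suc n))"]) simp
    qed
    fix z :: complex assume "z \<in> of_real ` {0<..}"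
    then obtain x where x: "x > 0" "z = of_real x" by auto
    have "levy_laplace z = (LINT u|lborel. of_real (limit_density u * exp (- (sqrt (2 * x))\<^sup>2 / 2 * u)))"
      unfolding levy_laplace_def x(2) using x(1)
      by (intro Bochner_Integration.integral_cong) (auto simp: scaleR_conv_of_real simp flip: exp_of_real)
    also have "\<dots> = of_real (exp (- sqrt (2 * x)))"
    proof -
      have "(LINT u|lborel. limit_density u * exp (- (sqrt (2 * x))\<^sup>2 / 2 * u)) = exp (- sqrt (2 * x))"
        using limit_density_tilted[of "sqrt (2 * x)"] x(1) by (simp add: has_bochner_integral_iff)
      then show ?thesis by (simp only: integral_complex_of_real)
    qed
    also have "\<dots> = exp (- csqrt (2 * z))"
    proof -
      have "csqrt (of_real (2 * x)) = of_real (sqrt (2 * x))" using x(1) by (subst csqrt_of_real_nonneg) auto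
      then show ?thesis by (simp add: x(2) flip: exp_of_real)
    qed
    finally show "levy_laplace z - exp (- csqrt (2 * z)) = 0" by simp
  qed (use s in auto)
  then show ?thesis by simp
qed

text \<open>The boundary values, which give the characteristic function, follow by dominated convergence from the
  interior.\<close>

lemma levy_laplace_eq:
  assumes s: "0 \<le> Re s" "s \<noteq> 0"
  shows "levy_laplace s = exp (- csqrt (2 * s))"
proof -
  define u where "u n = s + of_real (1 / real (Suc n))" for n
  have u: "u \<longlonglongrightarrow> s"
  proof -
    have "u \<longlonglongrightarrow> s + of_real 0" unfolding u_def
      by (intro tendsto_intros LIMSEQ_Suc[OF lim_1_over_n])
    then show ?thesis by simp
  qed
  have Re_u: "0 < Re (u n)" for n using s by (simp add: u_def add_nonneg_pos)
  have "2 * s \<notin> \<real>\<^sub>\<le>\<^sub>0" using s by (auto simp: complex_nonpos_Reals_iff complex_eq_iff)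
  then have "isCont csqrt (2 * s)" by (rule continuous_at_csqrt)
  then have "(\<lambda>n. exp (- csqrt (2 * u n))) \<longlonglongrightarrow> exp (- csqrt (2 * s))"
    by (intro tendsto_intros isCont_tendsto_compose[where g=csqrt] u)
  moreover have "(\<lambda>n. levy_laplace (u n)) \<longlonglongrightarrow> levy_laplace s"
    unfolding levy_laplace_def
  proof (rule integral_dominated_convergence[OF _ _ integrable_limit_density])
    show "AE x in lborel. (\<lambda>n. limit_density x *\<^sub>R exp (- (u n * of_real x))) \<longlonglongrightarrow> limit_density x *\<^sub>R exp (- (s * of_real x))"
      by (intro AE_I2 tendsto_intros u)
    show "AE x in lborel. norm (limit_density x *\<^sub>R exp (- (u n * of_real x))) \<le> limit_density x" for n
      using Re_u[of n] by (intro AE_I2 norm_levy_integrand) simp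
  qed auto
  ultimately show ?thesis
    using Re_u by (auto simp: levy_laplace_interior intro: LIMSEQ_unique)
qed

definition limit_law :: "real measure" where
  "limit_law = density lborel (\<lambda>x. ennreal (limit_density x))"

lemma real_distribution_limit_law: "real_distribution limit_law"
proof -
  have "prob_space limit_law"
    unfolding limit_law_def
    by (rule prob_spaceI)
       (simp add: emeasure_density nn_integral_eq_integral[OF integrable_limit_density] limit_density_nonneg integral_limit_density)
  then show ?thesis
    unfolding real_distribution_def real_distribution_axioms_def by (simp add: limit_law_def)
qed

lemma char_limit_law:
  assumes "t \<noteq> 0"
  shows "char limit_law t = exp (- csqrt (- 2 * \<i> * of_real t))"
proof -
  have "char limit_law t = (LINT x|lborel. limit_density x *\<^sub>R exp (\<i> * of_real (t * x)))"
    unfolding char_def limit_law_def by (subst integral_density) (auto simp: limit_density_nonneg)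
  also have "\<dots> = levy_laplace (- \<i> * of_real t)"
    unfolding levy_laplace_def by (simp add: mult_ac)
  also have "\<dots> = exp (- csqrt (2 * (- \<i> * of_real t)))"
    using assms by (intro levy_laplace_eq) auto
  finally show ?thesis by (simp add: mult_ac)
qed

section \<open>The standard complex Gaussian\<close>

lemma Complex_eq_of_real: "Complex x y = of_real x + \<i> * of_real y"
  by (simp add: complex_eq_iff)

lemma measurable_Complex [measurable (raw)]:
  assumes [measurable]: "f \<in> borel_measurable M" "g \<in> borel_measurable M"
  shows "(\<lambda>x. Complex (f x) (g x)) \<in> borel_measurable M"
  unfolding Complex_eq_of_real by measurable

lemma borel_measurable_cnj [measurable]: "cnj \<in> borel_measurable borel"
  by (intro borel_measurable_continuous_onI continuous_intros)

lemma borel_measurable_Re [measurable]: "Re \<in> borel_measurable borel"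
  and borel_measurable_Im [measurable]: "Im \<in> borel_measurable borel"
  by (intro borel_measurable_continuous_onI continuous_intros)+

lemma borel_measurable_Arg [measurable]: "Arg \<in> borel_measurable borel"
proof -
  have "Arg = (\<lambda>z. if z = 0 then 0 else Im (Ln z))"
    by (auto simp: Arg_eq_Im_Ln Arg_zero)
  also have "\<dots> \<in> borel_measurable borel" by measurable
  finally show ?thesis .
qed

interpretation std_normal: prob_space std_normal_distribution
  using real_dist_normal_dist by (rule real_distribution.axioms(1))

interpretation std_normal_pair: pair_prob_space std_normal_distribution std_normal_distribution ..

definition cgauss :: "complex measure" where
  "cgauss = distr (std_normal_distribution \<Otimes>\<^sub>M std_normal_distribution) borel (\<lambda>(x, y). Complex x y)"

lemma sets_cgauss [simp, measurable_cong]: "sets cgauss = sets borel"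
  and space_cgauss [simp]: "space cgauss = UNIV"
  by (simp_all add: cgauss_def)

interpretation cgauss: prob_space cgauss
  unfolding cgauss_def by (rule std_normal_pair.prob_space_distr) measurable

lemma nn_integral_cgauss_iterated:
  assumes [measurable]: "f \<in> borel_measurable borel"
  shows "(\<integral>\<^sup>+z. f z \<partial>cgauss) = (\<integral>\<^sup>+x. \<integral>\<^sup>+y. f (Complex x y) \<partial>std_normal_distribution \<partial>std_normal_distribution)"
proof -
  have "(\<integral>\<^sup>+z. f z \<partial>cgauss) = (\<integral>\<^sup>+p. f (case p of (x, y) \<Rightarrow> Complex x y) \<partial>(std_normal_distribution \<Otimes>\<^sub>M std_normal_distribution))"
    unfolding cgauss_def by (subst nn_integral_distr) auto
  also have "\<dots> = (\<integral>\<^sup>+x. \<integral>\<^sup>+y. f (Complex x y) \<partial>std_normal_distribution \<partial>std_normal_distribution)"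
    by (subst std_normal.nn_integral_fst[symmetric]) auto
  finally show ?thesis .
qed

lemma nn_integral_cgauss:
  assumes [measurable]: "f \<in> borel_measurable borel"
  shows "(\<integral>\<^sup>+z. f z \<partial>cgauss) =
    (\<integral>\<^sup>+x. \<integral>\<^sup>+y. ennreal (exp (- ((norm (Complex x y))\<^sup>2) / 2) / (2 * pi)) * f (Complex x y) \<partial>lborel \<partial>lborel)"
proof -
  have d: "ennreal (std_normal_density x) * (ennreal (std_normal_density y) * c)
      = ennreal (exp (- ((norm (Complex x y))\<^sup>2) / 2) / (2 * pi)) * c" for x y :: real and c
  proof -
    have "std_normal_density x * std_normal_density y = exp (- ((norm (Complex x y))\<^sup>2) / 2) / (2 * pi)"
      unfolding std_normal_density_def
      by (simp add: cmod_power2 field_simps flip: exp_add)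
    then show ?thesis
      by (simp add: mult.assoc[symmetric] ennreal_mult''[symmetric])
  qed
  have "(\<integral>\<^sup>+z. f z \<partial>cgauss) = (\<integral>\<^sup>+x. \<integral>\<^sup>+y. f (Complex x y) \<partial>std_normal_distribution \<partial>std_normal_distribution)"
    by (rule nn_integral_cgauss_iterated) measurable
  also have "\<dots> = (\<integral>\<^sup>+x. ennreal (std_normal_density x) * (\<integral>\<^sup>+y. ennreal (std_normal_density y) * f (Complex x y) \<partial>lborel) \<partial>lborel)"
    by (subst nn_integral_density) (auto intro!: nn_integral_cong simp: nn_integral_density)
  also have "\<dots> = (\<integral>\<^sup>+x. \<integral>\<^sup>+y. ennreal (exp (- ((norm (Complex x y))\<^sup>2) / 2) / (2 * pi)) * f (Complex x y) \<partial>lborel \<partial>lborel)"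
    by (intro nn_integral_cong) (subst nn_integral_cmult[symmetric]; simp add: d)
  finally show ?thesis .
qed

lemma nn_integral_horizontal_shear:
  assumes [measurable]: "case_prod g \<in> borel_measurable (borel \<Otimes>\<^sub>M borel)"
  shows "(\<integral>\<^sup>+x. \<integral>\<^sup>+y. g (x + c * y) y \<partial>lborel \<partial>lborel) = (\<integral>\<^sup>+(x::real). \<integral>\<^sup>+(y::real). g x y \<partial>lborel \<partial>lborel)"
proof -
  have "(\<integral>\<^sup>+x. \<integral>\<^sup>+y. g (x + c * y) y \<partial>lborel \<partial>lborel) = (\<integral>\<^sup>+y. \<integral>\<^sup>+x. g (c * y + 1 * x) y \<partial>lborel \<partial>lborel)"
    by (subst lborel_pair.Fubini') (auto simp: add.commute)
  also have "\<dots> = (\<integral>\<^sup>+y. \<integral>\<^sup>+x. g x y \<partial>lborel \<partial>lborel)"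
  proof (rule nn_integral_cong)
    fix y :: real
    show "(\<integral>\<^sup>+x. g (c * y + 1 * x) y \<partial>lborel) = (\<integral>\<^sup>+x. g x y \<partial>lborel)"
      using nn_integral_real_affine[of "\<lambda>x. g x y" 1 "c * y"] by simp
  qed
  also have "\<dots> = (\<integral>\<^sup>+x. \<integral>\<^sup>+y. g x y \<partial>lborel \<partial>lborel)"
    by (subst lborel_pair.Fubini') auto
  finally show ?thesis .
qed

lemma nn_integral_vertical_shear:
  assumes [measurable]: "case_prod g \<in> borel_measurable (borel \<Otimes>\<^sub>M borel)"
  shows "(\<integral>\<^sup>+x. \<integral>\<^sup>+y. g x (y + c * x) \<partial>lborel \<partial>lborel) = (\<integral>\<^sup>+(x::real). \<integral>\<^sup>+(y::real). g x y \<partial>lborel \<partial>lborel)"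
proof (rule nn_integral_cong)
  fix x :: real
  show "(\<integral>\<^sup>+y. g x (y + c * x) \<partial>lborel) = (\<integral>\<^sup>+y. g x y \<partial>lborel)"
    using nn_integral_real_affine[of "\<lambda>y. g x y" 1 "c * x"] by (simp add: add.commute)
qed

text \<open>A rotation by an angle that is not a multiple of \<open>\<pi>\<close> is a product of three shears, and Lebesgue measure is
  invariant under shears by Fubini and translation invariance.\<close>

lemma nn_integral_rotate:
  assumes [measurable]: "g \<in> borel_measurable borel" and ab: "a\<^sup>2 + b\<^sup>2 = 1" "b \<noteq> 0"
  shows "(\<integral>\<^sup>+x. \<integral>\<^sup>+y. g (Complex a b * Complex x y) \<partial>lborel \<partial>lborel) = (\<integral>\<^sup>+(x::real). \<integral>\<^sup>+(y::real). g (Complex x y) \<partial>lborel \<partial>lborel)"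
proof -
  define c where "c = (a - 1) / b"
  have cb: "c * b = a - 1" using ab by (simp add: c_def)
  have ca: "c * (1 + a) = - b"
    using ab by (simp add: c_def field_simps power2_eq_square)
  have "(\<integral>\<^sup>+(x::real). \<integral>\<^sup>+(y::real). g (Complex x y) \<partial>lborel \<partial>lborel)
      = (\<integral>\<^sup>+(x::real). \<integral>\<^sup>+(y::real). g (Complex (x + c * y) y) \<partial>lborel \<partial>lborel)"
    by (rule nn_integral_horizontal_shear[symmetric]) measurable
  also have "\<dots> = (\<integral>\<^sup>+(x::real). \<integral>\<^sup>+(y::real). g (Complex (x + c * (y + b * x)) (y + b * x)) \<partial>lborel \<partial>lborel)"
    by (rule nn_integral_vertical_shear[symmetric, where g="\<lambda>x y. g (Complex (x + c * y) y)"]) measurable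
  also have "\<dots> = (\<integral>\<^sup>+(x::real). \<integral>\<^sup>+(y::real). g (Complex ((x + c * y) + c * (y + b * (x + c * y))) (y + b * (x + c * y))) \<partial>lborel \<partial>lborel)"
    by (rule nn_integral_horizontal_shear[symmetric, where g="\<lambda>x y. g (Complex (x + c * (y + b * x)) (y + b * x))"]) measurable
  also have "\<dots> = (\<integral>\<^sup>+x. \<integral>\<^sup>+y. g (Complex a b * Complex x y) \<partial>lborel \<partial>lborel)"
  proof (intro nn_integral_cong arg_cong[where f=g])
    fix x y :: real
    have 1: "y + b * (x + c * y) = b * x + a * y"
    proof -
      have "y + b * (x + c * y) = b * x + (1 + c * b) * y" by (simp add: algebra_simps)
      then show ?thesis by (simp add: cb)
    qed
    have "x + c * y + c * (b * x + a * y) = x + (c * b) * x + (c * (1 + a)) * y"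
      by (simp add: algebra_simps)
    also have "\<dots> = a * x - b * y" by (simp only: cb ca) (simp add: algebra_simps)
    finally show "Complex ((x + c * y) + c * (y + b * (x + c * y))) (y + b * (x + c * y)) = Complex a b * Complex x y"
      by (simp add: 1 complex_eq_iff)
  qed
  finally show ?thesis ..
qed

lemma nn_integral_cgauss_rotate:
  assumes f [measurable]: "f \<in> borel_measurable borel" and u: "norm u = 1"
  shows "(\<integral>\<^sup>+z. f (u * z) \<partial>cgauss) = (\<integral>\<^sup>+z. f z \<partial>cgauss)"
proof -
  have *: "(\<integral>\<^sup>+z. f (u * z) \<partial>cgauss) = (\<integral>\<^sup>+z. f z \<partial>cgauss)"
    if [measurable]: "f \<in> borel_measurable borel" and u: "norm u = 1" "Im u \<noteq> 0" for f u
  proof -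
    define g where "g z = ennreal (exp (- ((norm z)\<^sup>2) / 2) / (2 * pi)) * f z" for z
    have [measurable]: "g \<in> borel_measurable borel" unfolding g_def [abs_def] by measurable
    have "(\<integral>\<^sup>+z. f (u * z) \<partial>cgauss) = (\<integral>\<^sup>+x. \<integral>\<^sup>+y. g (Complex (Re u) (Im u) * Complex x y) \<partial>lborel \<partial>lborel)"
      using u by (subst nn_integral_cgauss) (simp_all add: g_def norm_mult)
    also have "\<dots> = (\<integral>\<^sup>+x. \<integral>\<^sup>+y. g (Complex x y) \<partial>lborel \<partial>lborel)"
      using u by (intro nn_integral_rotate) (auto simp flip: cmod_power2)
    also have "\<dots> = (\<integral>\<^sup>+z. f z \<partial>cgauss)"
      by (subst nn_integral_cgauss) (simp_all add: g_def)
    finally show ?thesis .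
  qed
  show ?thesis
  proof (cases "Im u = 0")
    case True
    \<comment> \<open>a real unit is the product of two non-real ones\<close>
    then have "Im (u * - \<i>) \<noteq> 0" using u by (auto simp: complex_eq_iff cmod_def)
    moreover have "norm (u * - \<i>) = 1" using u by (simp add: norm_mult)
    ultimately have "(\<integral>\<^sup>+z. f (\<i> * ((u * - \<i>) * z)) \<partial>cgauss) = (\<integral>\<^sup>+z. f (\<i> * z) \<partial>cgauss)"
      by (intro *[where f="\<lambda>z. f (\<i> * z)"]) auto
    also have "\<dots> = (\<integral>\<^sup>+z. f z \<partial>cgauss)"
      by (intro *) auto
    finally have "(\<integral>\<^sup>+z. f (\<i> * ((u * - \<i>) * z)) \<partial>cgauss) = (\<integral>\<^sup>+z. f z \<partial>cgauss)" .
    moreover have "\<i> * ((u * - \<i>) * z) = u * z" for z by (simp add: complex_eq_iff)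
    ultimately show ?thesis by (simp only:)
  qed (intro * f u)
qed

lemma distr_cgauss_rotate:
  assumes u: "norm u = 1"
  shows "distr cgauss borel (\<lambda>z. u * z) = cgauss"
proof (rule measure_eqI)
  fix A assume "A \<in> sets (distr cgauss borel (\<lambda>z. u * z))"
  then have [measurable]: "A \<in> sets borel" by simp
  have "emeasure (distr cgauss borel (\<lambda>z. u * z)) A = (\<integral>\<^sup>+z. indicator A z \<partial>distr cgauss borel (\<lambda>z. u * z))"
    by (subst nn_integral_indicator) auto
  also have "\<dots> = (\<integral>\<^sup>+z. indicator A (u * z) \<partial>cgauss)"
    by (subst nn_integral_distr) auto
  also have "\<dots> = (\<integral>\<^sup>+z. indicator A z \<partial>cgauss)"
    by (rule nn_integral_cgauss_rotate) (use u in auto)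
  finally show "emeasure (distr cgauss borel (\<lambda>z. u * z)) A = emeasure cgauss A" by simp
qed simp

lemma integral_cgauss_rotate:
  fixes f :: "complex \<Rightarrow> 'b::{banach, second_countable_topology}"
  assumes [measurable]: "f \<in> borel_measurable borel" and u: "norm u = 1"
  shows "(LINT z|cgauss. f (u * z)) = (LINT z|cgauss. f z)"
proof -
  have "(LINT z|cgauss. f z) = (LINT z|distr cgauss borel (\<lambda>z. u * z). f z)"
    using u by (simp only: distr_cgauss_rotate)
  also have "\<dots> = (LINT z|cgauss. f (u * z))" by (rule integral_distr) auto
  finally show ?thesis ..
qed

lemma distr_cgauss_Re: "distr cgauss std_normal_distribution Re = std_normal_distribution"
proof -
  let ?P = "std_normal_distribution \<Otimes>\<^sub>M std_normal_distribution"
  have "distr cgauss std_normal_distribution Re = distr ?P std_normal_distribution (Re \<circ> (\<lambda>(x, y). Complex x y))"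
    unfolding cgauss_def by (rule distr_distr) auto
  also have "Re \<circ> (\<lambda>(x, y). Complex x y) = fst" by auto
  finally show ?thesis by (simp only: std_normal.distr_pair_fst)
qed

lemma cgauss_Re:
  fixes f :: "real \<Rightarrow> real"
  assumes "integrable std_normal_distribution f"
  shows "integrable cgauss (\<lambda>z. f (Re z))" "(LINT z|cgauss. f (Re z)) = (LINT x|std_normal_distribution. f x)"
proof -
  have [measurable]: "f \<in> borel_measurable borel" using assms by (auto dest: borel_measurable_integrable)
  have "integrable (distr cgauss std_normal_distribution Re) f"
    using assms by (simp only: distr_cgauss_Re)
  then show "integrable cgauss (\<lambda>z. f (Re z))" by (rule integrable_distr[rotated]) measurable
  have "(LINT x|distr cgauss std_normal_distribution Re. f x) = (LINT z|cgauss. f (Re z))"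
    by (rule integral_distr) auto
  then show "(LINT z|cgauss. f (Re z)) = (LINT x|std_normal_distribution. f x)"
    by (simp only: distr_cgauss_Re)
qed

text \<open>The imaginary part is the real part after a quarter turn.\<close>

lemma cgauss_Im:
  fixes f :: "real \<Rightarrow> real"
  assumes "integrable std_normal_distribution f"
  shows "integrable cgauss (\<lambda>z. f (Im z))" "(LINT z|cgauss. f (Im z)) = (LINT x|std_normal_distribution. f x)"
proof -
  have [measurable]: "f \<in> borel_measurable borel" using assms by (auto dest: borel_measurable_integrable)
  have "integrable (distr cgauss borel (\<lambda>z. - \<i> * z)) (\<lambda>z. f (Re z))"
    using cgauss_Re(1)[OF assms] by (subst distr_cgauss_rotate) auto
  then have "integrable cgauss (\<lambda>z. f (Re (- \<i> * z)))"
    by (rule integrable_distr[rotated]) measurable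
  then show "integrable cgauss (\<lambda>z. f (Im z))" by simp
  have "(LINT z|cgauss. f (Re (- \<i> * z))) = (LINT z|cgauss. f (Re z))"
    by (rule integral_cgauss_rotate[where f="\<lambda>z. f (Re z)"]) auto
  then show "(LINT z|cgauss. f (Im z)) = (LINT x|std_normal_distribution. f x)"
    using cgauss_Re(2)[OF assms] by simp
qed

lemma cgauss_moment4: "integrable cgauss (\<lambda>z. norm z ^ 4)"
proof (rule Bochner_Integration.integrable_bound[where f="\<lambda>z. 2 * (Re z ^ 4 + Im z ^ 4)"])
  show "integrable cgauss (\<lambda>z. 2 * (Re z ^ 4 + Im z ^ 4))"
    using cgauss_Re(1)[of "\<lambda>x. x ^ 4"] cgauss_Im(1)[of "\<lambda>x. x ^ 4"] integrable_std_normal_distribution_moment[of 4]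
    by simp
  show "AE z in cgauss. norm (norm z ^ 4) \<le> norm (2 * (Re z ^ 4 + Im z ^ 4))"
  proof (rule AE_I2)
    fix z :: complex
    have "norm z ^ 4 = ((norm z)\<^sup>2)\<^sup>2" by simp
    also have "\<dots> = ((Re z)\<^sup>2 + (Im z)\<^sup>2)\<^sup>2" by (simp only: cmod_power2)
    also have "\<dots> \<le> 2 * (((Re z)\<^sup>2)\<^sup>2 + ((Im z)\<^sup>2)\<^sup>2)"
      using sum_squares_bound[of "(Re z)\<^sup>2" "(Im z)\<^sup>2"] by (simp add: power2_sum)
    finally show "norm (norm z ^ 4) \<le> norm (2 * (Re z ^ 4 + Im z ^ 4))"
      by simp
  qed
qed measurable

lemma cgauss_integrable_bound:
  fixes f :: "complex \<Rightarrow> 'b::{banach, second_countable_topology}"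
  assumes [measurable]: "f \<in> borel_measurable borel" and b: "\<And>z. norm (f z) \<le> C * (1 + norm z ^ 4)"
  shows "integrable cgauss f"
proof (rule Bochner_Integration.integrable_bound)
  show "integrable cgauss (\<lambda>z. C * (1 + norm z ^ 4))" using cgauss_moment4 by simp
  show "AE z in cgauss. norm (f z) \<le> norm (C * (1 + norm z ^ 4))"
    using b by (intro AE_I2) (smt (verit) real_norm_def)
qed simp

text \<open>Rotation by a half turn changes the sign of the mean.\<close>

lemma cgauss_mean: "(LINT z|cgauss. z) = 0" "(LINT z|cgauss. cnj z) = 0"
proof -
  have "(LINT z|cgauss. - 1 * z) = (LINT z|cgauss. z)"
    by (rule integral_cgauss_rotate) auto
  then show "(LINT z|cgauss. z) = 0" by simp
  have "(LINT z|cgauss. cnj (- 1 * z)) = (LINT z|cgauss. cnj z)"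
    by (rule integral_cgauss_rotate[where f=cnj]) auto
  then show "(LINT z|cgauss. cnj z) = 0" by simp
qed

text \<open>Rotation by a quarter turn changes the sign of the square.\<close>

lemma cgauss_square: "(LINT z|cgauss. z\<^sup>2) = 0" "(LINT z|cgauss. (cnj z)\<^sup>2) = 0"
proof -
  have "(LINT z|cgauss. (\<i> * z)\<^sup>2) = (LINT z|cgauss. z\<^sup>2)"
    by (rule integral_cgauss_rotate[where f="\<lambda>z. z\<^sup>2"]) auto
  then show "(LINT z|cgauss. z\<^sup>2) = 0" by (simp add: power_mult_distrib)
  have "(LINT z|cgauss. (cnj (\<i> * z))\<^sup>2) = (LINT z|cgauss. (cnj z)\<^sup>2)"
    by (rule integral_cgauss_rotate[where f="\<lambda>z. (cnj z)\<^sup>2"]) auto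
  then show "(LINT z|cgauss. (cnj z)\<^sup>2) = 0" by (simp add: power_mult_distrib)
qed

lemma cgauss_norm2: "(LINT z|cgauss. (norm z)\<^sup>2) = 2"
proof -
  have i: "integrable std_normal_distribution (\<lambda>x. x\<^sup>2)" by (rule integrable_std_normal_distribution_moment)
  have "(LINT x|std_normal_distribution. x\<^sup>2) = 1"
    using std_normal_distribution_even_moments(1)[of 1] by simp
  then show ?thesis
    using cgauss_Re[OF i] cgauss_Im[OF i] by (simp add: cmod_power2)
qed

section \<open>One Gaussian step of the spiral function\<close>

text \<open>For a point with logarithm \<open>\<rho> + i \<theta>\<close> this is \<open>exp (\<kappa> \<rho> + i \<mu> \<theta>)\<close>. For the right
  \<open>\<kappa>\<close> it is harmonic for the joint motion of position and winding angle, compare \<open>spiral_step\<close>.\<close>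

definition spiral :: "complex \<Rightarrow> real \<Rightarrow> complex \<Rightarrow> complex" where
  "spiral \<kappa> \<mu> z = of_real (norm z) powr \<kappa> * cis (\<mu> * Arg z)"

lemma measurable_spiral [measurable]: "spiral \<kappa> \<mu> \<in> borel_measurable borel"
  unfolding spiral_def [abs_def] cis_conv_exp by measurable

lemma norm_spiral [simp]: "norm (spiral \<kappa> \<mu> z) = norm z powr Re \<kappa>"
  by (simp add: spiral_def norm_mult norm_powr_real_powr)

text \<open>Separating the holomorphic from the antiholomorphic dependence reduces the expansion at \<open>1\<close> to the
  binomial series.\<close>

lemma spiral_eq_powr:
  assumes z: "z \<noteq> 0"
  shows "spiral \<kappa> \<mu> z = z powr ((\<kappa> + of_real \<mu>) / 2) * cnj (z powr cnj ((\<kappa> - of_real \<mu>) / 2))"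
proof -
  have L: "Ln z = of_real (ln (norm z)) + \<i> * of_real (Arg z)"
    using z by (simp add: Arg_eq_Im_Ln complex_eq_iff)
  have "spiral \<kappa> \<mu> z = exp (\<kappa> * of_real (ln (norm z)) + \<i> * of_real \<mu> * of_real (Arg z))"
    using z by (simp add: spiral_def powr_def cis_conv_exp exp_add Ln_of_real mult_ac)
  also have "\<dots> = exp ((\<kappa> + of_real \<mu>) / 2 * Ln z + cnj (cnj ((\<kappa> - of_real \<mu>) / 2) * Ln z))"
  proof (rule arg_cong[where f=exp])
    have c: "cnj (cnj ((\<kappa> - of_real \<mu>) / 2) * Ln z) = (\<kappa> - of_real \<mu>) / 2 * (of_real (ln (norm z)) - \<i> * of_real (Arg z))"
      unfolding L by simp
    define a b where "a = (\<kappa> + of_real \<mu>) / 2" and "b = (\<kappa> - of_real \<mu>) / 2"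
    have k: "\<kappa> = a + b" "of_real \<mu> = a - b"
      by (simp_all add: a_def b_def flip: add_divide_distrib diff_divide_distrib)
    have "(a + b) * x + \<i> * (a - b) * y = a * (x + \<i> * y) + b * (x - \<i> * y)" for x y
      by (simp add: algebra_simps)
    from this show "\<kappa> * of_real (ln (norm z)) + \<i> * of_real \<mu> * of_real (Arg z) =
        (\<kappa> + of_real \<mu>) / 2 * Ln z + cnj (cnj ((\<kappa> - of_real \<mu>) / 2) * Ln z)"
      by (subst c) (simp only: a_def[symmetric] b_def[symmetric] L, simp only: k)
  qed
  also have "\<dots> = z powr ((\<kappa> + of_real \<mu>) / 2) * cnj (z powr cnj ((\<kappa> - of_real \<mu>) / 2))"
    using z by (simp add: powr_def exp_add exp_cnj)
  finally show ?thesis .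
qed

lemma powr_one_plus_expansion:
  obtains C where "0 \<le> C"
    "\<And>w::complex. norm w \<le> 1/2 \<Longrightarrow> norm ((1 + w) powr a - (1 + a * w + a * (a - 1) / 2 * w\<^sup>2)) \<le> C * norm w ^ 3"
proof -
  have "summable (\<lambda>n. (a gchoose n) * (3/4) ^ n)"
    using gen_binomial_complex[of "3/4" a] by (simp add: sums_iff)
  then have s: "summable (\<lambda>n. norm ((a gchoose n) * (1/2) ^ n))"
    by (rule powser_insidea) simp
  define C where "C = 8 * (\<Sum>n. norm ((a gchoose (n + 3)) * (1/2) ^ (n + 3)))"
  have s3: "summable (\<lambda>n. norm ((a gchoose (n + 3)) * (1/2) ^ (n + 3)))"
    using s by (rule summable_ignore_initial_segment)
  have C: "0 \<le> C" unfolding C_def using s3 by (intro mult_nonneg_nonneg suminf_nonneg) auto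
  have "norm ((1 + w) powr a - (1 + a * w + a * (a - 1) / 2 * w\<^sup>2)) \<le> C * norm w ^ 3" if w: "norm w \<le> 1/2" for w :: complex
  proof -
    have "(\<lambda>n. (a gchoose n) * w ^ n) sums (1 + w) powr a"
      using w by (intro gen_binomial_complex) simp
    then have "(\<lambda>n. (a gchoose (n + 3)) * w ^ (n + 3)) sums ((1 + w) powr a - (\<Sum>n<3. (a gchoose n) * w ^ n))"
      by (rule sums_split_initial_segment)
    also have "(\<Sum>n<3. (a gchoose n) * w ^ n) = 1 + a * w + a * (a - 1) / 2 * w\<^sup>2"
      by (simp add: numeral_3_eq_3 gbinomial_Suc[of a 1] numeral_2_eq_2 gbinomial_prod_rev lessThan_Suc field_simps)
    finally have *: "(\<lambda>n. (a gchoose (n + 3)) * w ^ (n + 3)) sums ((1 + w) powr a - (1 + a * w + a * (a - 1) / 2 * w\<^sup>2))" .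
    have b: "norm ((a gchoose (n + 3)) * w ^ (n + 3)) \<le> 8 * norm w ^ 3 * norm ((a gchoose (n + 3)) * (1/2) ^ (n + 3))" for n
    proof -
      have "norm w ^ n \<le> (1/2) ^ n" using w by (intro power_mono) auto
      then have "norm (a gchoose (n + 3)) * (norm w ^ n * norm w ^ 3) \<le> norm (a gchoose (n + 3)) * ((1/2) ^ n * norm w ^ 3)"
        by (intro mult_left_mono mult_right_mono) auto
      then show ?thesis by (simp add: norm_mult norm_power norm_divide power_add power_divide mult_ac)
    qed
    have "norm (\<Sum>n. (a gchoose (n + 3)) * w ^ (n + 3)) \<le> (\<Sum>n. 8 * norm w ^ 3 * norm ((a gchoose (n + 3)) * (1/2) ^ (n + 3)))"
      by (rule norm_suminf_le[OF b]) (rule summable_mult[OF s3])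
    also have "\<dots> = C * norm w ^ 3"
      by (subst suminf_mult[OF s3]) (simp add: C_def)
    finally show ?thesis using * by (simp add: sums_iff)
  qed
  with C that show ?thesis by blast
qed

text \<open>The second order Taylor polynomial at \<open>1\<close> of \<open>spiral\<close>, written in \<open>w\<close> and its conjugate; \<open>a\<close> and \<open>b\<close> are
  the exponents of the holomorphic and the antiholomorphic factor.\<close>

definition spiral_taylor :: "complex \<Rightarrow> real \<Rightarrow> complex \<Rightarrow> complex" where
  "spiral_taylor \<kappa> \<mu> w = (let a = (\<kappa> + of_real \<mu>) / 2; b = (\<kappa> - of_real \<mu>) / 2 in
     1 + a * w + b * cnj w + a * (a - 1) / 2 * w\<^sup>2 + b * (b - 1) / 2 * (cnj w)\<^sup>2 + a * b * of_real ((norm w)\<^sup>2))"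

lemma spiral_taylor_near:
  obtains C where "0 \<le> C"
    "\<And>w. norm w \<le> 1/2 \<Longrightarrow> norm (spiral \<kappa> \<mu> (1 + w) - spiral_taylor \<kappa> \<mu> w) \<le> C * norm w ^ 3"
proof -
  define a b where "a = (\<kappa> + of_real \<mu>) / 2" and "b = (\<kappa> - of_real \<mu>) / 2"
  obtain A where A: "0 \<le> A" "\<And>w. norm w \<le> 1/2 \<Longrightarrow> norm ((1 + w) powr a - (1 + a * w + a * (a - 1) / 2 * w\<^sup>2)) \<le> A * norm w ^ 3"
    using powr_one_plus_expansion[of a] by blast
  obtain B where B: "0 \<le> B" "\<And>w. norm w \<le> 1/2 \<Longrightarrow> norm ((1 + w) powr cnj b - (1 + cnj b * w + cnj b * (cnj b - 1) / 2 * w\<^sup>2)) \<le> B * norm w ^ 3"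
    using powr_one_plus_expansion[of "cnj b"] by blast
  \<comment> \<open>\<open>K\<close> collects the remainders of the two factors and the terms of degree three and four of the product\<close>
  define a2 b2 where "a2 = a * (a - 1) / 2" and "b2 = b * (b - 1) / 2"
  define K where "K = A * (1 + norm b + norm b2 + B) + (1 + norm a + norm a2) * B + norm a * norm b2 + norm a2 * norm b + norm a2 * norm b2"
  have K: "0 \<le> K" unfolding K_def using A(1) B(1) by (intro add_nonneg_nonneg mult_nonneg_nonneg) auto
  have "norm (spiral \<kappa> \<mu> (1 + w) - spiral_taylor \<kappa> \<mu> w) \<le> K * norm w ^ 3" if w: "norm w \<le> 1/2" for w
  proof -
    define r where "r = norm w"
    have r: "0 \<le> r" "r \<le> 1" using w by (auto simp: r_def)
    define P P2 Q Q2 where "P = (1 + w) powr a" and "P2 = 1 + a * w + a2 * w\<^sup>2"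
      and "Q = cnj ((1 + w) powr cnj b)" and "Q2 = 1 + b * cnj w + b2 * (cnj w)\<^sup>2"
    have w1: "1 + w \<noteq> 0"
    proof
      assume "1 + w = 0"
      then have "w = - 1" by (simp add: add_eq_0_iff)
      then show False using w by simp
    qed
    have s: "spiral \<kappa> \<mu> (1 + w) = P * Q"
      unfolding spiral_eq_powr[OF w1] P_def Q_def a_def b_def ..
    have P: "norm (P - P2) \<le> A * r ^ 3"
      using A(2)[OF w] by (simp add: P_def P2_def a2_def r_def)
    have Q: "norm (Q - Q2) \<le> B * r ^ 3"
    proof -
      have "norm (Q - Q2) = norm (cnj (Q - Q2))" by (rule complex_mod_cnj[symmetric])
      also have "cnj (Q - Q2) = (1 + w) powr cnj b - (1 + cnj b * w + cnj b * (cnj b - 1) / 2 * w\<^sup>2)"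
        by (simp add: Q_def Q2_def b2_def)
      finally show ?thesis using B(2)[OF w] by (simp add: r_def)
    qed
    have rp: "r ^ n \<le> 1" for n using r by (simp add: power_le_one)
    have nP2: "norm P2 \<le> 1 + norm a + norm a2"
    proof -
      have "norm P2 \<le> 1 + norm a * r + norm a2 * r ^ 2"
        unfolding P2_def r_def by (intro norm_triangle_le add_mono) (auto simp: norm_mult norm_power)
      also have "\<dots> \<le> 1 + norm a * 1 + norm a2 * 1"
        using rp[of 2] r by (intro add_mono mult_left_mono) auto
      finally show ?thesis by simp
    qed
    have nQ2: "norm Q2 \<le> 1 + norm b + norm b2"
    proof -
      have "norm Q2 \<le> 1 + norm b * r + norm b2 * r ^ 2"
        unfolding Q2_def r_def by (intro norm_triangle_le add_mono) (auto simp: norm_mult norm_power)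
      also have "\<dots> \<le> 1 + norm b * 1 + norm b2 * 1"
        using rp[of 2] r by (intro add_mono mult_left_mono) auto
      finally show ?thesis by simp
    qed
    have nQ: "norm Q \<le> 1 + norm b + norm b2 + B"
    proof -
      have "norm Q \<le> norm Q2 + norm (Q - Q2)"
        using norm_triangle_ineq[of Q2 "Q - Q2"] by simp
      also have "norm (Q - Q2) \<le> B * 1" by (rule order_trans[OF Q mult_left_mono[OF rp B(1)]])
      finally show ?thesis using nQ2 by simp
    qed
    have c: "of_real ((norm w)\<^sup>2) = w * cnj w" by (rule complex_norm_square)
    have t: "P2 * Q2 - spiral_taylor \<kappa> \<mu> w = a * b2 * (w * (cnj w)\<^sup>2) + a2 * b * (w\<^sup>2 * cnj w) + a2 * b2 * (w\<^sup>2 * (cnj w)\<^sup>2)"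
      unfolding spiral_taylor_def Let_def a_def[symmetric] b_def[symmetric] a2_def[symmetric] b2_def[symmetric] c P2_def Q2_def
      by (simp add: algebra_simps power2_eq_square)
    have nt: "norm (P2 * Q2 - spiral_taylor \<kappa> \<mu> w) \<le> norm a * norm b2 * r ^ 3 + norm a2 * norm b * r ^ 3 + norm a2 * norm b2 * r ^ 3"
      unfolding t
    proof (intro norm_triangle_le add_mono)
      show "norm (a * b2 * (w * (cnj w)\<^sup>2)) \<le> norm a * norm b2 * r ^ 3"
        by (simp add: norm_mult norm_power r_def power3_eq_cube power2_eq_square)
      show "norm (a2 * b * (w\<^sup>2 * cnj w)) \<le> norm a2 * norm b * r ^ 3"
        by (simp add: norm_mult norm_power r_def power3_eq_cube power2_eq_square)
      have "r ^ 4 \<le> r ^ 3" using r by (intro power_decreasing) auto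
      then have "norm a2 * norm b2 * r ^ 4 \<le> norm a2 * norm b2 * r ^ 3" by (intro mult_left_mono) auto
      then show "norm (a2 * b2 * (w\<^sup>2 * (cnj w)\<^sup>2)) \<le> norm a2 * norm b2 * r ^ 3"
        by (simp add: norm_mult norm_power r_def power4_eq_xxxx power2_eq_square mult_ac)
    qed
    have "norm (P * Q - spiral_taylor \<kappa> \<mu> w) = norm ((P - P2) * Q + P2 * (Q - Q2) + (P2 * Q2 - spiral_taylor \<kappa> \<mu> w))"
      by (simp add: algebra_simps)
    also have "\<dots> \<le> norm (P - P2) * norm Q + norm P2 * norm (Q - Q2) + norm (P2 * Q2 - spiral_taylor \<kappa> \<mu> w)"
      by (intro norm_triangle_le add_mono) (auto simp: norm_mult)
    also have "\<dots> \<le> (A * r ^ 3) * (1 + norm b + norm b2 + B) + (1 + norm a + norm a2) * (B * r ^ 3)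
        + (norm a * norm b2 * r ^ 3 + norm a2 * norm b * r ^ 3 + norm a2 * norm b2 * r ^ 3)"
      using A(1) B(1) r by (intro add_mono mult_mono P Q nP2 nQ nt) auto
    also have "\<dots> = K * r ^ 3" by (simp add: K_def algebra_simps)
    finally show ?thesis by (simp add: s r_def)
  qed
  with K that show ?thesis by blast
qed

text \<open>The remainder is cubic near \<open>0\<close> and of the order \<open>|w|\<^sup>2\<close> far away. The intermediate exponent makes one bound
  valid for all \<open>w\<close>, including the cut of the argument function and the zero of \<open>1 + w\<close>.\<close>

lemma spiral_taylor_bound:
  assumes k: "0 < Re \<kappa>" "Re \<kappa> \<le> 1"
  obtains C where "0 \<le> C" "\<And>w. norm (spiral \<kappa> \<mu> (1 + w) - spiral_taylor \<kappa> \<mu> w) \<le> C * norm w powr (2 + Re \<kappa> / 2)"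
proof -
  define p where "p = 2 + Re \<kappa> / 2"
  obtain C where C: "0 \<le> C" "\<And>w. norm w \<le> 1/2 \<Longrightarrow> norm (spiral \<kappa> \<mu> (1 + w) - spiral_taylor \<kappa> \<mu> w) \<le> C * norm w ^ 3"
    using spiral_taylor_near[of \<kappa> \<mu>] by blast
  define a b where "a = (\<kappa> + of_real \<mu>) / 2" and "b = (\<kappa> - of_real \<mu>) / 2"
  define D where "D = 4 + norm a + norm b + norm (a * (a - 1) / 2) + norm (b * (b - 1) / 2) + norm (a * b)"
  have "norm (spiral \<kappa> \<mu> (1 + w) - spiral_taylor \<kappa> \<mu> w) \<le> (C + 8 * D) * norm w powr p" for w
  proof (cases "norm w \<le> 1/2")
    case True
    have "norm w ^ 3 \<le> norm w powr p"
    proof (cases "w = 0")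
      case False
      have "norm w powr 3 \<le> norm w powr p" using False True k by (intro powr_mono') (auto simp: p_def)
      then show ?thesis using False by (simp add: powr_numeral)
    qed simp
    then have "C * norm w ^ 3 \<le> C * norm w powr p" using C(1) by (intro mult_left_mono)
    moreover have "0 \<le> 8 * D * norm w powr p" by (auto simp: D_def intro!: mult_nonneg_nonneg add_nonneg_nonneg)
    ultimately show ?thesis using C(2)[OF True] by (simp add: algebra_simps)
  next
    case False
    define v where "v = 2 * norm w"
    have v: "v > 1" using False by (simp add: v_def)
    have vp: "v powr p \<le> 8 * norm w powr p"
    proof -
      have "v powr p = 2 powr p * norm w powr p" unfolding v_def by (rule powr_mult)
      moreover have "2 powr p \<le> 2 powr (3::real)" using k by (intro powr_mono) (auto simp: p_def)
      ultimately show ?thesis by (simp add: mult_right_mono)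
    qed
    have m: "v powr q \<le> v powr p" if "q \<le> p" for q using v that by (intro powr_mono) auto
    have m0: "1 \<le> v powr p" using m[of 0] v k by (simp add: p_def)
    have m1: "norm w \<le> v powr p" using m[of 1] v k by (simp add: p_def v_def)
    have m2: "(norm w)\<^sup>2 \<le> v powr p"
    proof -
      have "v powr 2 \<le> v powr p" using k by (intro m) (auto simp: p_def)
      moreover have "v powr 2 = 4 * (norm w)\<^sup>2" using v by (simp add: powr_numeral v_def power_mult_distrib)
      ultimately show ?thesis using zero_le_power2[of "norm w"] by linarith
    qed
    have "norm (1 + w) powr Re \<kappa> \<le> (3 * v powr p)"
    proof -
      have "norm (1 + w) \<le> 3 * v" using norm_triangle_ineq[of 1 w] v by (simp add: v_def)
      then have "norm (1 + w) powr Re \<kappa> \<le> (3 * v) powr Re \<kappa>" using k by (intro powr_mono2) auto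
      also have "\<dots> \<le> (3 * v) powr 1" using k v by (intro powr_mono) auto
      also have "\<dots> \<le> 3 * v powr p" using m[of 1] v k by (simp add: p_def)
      finally show ?thesis .
    qed
    moreover have "norm (spiral_taylor \<kappa> \<mu> w) \<le> 1 * v powr p + norm a * v powr p + norm b * v powr p
       + norm (a * (a - 1) / 2) * v powr p + norm (b * (b - 1) / 2) * v powr p + norm (a * b) * v powr p"
    proof -
      have "norm (spiral_taylor \<kappa> \<mu> w) \<le> 1 * 1 + norm a * norm w + norm b * norm w
       + norm (a * (a - 1) / 2) * (norm w)\<^sup>2 + norm (b * (b - 1) / 2) * (norm w)\<^sup>2 + norm (a * b) * (norm w)\<^sup>2"
        unfolding spiral_taylor_def Let_def a_def[symmetric] b_def[symmetric]
        by (intro norm_triangle_le add_mono) (simp_all add: norm_mult norm_power norm_divide)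
      also have "\<dots> \<le> 1 * v powr p + norm a * v powr p + norm b * v powr p
       + norm (a * (a - 1) / 2) * v powr p + norm (b * (b - 1) / 2) * v powr p + norm (a * b) * v powr p"
        by (intro add_mono mult_left_mono m0 m1 m2) auto
      finally show ?thesis .
    qed
    ultimately have "norm (spiral \<kappa> \<mu> (1 + w) - spiral_taylor \<kappa> \<mu> w) \<le> D * v powr p"
      using norm_triangle_ineq4[of "spiral \<kappa> \<mu> (1 + w)" "spiral_taylor \<kappa> \<mu> w"]
      by (simp add: D_def algebra_simps)
    also have "\<dots> \<le> D * (8 * norm w powr p)"
      using vp by (intro mult_left_mono) (auto simp: D_def intro!: add_nonneg_nonneg)
    also have "\<dots> \<le> (C + 8 * D) * norm w powr p" using C(1) by (simp add: algebra_simps)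
    finally show ?thesis .
  qed
  moreover have "0 \<le> C + 8 * D" using C(1) by (auto simp: D_def intro!: add_nonneg_nonneg)
  ultimately show ?thesis using that unfolding p_def by blast
qed

lemma le_one_plus_power4: "x \<le> 1 + x ^ 4" for x :: real
proof (cases "x \<le> 1")
  case True
  moreover have "0 \<le> x ^ 4" by simp
  ultimately show ?thesis by linarith
next
  case False
  then have "x ^ 1 \<le> x ^ 4" by (intro power_increasing) auto
  then show ?thesis by simp
qed

lemma power2_le_one_plus_power4: "x\<^sup>2 \<le> 1 + x ^ 4" for x :: real
proof -
  have "0 \<le> (x\<^sup>2 - 1)\<^sup>2" by simp
  moreover have "(x\<^sup>2 - 1)\<^sup>2 = x ^ 4 - 2 * x\<^sup>2 + 1" by (simp add: power2_diff)
  moreover have "0 \<le> x\<^sup>2" by simp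
  ultimately show ?thesis by linarith
qed

lemma integrable_cgauss_moments:
  "integrable cgauss (\<lambda>z. z)" "integrable cgauss cnj" "integrable cgauss (\<lambda>z. z\<^sup>2)"
  "integrable cgauss (\<lambda>z. (cnj z)\<^sup>2)" "integrable cgauss (\<lambda>z. (norm z)\<^sup>2)"
  by (rule cgauss_integrable_bound[where C=1];
      simp add: norm_power le_one_plus_power4 power2_le_one_plus_power4)+

text \<open>Since \<open>E z = E z\<^sup>2 = 0\<close>, only the mixed term survives. Its coefficient is a quarter of
  \<open>\<kappa>\<^sup>2 - \<mu>\<^sup>2\<close>, the Laplacian of the spiral function at \<open>1\<close>.\<close>

lemma integral_spiral_taylor:
  "integrable cgauss (\<lambda>z. spiral_taylor \<kappa> \<mu> (c * z))"
  "(LINT z|cgauss. spiral_taylor \<kappa> \<mu> (c * z)) = 1 + (\<kappa>\<^sup>2 - (of_real \<mu>)\<^sup>2) / 2 * of_real ((norm c)\<^sup>2)"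
proof -
  define a b where "a = (\<kappa> + of_real \<mu>) / 2" and "b = (\<kappa> - of_real \<mu>) / 2"
  have e: "spiral_taylor \<kappa> \<mu> (c * z) = 1 + a * c * z + b * cnj c * cnj z + a * (a - 1) / 2 * c\<^sup>2 * z\<^sup>2
     + b * (b - 1) / 2 * (cnj c)\<^sup>2 * (cnj z)\<^sup>2 + a * b * of_real ((norm c)\<^sup>2) * of_real ((norm z)\<^sup>2)" for z
    unfolding spiral_taylor_def Let_def a_def[symmetric] b_def[symmetric]
    by (simp add: norm_mult power_mult_distrib mult.assoc)
  have i: "integrable cgauss (\<lambda>z. of_real ((norm z)\<^sup>2) :: complex)"
    using integrable_cgauss_moments(5) by (rule integrable_of_real)
  note ii = integrable_cgauss_moments(1-4) i
  show "integrable cgauss (\<lambda>z. spiral_taylor \<kappa> \<mu> (c * z))"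
    unfolding e by (intro Bochner_Integration.integrable_add integrable_mult_right ii) auto
  have "(LINT z|cgauss. spiral_taylor \<kappa> \<mu> (c * z)) = 1 + a * c * (LINT z|cgauss. z) + b * cnj c * (LINT z|cgauss. cnj z)
      + a * (a - 1) / 2 * c\<^sup>2 * (LINT z|cgauss. z\<^sup>2) + b * (b - 1) / 2 * (cnj c)\<^sup>2 * (LINT z|cgauss. (cnj z)\<^sup>2)
      + a * b * of_real ((norm c)\<^sup>2) * (LINT z|cgauss. of_real ((norm z)\<^sup>2))"
    unfolding e
    by (simp only: Bochner_Integration.integral_add Bochner_Integration.integrable_add integrable_mult_right ii
        integral_mult_right_zero cgauss.integrable_const cgauss.prob_space lebesgue_integral_const scaleR_one cgauss.finite_measure_axioms)
  also have "\<dots> = 1 + 2 * (a * b) * of_real ((norm c)\<^sup>2)"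
    by (simp only: integral_complex_of_real cgauss_mean cgauss_square cgauss_norm2) simp
  also have "2 * (a * b) = (\<kappa>\<^sup>2 - (of_real \<mu>)\<^sup>2) / 2"
  proof -
    have "(\<kappa> + of_real \<mu>) * (\<kappa> - of_real \<mu>) = \<kappa>\<^sup>2 - (of_real \<mu>)\<^sup>2"
      by (simp add: algebra_simps power2_eq_square)
    then show ?thesis by (simp add: a_def b_def)
  qed
  finally show "(LINT z|cgauss. spiral_taylor \<kappa> \<mu> (c * z)) = 1 + (\<kappa>\<^sup>2 - (of_real \<mu>)\<^sup>2) / 2 * of_real ((norm c)\<^sup>2)" .
qed

lemma powr_le_one_plus: "0 \<le> x \<Longrightarrow> 0 \<le> k \<Longrightarrow> k \<le> 1 \<Longrightarrow> x powr k \<le> 1 + x" for x k :: real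
proof (cases "x \<le> 1")
  case True
  assume "0 \<le> x" "0 \<le> k"
  with True have "x powr k \<le> 1" by (intro powr_le1) auto
  with \<open>0 \<le> x\<close> show ?thesis by simp
next
  case False
  assume "k \<le> 1"
  with False have "x powr k \<le> x powr 1" by (intro powr_mono) auto
  with False show ?thesis by simp
qed

lemma integrable_cgauss_powr:
  assumes "0 \<le> p" "p \<le> 4"
  shows "integrable cgauss (\<lambda>z. norm z powr p)"
proof (rule cgauss_integrable_bound[where C=1])
  fix z :: complex
  show "norm (norm z powr p) \<le> 1 * (1 + norm z ^ 4)"
  proof (cases "norm z \<le> 1")
    case True
    then have "norm z powr p \<le> 1" using assms by (intro powr_le1) auto
    moreover have "0 \<le> norm z ^ 4" by simp
    ultimately have "norm z powr p \<le> 1 + norm z ^ 4" by linarith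
    then show ?thesis by simp
  next
    case False
    then have "norm z powr p \<le> norm z powr 4" using assms by (intro powr_mono) auto
    also have "\<dots> = norm z ^ 4" using False by (simp add: powr_numeral)
    finally show ?thesis by simp
  qed
qed simp

lemma integrable_spiral:
  assumes k: "0 < Re \<kappa>" "Re \<kappa> \<le> 1"
  shows "integrable cgauss (\<lambda>z. spiral \<kappa> \<mu> (d + c * z))"
proof (rule cgauss_integrable_bound[where C="1 + norm d + norm c"])
  fix z
  have "norm (spiral \<kappa> \<mu> (d + c * z)) \<le> 1 + norm (d + c * z)"
    using k by (simp add: powr_le_one_plus)
  also have "\<dots> \<le> 1 + norm d + norm c * norm z"
    using norm_triangle_ineq[of d "c * z"] by (simp add: norm_mult)
  also have "\<dots> \<le> (1 + norm d) * (1 + norm z ^ 4) + norm c * (1 + norm z ^ 4)"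
    using le_one_plus_power4[of "norm z"]
    by (intro add_mono mult_left_mono) (auto simp: mult_ge1_I algebra_simps)
  finally show "norm (spiral \<kappa> \<mu> (d + c * z)) \<le> (1 + norm d + norm c) * (1 + norm z ^ 4)"
    by (simp add: algebra_simps)
qed simp

lemma exp_remainder_powr:
  assumes p: "2 \<le> p" "p \<le> 4"
  shows "norm (1 - \<i> * of_real x - exp (- (\<i> * of_real x))) \<le> 3 * \<bar>x\<bar> powr (p / 2)"
proof (cases "\<bar>x\<bar> \<le> 1")
  case True
  have "norm (exp (\<i> * of_real (- x)) - (\<Sum>k\<le>1. (\<i> * of_real (- x)) ^ k / fact k)) \<le> \<bar>- x\<bar> ^ Suc 1 / fact (Suc 1)"
    by (rule iexp_approx1)
  then have "norm (exp (- (\<i> * of_real x)) - (1 - \<i> * of_real x)) \<le> \<bar>x\<bar>\<^sup>2 / 2"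
    by (simp add: numeral_2_eq_2)
  also have "\<dots> \<le> \<bar>x\<bar> powr 2" by (cases "x = 0") (auto simp: powr_numeral)
  also have "\<dots> \<le> \<bar>x\<bar> powr (p / 2)" using True p by (intro powr_mono') auto
  also have "\<dots> \<le> 3 * \<bar>x\<bar> powr (p / 2)" by simp
  finally show ?thesis by (simp add: norm_minus_commute)
next
  case False
  have "norm (1 - \<i> * of_real x - exp (- (\<i> * of_real x))) \<le> norm (1::complex) + norm (\<i> * of_real x) + norm (exp (- (\<i> * of_real x)))"
    by (intro norm_triangle_le_diff add_mono norm_triangle_ineq4) auto
  also have "\<dots> = 2 + \<bar>x\<bar>" by (simp add: norm_mult)
  also have "\<dots> \<le> 3 * \<bar>x\<bar> powr 1" using False by simp
  also have "\<dots> \<le> 3 * \<bar>x\<bar> powr (p / 2)" using False p by (intro mult_left_mono powr_mono) auto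
  finally show ?thesis .
qed

text \<open>The relation between \<open>\<kappa>\<close> and \<open>\<mu>\<close> is chosen so that the first order change of the Gaussian mean cancels the
  first order change of the phase that the drift produces in the same time.\<close>

lemma spiral_step:
  assumes k: "0 < Re \<kappa>" "Re \<kappa> \<le> 1" and \<kappa>: "\<kappa>\<^sup>2 = (of_real \<mu>)\<^sup>2 - \<i> * of_real (\<beta> * \<mu>)"
  obtains C where "0 \<le> C"
    "\<And>c. norm (exp (\<i> * of_real (\<beta> * \<mu> * (norm c)\<^sup>2 / 2)) * (LINT z|cgauss. spiral \<kappa> \<mu> (1 + c * z)) - 1)
         \<le> C * norm c powr (2 + Re \<kappa> / 2)"
proof -
  define p where "p = 2 + Re \<kappa> / 2"
  obtain A where A: "0 \<le> A" "\<And>w. norm (spiral \<kappa> \<mu> (1 + w) - spiral_taylor \<kappa> \<mu> w) \<le> A * norm w powr p"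
    using spiral_taylor_bound[OF k, of \<mu>] unfolding p_def by blast
  define M where "M = (LINT z|cgauss. norm z powr p)"
  have M: "0 \<le> M" unfolding M_def by (intro integral_nonneg_AE) auto
  have ip: "integrable cgauss (\<lambda>z. norm z powr p)" using k by (intro integrable_cgauss_powr) (auto simp: p_def)
  define B where "B = 3 * \<bar>\<beta> * \<mu> / 2\<bar> powr (p / 2)"
  have "norm (exp (\<i> * of_real (\<beta> * \<mu> * (norm c)\<^sup>2 / 2)) * (LINT z|cgauss. spiral \<kappa> \<mu> (1 + c * z)) - 1)
         \<le> (A * M + B) * norm c powr p" for c
  proof -
    define x where "x = \<beta> * \<mu> * (norm c)\<^sup>2 / 2"
    define m where "m = (LINT z|cgauss. spiral \<kappa> \<mu> (1 + c * z))"
    have t: "(LINT z|cgauss. spiral_taylor \<kappa> \<mu> (c * z)) = 1 - \<i> * of_real x"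
      unfolding integral_spiral_taylor \<kappa> by (simp add: x_def)
    have "norm (m - (1 - \<i> * of_real x)) = norm (LINT z|cgauss. spiral \<kappa> \<mu> (1 + c * z) - spiral_taylor \<kappa> \<mu> (c * z))"
      unfolding m_def t[symmetric]
      by (subst Bochner_Integration.integral_diff[OF integrable_spiral[OF k] integral_spiral_taylor(1)]) simp
    also have "\<dots> \<le> (LINT z|cgauss. A * norm c powr p * norm z powr p)"
    proof (rule Bochner_Integration.integral_norm_bound_integral)
      show "integrable cgauss (\<lambda>z. spiral \<kappa> \<mu> (1 + c * z) - spiral_taylor \<kappa> \<mu> (c * z))"
        by (intro Bochner_Integration.integrable_diff integrable_spiral k integral_spiral_taylor)
      show "integrable cgauss (\<lambda>z. A * norm c powr p * norm z powr p)"
        using ip by (intro integrable_mult_right) auto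
      show "norm (spiral \<kappa> \<mu> (1 + c * z) - spiral_taylor \<kappa> \<mu> (c * z)) \<le> A * norm c powr p * norm z powr p" for z
        using A(2)[of "c * z"] by (simp add: norm_mult powr_mult mult.assoc)
    qed
    also have "\<dots> = A * M * norm c powr p" by (simp add: M_def)
    finally have 1: "norm (m - (1 - \<i> * of_real x)) \<le> A * M * norm c powr p" .
    have 2: "norm (1 - \<i> * of_real x - exp (- (\<i> * of_real x))) \<le> B * norm c powr p"
    proof -
      have "\<bar>x\<bar> powr (p / 2) = \<bar>\<beta> * \<mu> / 2\<bar> powr (p / 2) * ((norm c)\<^sup>2) powr (p / 2)"
        unfolding x_def by (subst powr_mult[symmetric]) (auto simp: abs_mult)
      also have "((norm c)\<^sup>2) powr (p / 2) = norm c powr p"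
        by (cases "c = 0") (auto simp: powr_powr simp flip: powr_numeral)
      finally have "3 * \<bar>x\<bar> powr (p / 2) = B * norm c powr p" by (simp add: B_def)
      then show ?thesis using exp_remainder_powr[of p x] k by (simp add: p_def)
    qed
    have "exp (\<i> * of_real x) * m - 1 = exp (\<i> * of_real x) * (m - exp (- (\<i> * of_real x)))"
      by (simp add: algebra_simps flip: exp_add)
    then have "norm (exp (\<i> * of_real x) * m - 1) = norm (m - exp (- (\<i> * of_real x)))"
      by (simp add: norm_mult)
    also have "\<dots> \<le> norm (m - (1 - \<i> * of_real x)) + norm (1 - \<i> * of_real x - exp (- (\<i> * of_real x)))"
      by norm
    finally show ?thesis using 1 2 unfolding x_def m_def by (simp add: algebra_simps)
  qed
  moreover have "0 \<le> A * M + B" using A(1) M by (simp add: B_def)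
  ultimately show ?thesis using that unfolding p_def by blast
qed

section \<open>Discrete winding along a single path\<close>

text \<open>Euler scheme for the initial phase \<open>a\<close> plus the angle through which the drift turns a particle that is seen
  at the points \<open>\<rho> j\<close>.\<close>

definition phase :: "real \<Rightarrow> real \<Rightarrow> real \<Rightarrow> (nat \<Rightarrow> complex) \<Rightarrow> nat \<Rightarrow> real" where
  "phase \<beta> h a \<rho> i = a + (\<Sum>j<i. \<beta> * h / (norm (\<rho> j))\<^sup>2)"

text \<open>The increments of the noise are seen in the frame that turns with the drift.\<close>

definition walk :: "complex \<Rightarrow> (nat \<Rightarrow> real) \<Rightarrow> (nat \<Rightarrow> complex) \<Rightarrow> nat \<Rightarrow> complex" where
  "walk y\<^sub>0 \<alpha> \<xi> i = y\<^sub>0 + (\<Sum>j<i. of_real (sqrt 2) * cis (- \<alpha> j) * \<xi> j)"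

text \<open>Discrete counterpart of the total winding angle: the winding of the walk in the turning frame plus the
  winding of the frame. The latter is computed from the walk and not from the path, so that the pair
  consisting of the walk and its turning is a Markov chain.\<close>

definition turning :: "real \<Rightarrow> real \<Rightarrow> (nat \<Rightarrow> complex) \<Rightarrow> nat \<Rightarrow> real" where
  "turning \<beta> h y i = (\<Sum>j<i. Arg (y (Suc j) / y j) + \<beta> * h / (norm (y j))\<^sup>2)"

lemma phase_0 [simp]: "phase \<beta> h a \<rho> 0 = a"
  and phase_Suc: "phase \<beta> h a \<rho> (Suc i) = phase \<beta> h a \<rho> i + \<beta> * h / (norm (\<rho> i))\<^sup>2"
  by (simp_all add: phase_def)

lemma walk_0 [simp]: "walk y\<^sub>0 \<alpha> \<xi> 0 = y\<^sub>0"
  and walk_Suc: "walk y\<^sub>0 \<alpha> \<xi> (Suc i) = walk y\<^sub>0 \<alpha> \<xi> i + of_real (sqrt 2) * cis (- \<alpha> i) * \<xi> i"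
  by (simp_all add: walk_def)

lemma turning_0 [simp]: "turning \<beta> h y 0 = 0"
  and turning_Suc: "turning \<beta> h y (Suc i) = turning \<beta> h y i + (Arg (y (Suc i) / y i) + \<beta> * h / (norm (y i))\<^sup>2)"
  by (simp_all add: turning_def)

lemma cis_eq_imp_eq:
  assumes "cis x = cis y" "\<bar>x - y\<bar> < 2 * pi"
  shows "x = y"
proof -
  have "cis (x - y) = 1" using assms(1) by (simp flip: cis_divide)
  then have "cos (x - y) = 1" by (simp add: complex_eq_iff)
  then obtain n :: int where n: "x - y = of_int n * 2 * pi" by (auto simp: cos_one_2pi_int)
  with assms(2) have "\<bar>of_int n * 2 * pi\<bar> < 2 * pi" by simp
  then have "\<bar>real_of_int n\<bar> < 1" by (simp add: abs_mult)
  then have "n = 0" by linarith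
  with n show ?thesis by simp
qed

lemma abs_Arg_le:
  assumes "norm (q - 1) \<le> 1/4"
  shows "\<bar>Arg q\<bar> \<le> 2 * norm (q - 1)"
proof -
  have "q \<noteq> 0" using assms by auto
  then have "\<bar>Arg q\<bar> = \<bar>Im (Ln (1 + (q - 1)))\<bar>" by (simp add: Arg_eq_Im_Ln)
  also have "\<dots> \<le> norm (Ln (1 + (q - 1)))" by (rule abs_Im_le_cmod)
  also have "\<dots> \<le> 2 * norm (q - 1)" using assms by (intro norm_Ln_le) simp
  finally show ?thesis .
qed

lemma sgn_eq_cis_Arg: "z \<noteq> 0 \<Longrightarrow> sgn z = cis (Arg z)"
  using cis_Arg by metis

lemma norm_cis_remainder: "norm (cis (- x) - 1 + \<i> * of_real x) \<le> x\<^sup>2"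
proof -
  have "norm (exp (\<i> * of_real (- x)) - (\<Sum>k\<le>1. (\<i> * of_real (- x)) ^ k / fact k)) \<le> \<bar>- x\<bar> ^ Suc 1 / fact (Suc 1)"
    by (rule iexp_approx1)
  then have "norm (cis (- x) - 1 + \<i> * of_real x) \<le> x\<^sup>2 / 2"
    by (simp add: numeral_2_eq_2 cis_conv_exp algebra_simps)
  then show ?thesis using zero_le_power2[of x] by linarith
qed

lemma norm_cis_minus_1: "norm (cis x - 1) \<le> \<bar>x\<bar>"
proof -
  have "norm (exp (\<i> * of_real x) - (\<Sum>k\<le>0. (\<i> * of_real x) ^ k / fact k)) \<le> \<bar>x\<bar> ^ Suc 0 / fact (Suc 0)"
    by (rule iexp_approx1)
  then show ?thesis by (simp add: cis_conv_exp)
qed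

lemma norm_triangle3:
  "norm x \<le> a \<Longrightarrow> norm y \<le> b \<Longrightarrow> norm z \<le> c \<Longrightarrow> norm (x + y - z) \<le> a + b + c"
  for x y z :: "'a::real_normed_vector"
  using norm_triangle_ineq4[of "x + y" z] norm_triangle_ineq[of x y] by linarith

text \<open>In the frame rotated by the phase the drift cancels to first order in \<open>h\<close>. What remains in each step is
  \<open>h\<close> times the oscillation of the path and of the drift over one step, and these errors add up to \<open>t\<close> times
  that oscillation.\<close>

lemma walk_tracks_path:
  fixes r w :: "real \<Rightarrow> complex" and a \<beta> c K \<eta> h t :: real
  assumes h: "0 < h" "h \<le> \<eta>" "real n * h = t" and c: "0 < c"
    and r: "\<And>s. 0 \<le> s \<Longrightarrow> s \<le> t \<Longrightarrow> c \<le> norm (r s)" "\<And>s. 0 \<le> s \<Longrightarrow> s \<le> t \<Longrightarrow> norm (r s) \<le> K"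
    and osc_r: "\<And>s s'. 0 \<le> s \<Longrightarrow> s \<le> t \<Longrightarrow> 0 \<le> s' \<Longrightarrow> s' \<le> t \<Longrightarrow> \<bar>s' - s\<bar> \<le> h \<Longrightarrow> norm (r s' - r s) \<le> \<eta>"
    and osc_g: "\<And>s s'. 0 \<le> s \<Longrightarrow> s \<le> t \<Longrightarrow> 0 \<le> s' \<Longrightarrow> s' \<le> t \<Longrightarrow> \<bar>s' - s\<bar> \<le> h \<Longrightarrow>
        norm (\<i> * of_real \<beta> / cnj (r s') - \<i> * of_real \<beta> / cnj (r s)) \<le> \<eta>"
    and cont: "continuous_on {0..t} r"
    and sde: "\<And>s. 0 \<le> s \<Longrightarrow> s \<le> t \<Longrightarrow>
        r s = r 0 + integral {0..s} (\<lambda>u. \<i> * of_real \<beta> / cnj (r u)) + of_real (sqrt 2) * w s"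
    and w0: "w 0 = 0"
    and i: "i \<le> n"
  defines "\<rho> \<equiv> (\<lambda>j. r (real j * h))" and "\<xi> \<equiv> (\<lambda>j. w (real (Suc j) * h) - w (real j * h))"
  defines "\<alpha> \<equiv> phase \<beta> h a \<rho>"
  defines "y \<equiv> walk (cis (- a) * r 0) \<alpha> \<xi>"
  shows "norm (y i - cis (- \<alpha> i) * \<rho> i) \<le> real i * h * (\<eta> * (K * (\<bar>\<beta>\<bar> / c\<^sup>2)\<^sup>2 + \<bar>\<beta>\<bar> / c\<^sup>2 + 1))"
  using i
proof (induction i)
  case 0
  then show ?case by (simp add: y_def \<alpha>_def \<rho>_def)
next
  case (Suc i)
  define B where "B = \<bar>\<beta>\<bar> / c\<^sup>2"
  define g where "g u = \<i> * of_real \<beta> / cnj (r u)" for u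
  have B: "0 \<le> B" by (simp add: B_def)
  define s s' where "s = real i * h" and "s' = real (Suc i) * h"
  have ss: "s' = s + h" by (simp add: s_def s'_def algebra_simps)
  have s: "0 \<le> s" "s \<le> s'" "s' \<le> t"
  proof -
    show "0 \<le> s" "s \<le> s'" using h by (simp_all add: s_def ss)
    have "real (Suc i) * h \<le> real n * h" using Suc.prems h by (intro mult_right_mono) auto
    then show "s' \<le> t" using h by (simp add: s'_def)
  qed
  have K: "0 \<le> K" using r[of 0] s c by force
  define \<delta> where "\<delta> = \<beta> * h / (norm (r s))\<^sup>2"
  have cr: "c\<^sup>2 \<le> (norm (r s))\<^sup>2" using r(1)[of s] s c by (intro power_mono) auto
  have rs0: "r s \<noteq> 0" using r(1)[of s] s c by auto
  have \<delta>: "\<bar>\<delta>\<bar> \<le> B * h"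
  proof -
    have "\<bar>\<delta>\<bar> = \<bar>\<beta>\<bar> * h / (norm (r s))\<^sup>2" using h by (simp add: \<delta>_def abs_mult)
    also have "\<dots> \<le> \<bar>\<beta>\<bar> * h / c\<^sup>2" using cr c h rs0 by (intro divide_left_mono mult_pos_pos) auto
    finally show ?thesis by (simp add: B_def)
  qed
  have g_cont: "continuous_on {0..t} g"
  proof -
    have "r u \<noteq> 0" if "u \<in> {0..t}" for u using r(1)[of u] that c by auto
    then show ?thesis unfolding g_def by (intro continuous_intros cont) auto
  qed
  then have g_int: "g integrable_on {u..v}" if "0 \<le> u" "v \<le> t" for u v
    using that by (intro integrable_continuous_interval) (auto intro: continuous_on_subset)
  have noise: "of_real (sqrt 2) * \<xi> i = r s' - r s - integral {s..s'} g"
  proof -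
    have "integral {0..s} g + integral {s..s'} g = integral {0..s'} g"
      using s by (intro Henstock_Kurzweil_Integration.integral_combine g_int) auto
    moreover have "\<xi> i = w s' - w s" by (simp only: \<xi>_def s_def s'_def)
    moreover have "r s = r 0 + integral {0..s} g + of_real (sqrt 2) * w s"
      unfolding g_def using s by (intro sde) auto
    moreover have "r s' = r 0 + integral {0..s'} g + of_real (sqrt 2) * w s'"
      unfolding g_def using s by (intro sde) auto
    ultimately show ?thesis by (simp only: right_diff_distrib) (simp add: algebra_simps)
  qed
  have osc: "norm (integral {s..s'} g - of_real h * g s) \<le> h * \<eta>"
  proof -
    have "integral {s..s'} g - of_real h * g s = integral {s..s'} (\<lambda>u. g u - g s)"
    proof -
      have "integral {s..s'} (\<lambda>u. g u - g s) = integral {s..s'} g - integral {s..s'} (\<lambda>u. g s)"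
        using s by (intro Henstock_Kurzweil_Integration.integral_diff g_int) auto
      also have "integral {s..s'} (\<lambda>u. g s) = of_real h * g s"
        using s by (simp add: ss scaleR_conv_of_real)
      finally show ?thesis ..
    qed
    also have "norm \<dots> \<le> \<eta> * (s' - s)"
    proof (rule integral_bound)
      show "continuous_on {s..s'} (\<lambda>u. g u - g s)"
        using s by (intro continuous_intros continuous_on_subset[OF g_cont]) auto
      fix u assume "u \<in> {s..s'}"
      then show "norm (g u - g s) \<le> \<eta>"
        unfolding g_def using s by (intro osc_g) (auto simp: ss)
    qed (use s in simp)
    finally show ?thesis by (simp add: ss mult.commute)
  qed
  have hg: "\<i> * of_real \<delta> * r s = of_real h * g s"
  proof -
    have "of_real ((norm (r s))\<^sup>2) = r s * cnj (r s)" by (rule complex_norm_square)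
    then show ?thesis using rs0 by (simp add: \<delta>_def g_def field_simps)
  qed
  have step: "y (Suc i) - cis (- \<alpha> (Suc i)) * \<rho> (Suc i) =
     (y i - cis (- \<alpha> i) * \<rho> i) + cis (- \<alpha> i) * (r s' - r s - integral {s..s'} g - (cis (- \<delta>) * r s' - r s))"
  proof -
    have "\<alpha> (Suc i) = \<alpha> i + \<delta>" by (simp add: \<alpha>_def phase_Suc \<delta>_def \<rho>_def s_def)
    then have "cis (- \<alpha> (Suc i)) = cis (- \<alpha> i) * cis (- \<delta>)" by (simp add: cis_mult)
    moreover have "y (Suc i) = y i + cis (- \<alpha> i) * (of_real (sqrt 2) * \<xi> i)"
      by (simp add: y_def walk_Suc)
    moreover have "\<rho> i = r s" "\<rho> (Suc i) = r s'" by (simp_all only: \<rho>_def s_def s'_def)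
    ultimately show ?thesis unfolding noise by (simp add: algebra_simps)
  qed
  have "r s' - r s - integral {s..s'} g - (cis (- \<delta>) * r s' - r s) =
      - ((cis (- \<delta>) - 1 + \<i> * of_real \<delta>) * r s') + \<i> * of_real \<delta> * (r s' - r s) - (integral {s..s'} g - of_real h * g s)"
    unfolding hg[symmetric] by (simp add: algebra_simps)
  also have "norm \<dots> \<le> (B * h)\<^sup>2 * K + (B * h) * \<eta> + h * \<eta>"
  proof -
    have 1: "norm ((cis (- \<delta>) - 1 + \<i> * of_real \<delta>) * r s') \<le> (B * h)\<^sup>2 * K"
    proof -
      have "norm (cis (- \<delta>) - 1 + \<i> * of_real \<delta>) \<le> (B * h)\<^sup>2"
        using norm_cis_remainder[of \<delta>] power_mono[OF \<delta>, of 2] by simp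
      then show ?thesis unfolding norm_mult using r(2)[of s'] s by (intro mult_mono) auto
    qed
    have 2: "norm (\<i> * of_real \<delta> * (r s' - r s)) \<le> (B * h) * \<eta>"
    proof -
      have "norm (r s' - r s) \<le> \<eta>" using s h by (intro osc_r) (auto simp: ss)
      then have "\<bar>\<delta>\<bar> * norm (r s' - r s) \<le> (B * h) * \<eta>" using \<delta> B h by (intro mult_mono) auto
      then show ?thesis by (simp add: norm_mult)
    qed
    from 1 2 osc show ?thesis by (intro norm_triangle3) (simp_all only: norm_minus_cancel)
  qed
  also have "\<dots> \<le> h * (\<eta> * (K * B\<^sup>2 + B + 1))"
  proof -
    have "(B * h)\<^sup>2 * K = (h * (K * B\<^sup>2)) * h" by (simp add: power2_eq_square)
    also have "\<dots> \<le> (h * (K * B\<^sup>2)) * \<eta>" using h K by (intro mult_left_mono) auto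
    finally show ?thesis by (simp add: algebra_simps)
  qed
  finally have "norm (y (Suc i) - cis (- \<alpha> (Suc i)) * \<rho> (Suc i)) \<le>
     norm (y i - cis (- \<alpha> i) * \<rho> i) + h * (\<eta> * (K * B\<^sup>2 + B + 1))"
    unfolding step by (intro norm_triangle_le add_mono) (auto simp: norm_mult)
  also have "\<dots> \<le> real i * h * (\<eta> * (K * B\<^sup>2 + B + 1)) + h * (\<eta> * (K * B\<^sup>2 + B + 1))"
    using Suc.IH Suc.prems by (simp add: B_def)
  also have "\<dots> = real (Suc i) * h * (\<eta> * (K * B\<^sup>2 + B + 1))"
    by (simp only: of_nat_Suc distrib_right mult_1)
  finally show ?case by (simp only: B_def)
qed

text \<open>The discrete angle, corrected for the replacement of the path by the walk in the drift term, and the true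
  angle differ by an argument of \<open>q = cis \<alpha> * y / \<rho>\<close>, which is close to \<open>1\<close>. The difference could be off by a
  multiple of \<open>2 \<pi>\<close>, but it starts at \<open>0\<close> and moves by less than a full turn in each step.\<close>

lemma turning_tracks_angle:
  fixes r w :: "real \<Rightarrow> complex" and \<theta> :: "real \<Rightarrow> real" and a \<beta> c K \<eta> h t :: real
  assumes h: "0 < h" "h \<le> \<eta>" "real n * h = t" and c: "0 < c"
    and r: "\<And>s. 0 \<le> s \<Longrightarrow> s \<le> t \<Longrightarrow> c \<le> norm (r s)" "\<And>s. 0 \<le> s \<Longrightarrow> s \<le> t \<Longrightarrow> norm (r s) \<le> K"
    and osc_r: "\<And>s s'. 0 \<le> s \<Longrightarrow> s \<le> t \<Longrightarrow> 0 \<le> s' \<Longrightarrow> s' \<le> t \<Longrightarrow> \<bar>s' - s\<bar> \<le> h \<Longrightarrow> norm (r s' - r s) \<le> \<eta>"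
    and osc_g: "\<And>s s'. 0 \<le> s \<Longrightarrow> s \<le> t \<Longrightarrow> 0 \<le> s' \<Longrightarrow> s' \<le> t \<Longrightarrow> \<bar>s' - s\<bar> \<le> h \<Longrightarrow>
        norm (\<i> * of_real \<beta> / cnj (r s') - \<i> * of_real \<beta> / cnj (r s)) \<le> \<eta>"
    and osc_\<theta>: "\<And>s s'. 0 \<le> s \<Longrightarrow> s \<le> t \<Longrightarrow> 0 \<le> s' \<Longrightarrow> s' \<le> t \<Longrightarrow> \<bar>s' - s\<bar> \<le> h \<Longrightarrow> \<bar>\<theta> s' - \<theta> s\<bar> \<le> \<eta>"
    and cont: "continuous_on {0..t} r"
    and sde: "\<And>s. 0 \<le> s \<Longrightarrow> s \<le> t \<Longrightarrow>
        r s = r 0 + integral {0..s} (\<lambda>u. \<i> * of_real \<beta> / cnj (r u)) + of_real (sqrt 2) * w s"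
    and w0: "w 0 = 0"
    and polar: "\<And>s. 0 \<le> s \<Longrightarrow> s \<le> t \<Longrightarrow> r s = of_real (norm (r s)) * cis (\<theta>\<^sub>0 + \<theta> s)"
    and \<theta>0: "\<theta> 0 = 0"
  defines "B \<equiv> \<bar>\<beta>\<bar> / c\<^sup>2"
  defines "D \<equiv> t * (K * B\<^sup>2 + B + 1)"
  assumes small: "D * \<eta> \<le> c / 4" "(1 + K * B + 2 * D) * (2 / c) * \<eta> \<le> 1/4" "B * \<eta> + \<eta> \<le> 1/2"
  defines "\<rho> \<equiv> (\<lambda>j. r (real j * h))" and "\<xi> \<equiv> (\<lambda>j. w (real (Suc j) * h) - w (real j * h))"
  defines "y \<equiv> walk (cis (- a) * r 0) (phase \<beta> h a \<rho>) \<xi>"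
  shows "\<bar>turning \<beta> h y n - \<theta> t\<bar> \<le> (2 * D / c + 12 * t * \<bar>\<beta>\<bar> * K * D / c ^ 4) * \<eta>"
proof -
  define \<alpha> where "\<alpha> = phase \<beta> h a \<rho>"
  have t: "0 \<le> t" using h by (metis less_eq_real_def mult_nonneg_nonneg of_nat_0_le_iff)
  have \<eta>: "0 < \<eta>" using h by simp
  have B: "0 \<le> B" by (simp add: B_def)
  have K: "c \<le> K" using r[of 0] t by simp
  have D: "0 \<le> D" unfolding D_def using t K c B by (intro mult_nonneg_nonneg add_nonneg_nonneg) auto
  have time: "0 \<le> real i * h" "real i * h \<le> t" if "i \<le> n" for i
    using that h by (auto simp flip: h(3) intro!: mult_right_mono)
  have \<rho>: "c \<le> norm (\<rho> i)" "norm (\<rho> i) \<le> K" if "i \<le> n" for i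
    using r time[OF that] by (simp_all add: \<rho>_def)
  have \<rho>0: "\<rho> i \<noteq> 0" if "i \<le> n" for i using \<rho>(1)[OF that] c by auto
  have track: "norm (y i - cis (- \<alpha> i) * \<rho> i) \<le> D * \<eta>" if i: "i \<le> n" for i
  proof -
    have "norm (y i - cis (- \<alpha> i) * \<rho> i) \<le> real i * h * (\<eta> * (K * (\<bar>\<beta>\<bar> / c\<^sup>2)\<^sup>2 + \<bar>\<beta>\<bar> / c\<^sup>2 + 1))"
      unfolding y_def \<alpha>_def \<rho>_def \<xi>_def
      by (rule walk_tracks_path[OF h c r osc_r osc_g cont sde w0 i])
    also have "\<dots> \<le> t * (\<eta> * (K * B\<^sup>2 + B + 1))"
      unfolding B_def[symmetric] using time[OF i] \<eta> B K c by (intro mult_right_mono) auto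
    finally show ?thesis by (simp add: D_def mult_ac)
  qed
  define q where "q i = cis (\<alpha> i) * y i / \<rho> i" for i
  have q1: "norm (q i - 1) \<le> D * \<eta> / c" if i: "i \<le> n" for i
  proof -
    have "q i - 1 = cis (\<alpha> i) * (y i - cis (- \<alpha> i) * \<rho> i) / \<rho> i"
      using \<rho>0[OF i] by (simp add: q_def field_simps cis_mult)
    then have "norm (q i - 1) = norm (y i - cis (- \<alpha> i) * \<rho> i) / norm (\<rho> i)"
      by (simp add: norm_mult norm_divide)
    also have "\<dots> \<le> D * \<eta> / c"
      using track[OF i] \<rho>(1)[OF i] c mult_nonneg_nonneg[OF D less_imp_le[OF \<eta>]] by (intro frac_le) auto
    finally show ?thesis .
  qed
  have Dc: "D * \<eta> / c \<le> 1/4" using small(1) c by (simp add: field_simps)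
  have Argq: "\<bar>Arg (q i)\<bar> \<le> 2 * (D * \<eta> / c)" if i: "i \<le> n" for i
    using abs_Arg_le[of "q i"] q1[OF i] Dc by linarith
  have ylow: "c / 2 \<le> norm (y i)" and yup: "\<bar>norm (y i) - norm (\<rho> i)\<bar> \<le> D * \<eta>" if i: "i \<le> n" for i
  proof -
    have "\<bar>norm (y i) - norm (cis (- \<alpha> i) * \<rho> i)\<bar> \<le> D * \<eta>"
      using norm_triangle_ineq3[of "y i" "cis (- \<alpha> i) * \<rho> i"] track[OF i] by simp
    then show u: "\<bar>norm (y i) - norm (\<rho> i)\<bar> \<le> D * \<eta>" by (simp add: norm_mult)
    show "c / 2 \<le> norm (y i)" using u \<rho>(1)[OF i] small(1) c by linarith
  qed
  have y0: "y i \<noteq> 0" if "i \<le> n" for i using ylow[OF that] c by auto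
  have \<delta>: "\<bar>\<beta> * h / (norm (\<rho> i))\<^sup>2\<bar> \<le> B * \<eta>" if i: "i \<le> n" for i
  proof -
    have "c\<^sup>2 \<le> (norm (\<rho> i))\<^sup>2" using \<rho>(1)[OF i] c by (intro power_mono) auto
    then have "\<bar>\<beta>\<bar> * h / (norm (\<rho> i))\<^sup>2 \<le> \<bar>\<beta>\<bar> * \<eta> / c\<^sup>2"
      using h c by (intro frac_le mult_left_mono mult_nonneg_nonneg) auto
    then show ?thesis using h by (simp add: B_def abs_mult)
  qed
  have \<alpha>Suc: "\<alpha> (Suc i) = \<alpha> i + \<beta> * h / (norm (\<rho> i))\<^sup>2" for i by (simp add: \<alpha>_def phase_Suc)
  have yArg: "\<bar>Arg (y (Suc i) / y i)\<bar> \<le> 1/2" if i: "Suc i \<le> n" for i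
  proof -
    let ?d = "\<beta> * h / (norm (\<rho> i))\<^sup>2"
    have "norm (cis (- \<alpha> (Suc i)) * \<rho> (Suc i) - cis (- \<alpha> i) * \<rho> i) = norm (cis (- \<alpha> i) * (cis (- ?d) * \<rho> (Suc i) - \<rho> i))"
    proof -
      have "cis (- \<alpha> (Suc i)) = cis (- \<alpha> i) * cis (- ?d)" by (simp add: \<alpha>Suc cis_mult)
      then show ?thesis by (simp only: right_diff_distrib mult.assoc)
    qed
    also have "\<dots> = norm (cis (- ?d) * \<rho> (Suc i) - \<rho> i)"
      by (simp only: norm_mult norm_cis mult_1)
    also have "cis (- ?d) * \<rho> (Suc i) - \<rho> i = (\<rho> (Suc i) - \<rho> i) + (cis (- ?d) - 1) * \<rho> (Suc i)"
      by (simp add: algebra_simps)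
    also have "norm ((\<rho> (Suc i) - \<rho> i) + (cis (- ?d) - 1) * \<rho> (Suc i)) \<le> \<eta> + (B * \<eta>) * K"
    proof (intro norm_triangle_le add_mono)
      show "norm (\<rho> (Suc i) - \<rho> i) \<le> \<eta>"
        unfolding \<rho>_def using time[of i] time[of "Suc i"] i h by (intro osc_r) (auto simp: algebra_simps)
      show "norm ((cis (- ?d) - 1) * \<rho> (Suc i)) \<le> (B * \<eta>) * K"
        unfolding norm_mult using norm_cis_minus_1[of "- ?d"] \<delta>[of i] \<rho>(2)[OF i] i mult_nonneg_nonneg[OF B less_imp_le[OF \<eta>]]
        by (intro mult_mono) auto
    qed
    finally have 1: "norm (cis (- \<alpha> (Suc i)) * \<rho> (Suc i) - cis (- \<alpha> i) * \<rho> i) \<le> \<eta> + (B * \<eta>) * K" .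
    have "y (Suc i) - y i = (y (Suc i) - cis (- \<alpha> (Suc i)) * \<rho> (Suc i))
        + (cis (- \<alpha> (Suc i)) * \<rho> (Suc i) - cis (- \<alpha> i) * \<rho> i) - (y i - cis (- \<alpha> i) * \<rho> i)" by simp
    also have "norm \<dots> \<le> D * \<eta> + (\<eta> + (B * \<eta>) * K) + D * \<eta>"
      using track[of i] track[of "Suc i"] i 1 by (intro norm_triangle3) auto
    finally have 2: "norm (y (Suc i) - y i) \<le> (1 + K * B + 2 * D) * \<eta>" by (simp add: algebra_simps)
    have "y (Suc i) / y i - 1 = (y (Suc i) - y i) / y i" using y0[of i] i by (simp add: field_simps)
    then have "norm (y (Suc i) / y i - 1) = norm (y (Suc i) - y i) / norm (y i)" by (simp add: norm_divide)
    also have "\<dots> \<le> ((1 + K * B + 2 * D) * \<eta>) / (c / 2)" using 2 ylow[of i] i c order_trans[OF norm_ge_zero 2] by (intro frac_le) auto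
    also have "\<dots> \<le> 1/4" using small(2) by (simp add: mult_ac)
    finally have "norm (y (Suc i) / y i - 1) \<le> 1/4" .
    with abs_Arg_le[OF this] show ?thesis by linarith
  qed
  define S where "S i = (\<Sum>j<i. Arg (y (Suc j) / y j))" for i
  have cisS: "sgn (y i) = sgn (y 0) * cis (S i)" if "i \<le> n" for i
    using that
  proof (induction i)
    case (Suc i)
    have "sgn (y (Suc i)) = sgn (y i) * sgn (y (Suc i) / y i)"
      using y0[of i] y0[of "Suc i"] Suc.prems by (simp add: sgn_eq norm_divide)
    also have "sgn (y (Suc i) / y i) = cis (Arg (y (Suc i) / y i))"
      using y0[of i] y0[of "Suc i"] Suc.prems by (intro sgn_eq_cis_Arg) auto
    finally show ?case using Suc by (simp add: S_def cis_mult[symmetric] mult.assoc)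
  qed (simp add: S_def)
  define E where "E i = S i + (\<alpha> i - a) - \<theta> (real i * h)" for i
  have cisE: "cis (E i) = cis (Arg (q i))" if i: "i \<le> n" for i
  proof -
    have sr: "sgn (\<rho> i) = cis (\<theta>\<^sub>0 + \<theta> (real i * h))"
    proof -
      have "sgn (\<rho> i) = sgn (of_real (norm (\<rho> i)) * cis (\<theta>\<^sub>0 + \<theta> (real i * h)))"
        using polar[OF time[OF i]] by (simp add: \<rho>_def)
      also have "\<dots> = cis (\<theta>\<^sub>0 + \<theta> (real i * h))"
        using \<rho>0[OF i] by (simp add: sgn_eq norm_mult)
      finally show ?thesis .
    qed
    have sy: "sgn (y 0) = cis (\<theta>\<^sub>0 - a)"
    proof -
      have "y 0 = of_real (norm (r 0)) * cis (\<theta>\<^sub>0 - a)"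
        using polar[of 0] t \<theta>0 by (metis (no_types, lifting) y_def walk_0 add.right_neutral cis_mult diff_conv_add_uminus mult.left_commute add.commute order_refl)
      moreover have "r 0 \<noteq> 0" using r(1)[of 0] t c by auto
      ultimately show ?thesis by (simp add: sgn_eq norm_mult)
    qed
    have "cis (Arg (q i)) = sgn (q i)"
      using y0[OF i] \<rho>0[OF i] by (intro sgn_eq_cis_Arg[symmetric]) (simp add: q_def)
    also have "\<dots> = cis (\<alpha> i) * sgn (y i) / sgn (\<rho> i)"
      by (simp add: q_def sgn_eq norm_mult norm_divide)
    also have "\<dots> = cis (\<alpha> i + (\<theta>\<^sub>0 - a) + S i - (\<theta>\<^sub>0 + \<theta> (real i * h)))"
      unfolding cisS[OF i] sr sy by (simp add: cis_mult cis_divide algebra_simps)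
    also have "\<dots> = cis (E i)" by (simp add: E_def algebra_simps)
    finally show ?thesis ..
  qed
  have E: "E i = Arg (q i)" if "i \<le> n" for i
    using that
  proof (induction i)
    case 0
    have "y 0 = cis (- a) * \<rho> 0" by (simp add: y_def \<rho>_def)
    then have "q 0 = 1" using \<rho>0[of 0] by (simp add: q_def \<alpha>_def cis_mult field_simps)
    then show ?case using \<theta>0 by (simp add: E_def S_def \<alpha>_def)
  next
    case (Suc i)
    have "\<bar>\<theta> (real (Suc i) * h) - \<theta> (real i * h)\<bar> \<le> \<eta>"
      using time[of i] time[of "Suc i"] Suc.prems h by (intro osc_\<theta>) (auto simp: algebra_simps)
    moreover have "E (Suc i) - E i = Arg (y (Suc i) / y i) + \<beta> * h / (norm (\<rho> i))\<^sup>2 - (\<theta> (real (Suc i) * h) - \<theta> (real i * h))"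
      by (simp add: E_def S_def \<alpha>Suc)
    ultimately have "\<bar>E (Suc i) - E i\<bar> \<le> 1"
      using yArg[OF Suc.prems] \<delta>[of i] Suc.prems small(3) by linarith
    moreover have "\<bar>E i\<bar> \<le> 1"
    proof -
      have "E i = Arg (q i)" "i \<le> n" using Suc by simp_all
      then show ?thesis using Argq[of i] Dc by linarith
    qed
    moreover have "\<bar>Arg (q (Suc i))\<bar> \<le> 1" using Argq[OF Suc.prems] Dc by linarith
    ultimately have "\<bar>E (Suc i) - Arg (q (Suc i))\<bar> < 2 * pi" using pi_gt3 by linarith
    with cisE[OF Suc.prems] show ?case by (rule cis_eq_imp_eq)
  qed
  have T: "turning \<beta> h y n - \<theta> t = E n + (\<Sum>j<n. \<beta> * h / (norm (y j))\<^sup>2 - \<beta> * h / (norm (\<rho> j))\<^sup>2)"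
    using h(3) by (simp add: turning_def E_def S_def \<alpha>_def phase_def sum.distrib sum_subtractf)
  have "\<bar>\<Sum>j<n. \<beta> * h / (norm (y j))\<^sup>2 - \<beta> * h / (norm (\<rho> j))\<^sup>2\<bar> \<le> (\<Sum>j<n. h * (12 * \<bar>\<beta>\<bar> * K * D / c ^ 4 * \<eta>))"
  proof (intro order_trans[OF sum_abs] sum_mono)
    fix j assume "j \<in> {..<n}"
    then have j: "j \<le> n" by simp
    define u v where "u = norm (y j)" and "v = norm (\<rho> j)"
    have uv: "c / 2 \<le> u" "c \<le> v" "v \<le> K" "\<bar>u - v\<bar> \<le> D * \<eta>" "u \<le> 2 * K"
      using ylow[OF j] \<rho>[OF j] yup[OF j] small(1) K c by (auto simp: u_def v_def)
    have u0: "0 < u" "0 < v" using uv c by auto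
    have "\<beta> * h / u\<^sup>2 - \<beta> * h / v\<^sup>2 = \<beta> * h * ((v - u) * (v + u)) / (u\<^sup>2 * v\<^sup>2)"
      using u0 by (simp add: field_simps power2_eq_square)
    then have "\<bar>\<beta> * h / u\<^sup>2 - \<beta> * h / v\<^sup>2\<bar> = \<bar>\<beta>\<bar> * h * (\<bar>u - v\<bar> * (v + u)) / (u\<^sup>2 * v\<^sup>2)"
      using u0 h by (simp add: abs_mult abs_minus_commute)
    also have "\<dots> \<le> \<bar>\<beta>\<bar> * h * ((D * \<eta>) * (3 * K)) / ((c / 2)\<^sup>2 * c\<^sup>2)"
      using uv u0 c h D \<eta> K
      by (intro frac_le mult_left_mono mult_mono power_mono mult_nonneg_nonneg) auto
    also have "\<dots> = h * (12 * \<bar>\<beta>\<bar> * K * D / c ^ 4 * \<eta>)"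
      using c by (simp add: field_simps power2_eq_square power4_eq_xxxx)
    finally show "\<bar>\<beta> * h / (norm (y j))\<^sup>2 - \<beta> * h / (norm (\<rho> j))\<^sup>2\<bar> \<le> h * (12 * \<bar>\<beta>\<bar> * K * D / c ^ 4 * \<eta>)"
      by (simp add: u_def v_def)
  qed
  also have "\<dots> = t * (12 * \<bar>\<beta>\<bar> * K * D / c ^ 4 * \<eta>)" by (simp flip: h(3))
  finally have "\<bar>\<Sum>j<n. \<beta> * h / (norm (y j))\<^sup>2 - \<beta> * h / (norm (\<rho> j))\<^sup>2\<bar> \<le> t * (12 * \<bar>\<beta>\<bar> * K * D / c ^ 4 * \<eta>)" .
  moreover have "\<bar>E n\<bar> \<le> 2 * (D * \<eta> / c)" using E[of n] Argq[of n] by simp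
  ultimately have "\<bar>turning \<beta> h y n - \<theta> t\<bar> \<le> 2 * (D * \<eta> / c) + t * (12 * \<bar>\<beta>\<bar> * K * D / c ^ 4 * \<eta>)"
    unfolding T by linarith
  then show ?thesis by (simp add: algebra_simps)
qed

lemma uniform_osc:
  fixes f :: "real \<Rightarrow> 'b::real_normed_vector"
  assumes "continuous_on {0..t} f" "0 < e"
  obtains d where "0 < d"
    "\<And>s s'. 0 \<le> s \<Longrightarrow> s \<le> t \<Longrightarrow> 0 \<le> s' \<Longrightarrow> s' \<le> t \<Longrightarrow> \<bar>s' - s\<bar> < d \<Longrightarrow> norm (f s' - f s) \<le> e"
proof -
  have "uniformly_continuous_on {0..t} f"
    using assms(1) by (intro compact_uniformly_continuous) auto
  then obtain d where "0 < d" "\<And>x x'. x \<in> {0..t} \<Longrightarrow> x' \<in> {0..t} \<Longrightarrow> dist x' x < d \<Longrightarrow> dist (f x') (f x) < e"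
    using assms(2) unfolding uniformly_continuous_on_def by metis
  then show ?thesis using that[of d] by (simp add: dist_norm less_imp_le)
qed

lemma turning_tendsto_angle:
  fixes r w :: "real \<Rightarrow> complex" and \<theta> :: "real \<Rightarrow> real" and a \<beta> t :: real
  assumes t: "0 < t"
    and cont: "continuous_on {0..t} r" and cont_\<theta>: "continuous_on {0..t} \<theta>"
    and r0: "\<And>s. 0 \<le> s \<Longrightarrow> s \<le> t \<Longrightarrow> r s \<noteq> 0"
    and sde: "\<And>s. 0 \<le> s \<Longrightarrow> s \<le> t \<Longrightarrow>
        r s = r 0 + integral {0..s} (\<lambda>u. \<i> * of_real \<beta> / cnj (r u)) + of_real (sqrt 2) * w s"
    and polar: "\<And>s. 0 \<le> s \<Longrightarrow> s \<le> t \<Longrightarrow> r s = of_real (norm (r s)) * cis (\<theta>\<^sub>0 + \<theta> s)"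
    and \<theta>0: "\<theta> 0 = 0"
  shows "(\<lambda>n. let h = t / real n in
     turning \<beta> h (walk (cis (- a) * r 0) (phase \<beta> h a (\<lambda>j. r (real j * h)))
       (\<lambda>j. w (real (Suc j) * h) - w (real j * h))) n) \<longlonglongrightarrow> \<theta> t"
proof -
  have w0: "w 0 = 0" using sde[of 0] t by simp
  have contg: "continuous_on {0..t} (\<lambda>u. \<i> * of_real \<beta> / cnj (r u))"
    using r0 by (intro continuous_intros cont) auto
  obtain c where c: "0 < c" "\<And>s. 0 \<le> s \<Longrightarrow> s \<le> t \<Longrightarrow> c \<le> norm (r s)"
  proof -
    have "\<exists>x\<in>{0..t}. \<forall>y\<in>{0..t}. norm (r x) \<le> norm (r y)"
      using t by (intro continuous_attains_inf continuous_intros cont) auto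
    then obtain x where "x \<in> {0..t}" "\<forall>y\<in>{0..t}. norm (r x) \<le> norm (r y)" by blast
    then show ?thesis using that[of "norm (r x)"] r0[of x] by auto
  qed
  obtain K where K: "\<And>s. 0 \<le> s \<Longrightarrow> s \<le> t \<Longrightarrow> norm (r s) \<le> K"
  proof -
    have "\<exists>x\<in>{0..t}. \<forall>y\<in>{0..t}. norm (r y) \<le> norm (r x)"
      using t by (intro continuous_attains_sup continuous_intros cont) auto
    then obtain x where "\<forall>y\<in>{0..t}. norm (r y) \<le> norm (r x)" by blast
    then show ?thesis using that[of "norm (r x)"] by auto
  qed
  have cK: "c \<le> K" using c(2)[of 0] K[of 0] t by simp
  define B where "B = \<bar>\<beta>\<bar> / c\<^sup>2"
  define D where "D = t * (K * B\<^sup>2 + B + 1)"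
  define L where "L = 2 * D / c + 12 * t * \<bar>\<beta>\<bar> * K * D / c ^ 4"
  have B: "0 \<le> B" by (simp add: B_def)
  have D: "0 \<le> D" unfolding D_def using t cK c B by (intro mult_nonneg_nonneg add_nonneg_nonneg) auto
  have L: "0 \<le> L" unfolding L_def using t cK c D by (intro mult_nonneg_nonneg add_nonneg_nonneg divide_nonneg_nonneg) auto
  show ?thesis
  proof (rule LIMSEQ_I)
    fix e :: real assume e: "0 < e"
    \<comment> \<open>\<open>\<eta> = 1 / M\<close> satisfies each smallness condition because \<open>M\<close> exceeds each of the required ratios\<close>
    define Q1 Q2 where "Q1 = D / (c / 4)" and "Q2 = (1 + K * B + 2 * D) * (2 / c) * 4"
    define M where "M = 1 + Q1 + Q2 + 2 * (B + 1) + 2 * L / e"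
    define \<eta> where "\<eta> = 1 / M"
    have Q: "0 \<le> Q1" "0 \<le> Q2" "0 \<le> 2 * L / e"
      using c cK D B L e by (auto simp: Q1_def Q2_def intro!: mult_nonneg_nonneg add_nonneg_nonneg divide_nonneg_nonneg)
    have M: "1 \<le> M" using Q B by (simp add: M_def)
    have \<eta>: "0 < \<eta>" using M by (simp add: \<eta>_def)
    have le1: "x * \<eta> \<le> 1" if "x \<le> M" for x using that M by (simp add: \<eta>_def)
    have Q1: "Q1 * \<eta> \<le> 1" and Q2: "Q2 * \<eta> \<le> 1" and BB: "2 * (B + 1) * \<eta> \<le> 1" and LL: "2 * L / e * \<eta> \<le> 1"
      by (rule le1; use Q B in \<open>simp add: M_def\<close>)+
    have small: "D * \<eta> \<le> c / 4" "(1 + K * B + 2 * D) * (2 / c) * \<eta> \<le> 1/4" "B * \<eta> + \<eta> \<le> 1/2"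
      using Q1 Q2 BB c by (simp_all add: Q1_def Q2_def field_simps)
    have Le: "L * \<eta> < e" using LL e L \<eta> by (simp add: field_simps)
    obtain d1 where d1: "0 < d1" "\<And>s s'. 0 \<le> s \<Longrightarrow> s \<le> t \<Longrightarrow> 0 \<le> s' \<Longrightarrow> s' \<le> t \<Longrightarrow> \<bar>s' - s\<bar> < d1 \<Longrightarrow> norm (r s' - r s) \<le> \<eta>"
      using uniform_osc[OF cont \<eta>] by blast
    obtain d2 where d2: "0 < d2" "\<And>s s'. 0 \<le> s \<Longrightarrow> s \<le> t \<Longrightarrow> 0 \<le> s' \<Longrightarrow> s' \<le> t \<Longrightarrow> \<bar>s' - s\<bar> < d2 \<Longrightarrow>
        norm (\<i> * of_real \<beta> / cnj (r s') - \<i> * of_real \<beta> / cnj (r s)) \<le> \<eta>"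
      using uniform_osc[OF contg \<eta>] by blast
    obtain d3 where d3: "0 < d3" "\<And>s s'. 0 \<le> s \<Longrightarrow> s \<le> t \<Longrightarrow> 0 \<le> s' \<Longrightarrow> s' \<le> t \<Longrightarrow> \<bar>s' - s\<bar> < d3 \<Longrightarrow> norm (\<theta> s' - \<theta> s) \<le> \<eta>"
      using uniform_osc[OF cont_\<theta> \<eta>] by blast
    have "(\<lambda>n. t / real n) \<longlonglongrightarrow> 0" by (rule lim_const_over_n)
    moreover have "0 < Min {\<eta>, d1, d2, d3}" using \<eta> d1 d2 d3 by simp
    ultimately have "\<forall>\<^sub>F n in sequentially. dist (t / real n) 0 < Min {\<eta>, d1, d2, d3}"
      by (rule tendstoD)
    then obtain N where N: "\<And>n. N \<le> n \<Longrightarrow> dist (t / real n) 0 < Min {\<eta>, d1, d2, d3}"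
      by (auto simp only: eventually_sequentially)
    show "\<exists>no. \<forall>n\<ge>no. norm ((let h = t / real n in
     turning \<beta> h (walk (cis (- a) * r 0) (phase \<beta> h a (\<lambda>j. r (real j * h)))
       (\<lambda>j. w (real (Suc j) * h) - w (real j * h))) n) - \<theta> t) < e"
    proof (intro exI[of _ "Suc N"] allI impI)
      fix n assume n: "Suc N \<le> n"
      define h where "h = t / real n"
      have h: "0 < h" "h < \<eta>" "h < d1" "h < d2" "h < d3" "real n * h = t"
        using N[of n] n t by (auto simp: h_def)
      have "\<bar>turning \<beta> h (walk (cis (- a) * r 0) (phase \<beta> h a (\<lambda>j. r (real j * h)))
       (\<lambda>j. w (real (Suc j) * h) - w (real j * h))) n - \<theta> t\<bar> \<le>
          (2 * D / c + 12 * t * \<bar>\<beta>\<bar> * K * D / c ^ 4) * \<eta>"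
        unfolding D_def B_def
        by (rule turning_tracks_angle[OF h(1) less_imp_le[OF h(2)] h(6) c(1) c(2) K _ _ _ cont sde w0 polar \<theta>0])
          (use h d1(2) d2(2) d3(2) small in \<open>auto simp: D_def B_def\<close>)
      with Le show "norm ((let h = t / real n in
     turning \<beta> h (walk (cis (- a) * r 0) (phase \<beta> h a (\<lambda>j. r (real j * h)))
       (\<lambda>j. w (real (Suc j) * h) - w (real j * h))) n) - \<theta> t) < e"
        by (simp add: L_def h_def Let_def)
    qed
  qed
qed

section \<open>Inverse moments of Gaussian variables in the plane\<close>

text \<open>The value \<open>\<infinity>\<close> at \<open>0\<close> (where \<open>powr\<close> would give \<open>0\<close>) turns a finite mean into the statement that the origin
  is almost surely not hit.\<close>

definition inv_powr :: "real \<Rightarrow> real \<Rightarrow> ennreal" where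
  "inv_powr q x = (if x = 0 then \<infinity> else ennreal (\<bar>x\<bar> powr (- q)))"

lemma measurable_inv_powr [measurable]: "inv_powr q \<in> borel_measurable borel"
  unfolding inv_powr_def [abs_def] by measurable

lemma inv_powr_integral_finite:
  assumes q: "0 < q" "q < 1" and c: "0 < c"
  shows "(\<integral>\<^sup>+u. inv_powr q u * indicator {-c..c} u \<partial>lborel) < \<infinity>"
proof -
  let ?f = "\<lambda>u::real. u powr (- q)"
  let ?F = "\<lambda>u::real. u powr (1 - q) / (1 - q)"
  have F: "(?F has_real_derivative ?f u) (at u)" if "0 < u" for u
    using that q by (auto intro!: derivative_eq_intros)
  have A: "(?F \<longlongrightarrow> 0) (at_right 0)" using q by real_asymp
  have B: "(?F \<longlongrightarrow> ?F c) (at_left c)"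
    using DERIV_isCont[OF F[OF c]] by (simp add: isCont_def filterlim_at_split)
  have "set_integrable lborel (einterval (ereal 0) (ereal c)) ?f"
    by (rule interval_integral_FTC_nonneg[where F="?F" and A=0 and B="?F c"])
       (use c A B F in \<open>auto simp: tendsto_real_of_ereal_iff intro!: continuous_intros\<close>)
  then have i: "integrable lborel (\<lambda>u. indicator {0<..<c} u *\<^sub>R ?f u)"
    by (simp add: set_integrable_def)
  define P where "P = (\<integral>\<^sup>+u. ennreal (indicator {0<..<c} u *\<^sub>R ?f u) \<partial>lborel)"
  have P: "P < \<infinity>"
  proof -
    have "P = ennreal (LINT u|lborel. indicator {0<..<c} u *\<^sub>R ?f u)"
      unfolding P_def using i by (intro nn_integral_eq_integral) auto
    then show ?thesis by simp
  qed
  have P': "(\<integral>\<^sup>+u. ennreal (indicator {0<..<c} (- u) *\<^sub>R ?f (- u)) \<partial>lborel) = P"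
    unfolding P_def
    by (subst (2) nn_integral_real_affine[where c="-1" and t=0]) auto
  have "(\<integral>\<^sup>+u. inv_powr q u * indicator {-c..c} u \<partial>lborel) \<le>
      (\<integral>\<^sup>+u. ennreal (indicator {0<..<c} u *\<^sub>R ?f u) + ennreal (indicator {0<..<c} (- u) *\<^sub>R ?f (- u)) \<partial>lborel)"
  proof (rule nn_integral_mono_AE)
    have "AE u in lborel. u \<noteq> 0 \<and> u \<noteq> c \<and> u \<noteq> (-c :: real)"
      by (intro AE_conjI AE_lborel_singleton)
    then show "AE u in lborel. inv_powr q u * indicator {-c..c} u \<le>
       ennreal (indicator {0<..<c} u *\<^sub>R ?f u) + ennreal (indicator {0<..<c} (- u) *\<^sub>R ?f (- u))"
      by eventually_elim (auto simp: inv_powr_def indicator_def)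
  qed
  also have "\<dots> = P + P" by (subst nn_integral_add) (use P' in \<open>simp_all add: P_def\<close>)
  also have "\<dots> < \<infinity>" using P by simp
  finally show ?thesis .
qed

text \<open>A normal density with mean \<open>b\<close> is bounded near \<open>0\<close> uniformly in the standard deviation: for small deviations
  the exponential wins against the factor \<open>1 / \<sigma>\<close>.\<close>

lemma gauss_kernel_bound:
  assumes b: "0 < b" and s: "0 < \<sigma>" and u: "\<bar>u\<bar> \<le> b / 2"
  shows "std_normal_density ((u - b) / \<sigma>) / \<sigma> \<le> 2 / b"
proof -
  define v where "v = b / \<sigma>"
  have v: "0 < v" using b s by (simp add: v_def)
  have "(v / 2)\<^sup>2 \<le> ((u - b) / \<sigma>)\<^sup>2"
  proof -
    have "b / 2 \<le> \<bar>u - b\<bar>" using u by linarith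
    then have "v / 2 \<le> \<bar>(u - b) / \<sigma>\<bar>" using s by (simp add: v_def abs_divide field_simps)
    then have "(v / 2)\<^sup>2 \<le> \<bar>(u - b) / \<sigma>\<bar>\<^sup>2" using v by (intro power_mono) auto
    then show ?thesis by (simp only: power2_abs)
  qed
  then have "std_normal_density ((u - b) / \<sigma>) \<le> 1 / sqrt (2 * pi) * exp (- (v / 2)\<^sup>2 / 2)"
    unfolding std_normal_density_def by (intro mult_left_mono) auto
  also have "\<dots> \<le> 1 * exp (- (v\<^sup>2 / 8))"
  proof -
    have "1 \<le> sqrt (2 * pi)" using pi_ge_two by simp
    then have "1 / sqrt (2 * pi) \<le> 1" by simp
    then show ?thesis by (intro mult_mono) (auto simp: power_divide)
  qed
  finally have "std_normal_density ((u - b) / \<sigma>) \<le> exp (- (v\<^sup>2 / 8))" by simp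
  moreover have "v * exp (- (v\<^sup>2 / 8)) \<le> 2"
  proof -
    have "v \<le> 2 * (1 + v\<^sup>2 / 8)"
      using zero_le_power2[of "v - 2"] by (simp add: power2_diff)
    also have "\<dots> \<le> 2 * exp (v\<^sup>2 / 8)" by (intro mult_left_mono exp_ge_add_one_self) simp
    finally show ?thesis by (simp add: exp_minus field_simps)
  qed
  ultimately have "v * std_normal_density ((u - b) / \<sigma>) \<le> 2"
    using v by (smt (verit) mult_left_mono)
  then show ?thesis using b s by (simp add: v_def field_simps)
qed

lemma inv_powr_gauss_bound:
  assumes q: "0 < q" "q < 1" and b: "0 < b"
  obtains K where "0 \<le> K" "\<And>\<sigma>. 0 \<le> \<sigma> \<Longrightarrow> (\<integral>\<^sup>+x. inv_powr q (b + \<sigma> * x) \<partial>std_normal_distribution) \<le> ennreal K"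
proof -
  define J where "J = enn2real (\<integral>\<^sup>+u. inv_powr q u * indicator {-(b/2)..b/2} u \<partial>lborel)"
  have J: "(\<integral>\<^sup>+u. inv_powr q u * indicator {-(b/2)..b/2} u \<partial>lborel) = ennreal J"
    using inv_powr_integral_finite[OF q, of "b / 2"] b by (simp add: J_def)
  have J0: "0 \<le> J" by (simp add: J_def)
  define K where "K = (b / 2) powr (- q) + 2 / b * J"
  have "(\<integral>\<^sup>+x. inv_powr q (b + \<sigma> * x) \<partial>std_normal_distribution) \<le> ennreal K" if \<sigma>: "0 \<le> \<sigma>" for \<sigma>
  proof (cases "\<sigma> = 0")
    case True
    have "(\<integral>\<^sup>+x. inv_powr q (b + \<sigma> * x) \<partial>std_normal_distribution) = ennreal (b powr (- q))"
      using True b std_normal.emeasure_space_1 by (simp add: inv_powr_def)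
    also have "\<dots> \<le> ennreal K"
    proof (rule ennreal_leI)
      have "b powr (- q) \<le> (b / 2) powr (- q)" using b q by (intro powr_mono2') auto
      also have "\<dots> \<le> K" using b J0 by (simp add: K_def)
      finally show "b powr (- q) \<le> K" .
    qed
    finally show ?thesis .
  next
    case False
    with \<sigma> have s: "0 < \<sigma>" by simp
    let ?I = "indicator {-(b/2)..b/2} :: real \<Rightarrow> ennreal"
    let ?x = "\<lambda>u. - b / \<sigma> + 1 / \<sigma> * u"
    have "(\<integral>\<^sup>+x. inv_powr q (b + \<sigma> * x) \<partial>std_normal_distribution)
        \<le> (\<integral>\<^sup>+x. ennreal ((b / 2) powr (- q)) + inv_powr q (b + \<sigma> * x) * ?I (b + \<sigma> * x) \<partial>std_normal_distribution)"
    proof (rule nn_integral_mono)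
      fix x
      show "inv_powr q (b + \<sigma> * x) \<le> ennreal ((b / 2) powr (- q)) + inv_powr q (b + \<sigma> * x) * ?I (b + \<sigma> * x)"
      proof (cases "\<bar>b + \<sigma> * x\<bar> \<le> b / 2")
        case True
        then have "- (b/2) \<le> b + \<sigma> * x" "b + \<sigma> * x \<le> b / 2" by linarith+
        then have "?I (b + \<sigma> * x) = 1" by (simp only: indicator_def atLeastAtMost_iff simp_thms of_bool_eq)
        then show ?thesis by simp
      next
        case False
        then have "\<bar>b + \<sigma> * x\<bar> powr (- q) \<le> (b / 2) powr (- q)" using b q by (intro powr_mono2') auto
        moreover have "b + \<sigma> * x \<noteq> 0" using False b by auto
        ultimately have "inv_powr q (b + \<sigma> * x) \<le> ennreal ((b / 2) powr (- q))"
          by (simp add: inv_powr_def ennreal_leI)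
        then show ?thesis by (rule order_trans) simp
      qed
    qed
    also have "\<dots> = ennreal ((b / 2) powr (- q)) + (\<integral>\<^sup>+x. inv_powr q (b + \<sigma> * x) * ?I (b + \<sigma> * x) \<partial>std_normal_distribution)"
      using std_normal.emeasure_space_1 by (subst nn_integral_add) auto
    also have "(\<integral>\<^sup>+x. inv_powr q (b + \<sigma> * x) * ?I (b + \<sigma> * x) \<partial>std_normal_distribution)
       = (\<integral>\<^sup>+x. ennreal (std_normal_density x) * (inv_powr q (b + \<sigma> * x) * ?I (b + \<sigma> * x)) \<partial>lborel)"
      by (rule nn_integral_density) auto
    also have "\<dots> = ennreal \<bar>1 / \<sigma>\<bar> * (\<integral>\<^sup>+u. ennreal (std_normal_density (?x u)) * (inv_powr q (b + \<sigma> * ?x u) * ?I (b + \<sigma> * ?x u)) \<partial>lborel)"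
      using s by (intro nn_integral_real_affine) auto
    also have "\<dots> = (\<integral>\<^sup>+u. ennreal (std_normal_density ((u - b) / \<sigma>) / \<sigma>) * (inv_powr q u * ?I u) \<partial>lborel)"
    proof (subst nn_integral_cmult[symmetric])
      show "(\<integral>\<^sup>+u. ennreal \<bar>1 / \<sigma>\<bar> * (ennreal (std_normal_density (?x u)) * (inv_powr q (b + \<sigma> * ?x u) * ?I (b + \<sigma> * ?x u))) \<partial>lborel)
        = (\<integral>\<^sup>+u. ennreal (std_normal_density ((u - b) / \<sigma>) / \<sigma>) * (inv_powr q u * ?I u) \<partial>lborel)"
      proof (rule nn_integral_cong)
        fix u :: real
        have 1: "?x u = (u - b) / \<sigma>" "b + \<sigma> * ((u - b) / \<sigma>) = u"
          using s by (simp_all add: field_simps)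
        have "ennreal \<bar>1 / \<sigma>\<bar> * ennreal (std_normal_density ((u - b) / \<sigma>)) = ennreal (std_normal_density ((u - b) / \<sigma>) / \<sigma>)"
          using s by (subst ennreal_mult'[symmetric]) auto
        then show "ennreal \<bar>1 / \<sigma>\<bar> * (ennreal (std_normal_density (?x u)) * (inv_powr q (b + \<sigma> * ?x u) * ?I (b + \<sigma> * ?x u)))
          = ennreal (std_normal_density ((u - b) / \<sigma>) / \<sigma>) * (inv_powr q u * ?I u)"
          unfolding 1 by (simp only: mult.assoc[symmetric])
      qed
    qed measurable
    also have "\<dots> \<le> (\<integral>\<^sup>+u. ennreal (2 / b) * (inv_powr q u * ?I u) \<partial>lborel)"
    proof (rule nn_integral_mono)
      fix u :: real
      show "ennreal (std_normal_density ((u - b) / \<sigma>) / \<sigma>) * (inv_powr q u * ?I u) \<le> ennreal (2 / b) * (inv_powr q u * ?I u)"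
      proof (cases "\<bar>u\<bar> \<le> b / 2")
        case True
        then show ?thesis by (intro mult_right_mono ennreal_leI gauss_kernel_bound b s) auto
      next
        case False
        then have "?I u = 0" by (auto simp: indicator_def)
        then show ?thesis by simp
      qed
    qed
    also have "\<dots> = ennreal (2 / b) * ennreal J"
      by (subst nn_integral_cmult) (simp_all add: J)
    also have "ennreal ((b / 2) powr (- q)) + ennreal (2 / b) * ennreal J = ennreal K"
    proof -
      have "ennreal (2 / b) * ennreal J = ennreal (2 / b * J)"
        using b J0 by (intro ennreal_mult[symmetric]) auto
      then show ?thesis using b J0 by (simp only: K_def) (rule ennreal_plus[symmetric], auto)
    qed
    finally show ?thesis by (simp add: add_left_mono)
  qed
  moreover have "0 \<le> K" using b J0 by (simp add: K_def)
  ultimately show ?thesis using that by blast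
qed

text \<open>By \<open>|Re z|, |Im z| \<le> |z|\<close> a planar inverse power is dominated by a product of one-dimensional ones with half
  the exponent, each of them integrable as soon as the exponent in the plane is less than \<open>2\<close>.\<close>

definition inv_powr2 :: "real \<Rightarrow> complex \<Rightarrow> ennreal" where
  "inv_powr2 q z = inv_powr (q / 2) (Re z) * inv_powr (q / 2) (Im z)"

lemma measurable_inv_powr2 [measurable]: "inv_powr2 q \<in> borel_measurable borel"
  unfolding inv_powr2_def [abs_def] by measurable

lemma inv_powr2_ge:
  assumes "0 < q" "z \<noteq> 0"
  shows "ennreal (norm z powr (- q)) \<le> inv_powr2 q z"
proof (cases "Re z = 0 \<or> Im z = 0")
  case True
  with assms have "inv_powr2 q z = \<infinity>"
    by (auto simp: inv_powr2_def inv_powr_def complex_eq_iff ennreal_mult_eq_top_iff)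
  then show ?thesis by simp
next
  case False
  have "norm z powr (- q) = norm z powr (- (q/2)) * norm z powr (- (q/2))"
    by (simp flip: powr_add)
  also have "\<dots> \<le> \<bar>Re z\<bar> powr (- (q/2)) * \<bar>Im z\<bar> powr (- (q/2))"
    using False assms abs_Re_le_cmod[of z] abs_Im_le_cmod[of z]
    by (intro mult_mono powr_mono2') auto
  finally show ?thesis
    using False by (simp add: inv_powr2_def inv_powr_def ennreal_mult'[symmetric] ennreal_leI)
qed

lemma inv_powr2_0: "inv_powr2 q 0 = \<infinity>"
  by (simp add: inv_powr2_def inv_powr_def)

text \<open>The starting point lies on the diagonal so that both coordinates are away from \<open>0\<close>; then the bound is
  uniform down to \<open>\<sigma> = 0\<close>.\<close>

lemma cgauss_inverse_moment:
  assumes q: "0 < q" "q < 2" and b: "0 < b"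
  obtains K where "0 \<le> K" "\<And>\<sigma>. 0 \<le> \<sigma> \<Longrightarrow> (\<integral>\<^sup>+z. inv_powr2 q (Complex b b + of_real \<sigma> * z) \<partial>cgauss) \<le> ennreal K"
proof -
  obtain K where K: "0 \<le> K" "\<And>\<sigma>. 0 \<le> \<sigma> \<Longrightarrow> (\<integral>\<^sup>+x. inv_powr (q/2) (b + \<sigma> * x) \<partial>std_normal_distribution) \<le> ennreal K"
    using inv_powr_gauss_bound[of "q / 2" b] q b by auto
  have "(\<integral>\<^sup>+z. inv_powr2 q (Complex b b + of_real \<sigma> * z) \<partial>cgauss) \<le> ennreal (K * K)" if \<sigma>: "0 \<le> \<sigma>" for \<sigma>
  proof -
    let ?I = "\<integral>\<^sup>+x. inv_powr (q/2) (b + \<sigma> * x) \<partial>std_normal_distribution"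
    have "(\<integral>\<^sup>+z. inv_powr2 q (Complex b b + of_real \<sigma> * z) \<partial>cgauss) =
       (\<integral>\<^sup>+x. \<integral>\<^sup>+y. inv_powr (q/2) (b + \<sigma> * x) * inv_powr (q/2) (b + \<sigma> * y) \<partial>std_normal_distribution \<partial>std_normal_distribution)"
      by (subst nn_integral_cgauss_iterated) (simp_all add: inv_powr2_def)
    also have "\<dots> = ?I * ?I"
      by (simp add: nn_integral_cmult nn_integral_multc)
    also have "\<dots> \<le> ennreal K * ennreal K" using K(2)[OF \<sigma>] by (intro mult_mono) auto
    finally show ?thesis using K(1) by (simp add: ennreal_mult')
  qed
  then show ?thesis using that[of "K * K"] K(1) by simp
qed

section \<open>The Gaussian walk with predictable rotations\<close>

text \<open>Noise on a grid. The law of the partial sums is part of the interface because for Brownian motion such a sum is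
  itself a single increment; a derivation from the laws of the summands would take a convolution of
  Gaussian laws.\<close>

locale gaussian_increments = prob_space M for M :: "'a measure" +
  fixes G :: "nat \<Rightarrow> 'a measure" and \<xi> :: "nat \<Rightarrow> 'a \<Rightarrow> complex" and h :: real
  assumes h: "0 < h"
    and space_G: "\<And>i. space (G i) = space M"
    and sets_G: "\<And>i. sets (G i) \<subseteq> sets M"
    and mono_G: "\<And>i. sets (G i) \<subseteq> sets (G (Suc i))"
    and \<xi>_adapted: "\<And>i. \<xi> i \<in> borel_measurable (G (Suc i))"
    and \<xi>_indep: "\<And>i. indep_set (sets (G i)) (sets (vimage_algebra (space M) (\<xi> i) borel))"
    and \<xi>_law: "\<And>i. distr M borel (\<xi> i) = distr cgauss borel (\<lambda>z. of_real (sqrt h) * z)"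
    and sum_law: "\<And>i. distr M borel (\<lambda>\<omega>. \<Sum>j<i. \<xi> j \<omega>) = distr cgauss borel (\<lambda>z. of_real (sqrt (real i * h)) * z)"
begin

lemma measurable_G_M: "X \<in> measurable (G i) N \<Longrightarrow> X \<in> measurable M N"
  by (rule measurable_from_subalg) (auto simp: subalgebra_def space_G sets_G)

lemma measurable_G_Suc: "X \<in> measurable (G i) N \<Longrightarrow> X \<in> measurable (G (Suc i)) N"
  by (rule measurable_from_subalg) (auto simp: subalgebra_def space_G mono_G[THEN subsetD])

lemma \<xi>_measurable [measurable]: "\<xi> i \<in> borel_measurable M"
  using \<xi>_adapted by (rule measurable_G_M)

text \<open>The product law of the past and the next increment; every conditional expectation below is an instance of
  Fubini's theorem for it.\<close>

lemma joint_law: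
  assumes X: "X \<in> measurable (G i) N"
  shows "distr M (N \<Otimes>\<^sub>M borel) (\<lambda>\<omega>. (X \<omega>, \<xi> i \<omega>)) = distr M N X \<Otimes>\<^sub>M distr M borel (\<xi> i)"
proof -
  have XM [measurable]: "X \<in> measurable M N" using X by (rule measurable_G_M)
  interpret D: prob_space "distr M N X" by (rule prob_space_distr) measurable
  interpret E: prob_space "distr M borel (\<xi> i)" by (rule prob_space_distr) measurable
  show ?thesis
  proof (rule pair_measure_eqI[symmetric])
    fix A B assume "A \<in> sets (distr M N X)" "B \<in> sets (distr M borel (\<xi> i))"
    then have [measurable]: "A \<in> sets N" "B \<in> sets borel" by simp_all
    have "X -` A \<inter> space M \<in> sets (G i)"
      using measurable_sets[OF X \<open>A \<in> sets N\<close>] by (simp add: space_G)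
    moreover have "\<xi> i -` B \<inter> space M \<in> sets (vimage_algebra (space M) (\<xi> i) borel)"
      by (rule in_vimage_algebra) fact
    ultimately have p: "prob ((X -` A \<inter> space M) \<inter> (\<xi> i -` B \<inter> space M)) = prob (X -` A \<inter> space M) * prob (\<xi> i -` B \<inter> space M)"
      by (rule indep_setD[OF \<xi>_indep])
    have "emeasure (distr M (N \<Otimes>\<^sub>M borel) (\<lambda>\<omega>. (X \<omega>, \<xi> i \<omega>))) (A \<times> B) = emeasure M ((X -` A \<inter> space M) \<inter> (\<xi> i -` B \<inter> space M))"
      by (subst emeasure_distr) (auto intro!: arg_cong[where f="emeasure M"])
    also have "\<dots> = emeasure (distr M N X) A * emeasure (distr M borel (\<xi> i)) B"
      by (simp add: emeasure_distr emeasure_eq_measure p ennreal_mult')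
    finally show "emeasure (distr M N X) A * emeasure (distr M borel (\<xi> i)) B =
        emeasure (distr M (N \<Otimes>\<^sub>M borel) (\<lambda>\<omega>. (X \<omega>, \<xi> i \<omega>))) (A \<times> B)" ..
  qed (simp_all add: D.sigma_finite_measure_axioms E.sigma_finite_measure_axioms cong: sets_pair_measure_cong)
qed

lemma nn_integral_increment:
  assumes X: "X \<in> measurable (G i) N" and f [measurable]: "f \<in> borel_measurable (N \<Otimes>\<^sub>M borel)"
  shows "(\<integral>\<^sup>+\<omega>. f (X \<omega>, \<xi> i \<omega>) \<partial>M) = (\<integral>\<^sup>+\<omega>. \<integral>\<^sup>+z. f (X \<omega>, of_real (sqrt h) * z) \<partial>cgauss \<partial>M)"
proof -
  have [measurable]: "X \<in> measurable M N" using X by (rule measurable_G_M)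
  interpret D: prob_space "distr M N X" by (rule prob_space_distr) measurable
  interpret E: prob_space "distr M borel (\<xi> i)" by (rule prob_space_distr) measurable
  have "(\<integral>\<^sup>+\<omega>. f (X \<omega>, \<xi> i \<omega>) \<partial>M) = (\<integral>\<^sup>+p. f p \<partial>distr M (N \<Otimes>\<^sub>M borel) (\<lambda>\<omega>. (X \<omega>, \<xi> i \<omega>)))"
    by (subst nn_integral_distr) auto
  also have "\<dots> = (\<integral>\<^sup>+x. \<integral>\<^sup>+v. f (x, v) \<partial>distr M borel (\<xi> i) \<partial>distr M N X)"
    unfolding joint_law[OF X] by (subst E.nn_integral_fst[symmetric]) auto
  also have "\<dots> = (\<integral>\<^sup>+\<omega>. \<integral>\<^sup>+v. f (X \<omega>, v) \<partial>distr M borel (\<xi> i) \<partial>M)"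
    by (subst nn_integral_distr) auto
  also have "\<dots> = (\<integral>\<^sup>+\<omega>. \<integral>\<^sup>+z. f (X \<omega>, of_real (sqrt h) * z) \<partial>cgauss \<partial>M)"
  proof (rule nn_integral_cong)
    fix \<omega> assume "\<omega> \<in> space M"
    then have [measurable]: "X \<omega> \<in> space N" by (rule measurable_space[OF \<open>X \<in> measurable M N\<close>])
    show "(\<integral>\<^sup>+v. f (X \<omega>, v) \<partial>distr M borel (\<xi> i)) = (\<integral>\<^sup>+z. f (X \<omega>, of_real (sqrt h) * z) \<partial>cgauss)"
      unfolding \<xi>_law by (subst nn_integral_distr) auto
  qed
  finally show ?thesis .
qed

lemma integral_increment:
  fixes f :: "_ \<Rightarrow> complex"
  assumes X: "X \<in> measurable (G i) N" and f [measurable]: "f \<in> borel_measurable (N \<Otimes>\<^sub>M borel)"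
    and int: "integrable M (\<lambda>\<omega>. f (X \<omega>, \<xi> i \<omega>))"
  shows "integrable M (\<lambda>\<omega>. LINT z|cgauss. f (X \<omega>, of_real (sqrt h) * z))" (is ?A)
    "(LINT \<omega>|M. f (X \<omega>, \<xi> i \<omega>)) = (LINT \<omega>|M. LINT z|cgauss. f (X \<omega>, of_real (sqrt h) * z))" (is ?B)
proof -
  have XM [measurable]: "X \<in> measurable M N" using X by (rule measurable_G_M)
  interpret D: prob_space "distr M N X" by (rule prob_space_distr) measurable
  interpret E: prob_space "distr M borel (\<xi> i)" by (rule prob_space_distr) measurable
  interpret P: pair_sigma_finite "distr M N X" "distr M borel (\<xi> i)" ..
  have "integrable (distr M (N \<Otimes>\<^sub>M borel) (\<lambda>\<omega>. (X \<omega>, \<xi> i \<omega>))) f"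
    using int by (subst integrable_distr_eq) auto
  then have i: "integrable (distr M N X \<Otimes>\<^sub>M distr M borel (\<xi> i)) f"
    by (simp only: joint_law[OF X])
  have cong: "(LINT v|distr M borel (\<xi> i). f (X \<omega>, v)) = (LINT z|cgauss. f (X \<omega>, of_real (sqrt h) * z))" if "\<omega> \<in> space M" for \<omega>
  proof -
    have [measurable]: "X \<omega> \<in> space N" using that by (rule measurable_space[OF XM])
    show ?thesis unfolding \<xi>_law by (subst integral_distr) auto
  qed
  have m: "(\<lambda>x. LINT v|distr M borel (\<xi> i). f (x, v)) \<in> borel_measurable N"
    by (rule E.borel_measurable_lebesgue_integral) (simp add: case_prod_eta cong: measurable_cong_sets)
  have "integrable (distr M N X) (\<lambda>x. LINT v|distr M borel (\<xi> i). f (x, v))"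
    using P.integrable_fst'[OF i] .
  then have "integrable M (\<lambda>\<omega>. LINT v|distr M borel (\<xi> i). f (X \<omega>, v))"
    by (rule integrable_distr[OF XM])
  then show ?A by (subst (asm) Bochner_Integration.integrable_cong[OF refl cong])
  have "(LINT \<omega>|M. f (X \<omega>, \<xi> i \<omega>)) = (LINT p|distr M (N \<Otimes>\<^sub>M borel) (\<lambda>\<omega>. (X \<omega>, \<xi> i \<omega>)). f p)"
    by (subst integral_distr) auto
  also have "\<dots> = (LINT x|distr M N X. LINT v|distr M borel (\<xi> i). f (x, v))"
    unfolding joint_law[OF X] by (rule P.integral_fst'[OF i, symmetric])
  also have "\<dots> = (LINT \<omega>|M. LINT v|distr M borel (\<xi> i). f (X \<omega>, v))"
    using m by (subst integral_distr) auto
  also have "\<dots> = (LINT \<omega>|M. LINT z|cgauss. f (X \<omega>, of_real (sqrt h) * z))"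
    by (rule Bochner_Integration.integral_cong[OF refl cong])
  finally show ?B .
qed

lemma walk_adapted:
  assumes \<alpha>: "\<And>j. \<alpha> j \<in> borel_measurable (G j)"
  shows "(\<lambda>\<omega>. walk y\<^sub>0 (\<lambda>j. \<alpha> j \<omega>) (\<lambda>j. \<xi> j \<omega>) i) \<in> borel_measurable (G i)"
proof (induction i)
  case (Suc i)
  note [measurable] = measurable_G_Suc[OF Suc] measurable_G_Suc[OF \<alpha>[of i]] \<xi>_adapted[of i]
  show ?case unfolding walk_Suc cis_conv_exp by measurable
qed simp

lemma nn_integral_walk_Suc:
  assumes \<alpha>: "\<And>j. \<alpha> j \<in> borel_measurable (G j)" and f [measurable]: "f \<in> borel_measurable borel"
  shows "(\<integral>\<^sup>+\<omega>. f (walk y\<^sub>0 (\<lambda>j. \<alpha> j \<omega>) (\<lambda>j. \<xi> j \<omega>) (Suc i)) \<partial>M) =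
    (\<integral>\<^sup>+\<omega>. \<integral>\<^sup>+z. f (walk y\<^sub>0 (\<lambda>j. \<alpha> j \<omega>) (\<lambda>j. \<xi> j \<omega>) i + of_real (sqrt 2) * (of_real (sqrt h) * z)) \<partial>cgauss \<partial>M)"
proof -
  define Y where "Y \<omega> = walk y\<^sub>0 (\<lambda>j. \<alpha> j \<omega>) (\<lambda>j. \<xi> j \<omega>) i" for \<omega>
  have [measurable]: "Y \<in> borel_measurable (G i)" unfolding Y_def by (rule walk_adapted[OF \<alpha>])
  note [measurable] = \<alpha>[of i]
  have X: "(\<lambda>\<omega>. (Y \<omega>, \<alpha> i \<omega>)) \<in> measurable (G i) (borel \<Otimes>\<^sub>M borel)" by measurable
  define g where "g = (\<lambda>p. f (fst (fst p) + of_real (sqrt 2) * cis (- snd (fst p)) * snd p) :: ennreal)"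
  have g [measurable]: "g \<in> borel_measurable ((borel \<Otimes>\<^sub>M borel) \<Otimes>\<^sub>M borel)"
    unfolding g_def cis_conv_exp by measurable
  have "(\<integral>\<^sup>+\<omega>. f (walk y\<^sub>0 (\<lambda>j. \<alpha> j \<omega>) (\<lambda>j. \<xi> j \<omega>) (Suc i)) \<partial>M) = (\<integral>\<^sup>+\<omega>. g ((Y \<omega>, \<alpha> i \<omega>), \<xi> i \<omega>) \<partial>M)"
    by (simp add: g_def walk_Suc Y_def)
  also have "\<dots> = (\<integral>\<^sup>+\<omega>. \<integral>\<^sup>+z. g ((Y \<omega>, \<alpha> i \<omega>), of_real (sqrt h) * z) \<partial>cgauss \<partial>M)"
    by (rule nn_integral_increment[OF X g])
  also have "\<dots> = (\<integral>\<^sup>+\<omega>. \<integral>\<^sup>+z. f (Y \<omega> + of_real (sqrt 2) * (of_real (sqrt h) * z)) \<partial>cgauss \<partial>M)"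
  proof (rule nn_integral_cong)
    fix \<omega>
    have "(\<integral>\<^sup>+z. f (Y \<omega> + of_real (sqrt 2) * (of_real (sqrt h) * (cis (- \<alpha> i \<omega>) * z))) \<partial>cgauss) =
      (\<integral>\<^sup>+z. f (Y \<omega> + of_real (sqrt 2) * (of_real (sqrt h) * z)) \<partial>cgauss)"
      by (rule nn_integral_cgauss_rotate[where f="\<lambda>z. f (Y \<omega> + of_real (sqrt 2) * (of_real (sqrt h) * z))"]) auto
    then show "(\<integral>\<^sup>+z. g ((Y \<omega>, \<alpha> i \<omega>), of_real (sqrt h) * z) \<partial>cgauss) =
      (\<integral>\<^sup>+z. f (Y \<omega> + of_real (sqrt 2) * (of_real (sqrt h) * z)) \<partial>cgauss)"
      by (simp add: g_def mult_ac)
  qed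
  finally show ?thesis unfolding Y_def .
qed

text \<open>The rotation applied to an increment is known before the increment is drawn, and the law of the increment is
  rotation invariant.\<close>

lemma nn_integral_walk_phase_irrelevant:
  assumes \<alpha>: "\<And>j. \<alpha> j \<in> borel_measurable (G j)" and f: "f \<in> borel_measurable borel"
  shows "(\<integral>\<^sup>+\<omega>. f (walk y\<^sub>0 (\<lambda>j. \<alpha> j \<omega>) (\<lambda>j. \<xi> j \<omega>) i) \<partial>M) = (\<integral>\<^sup>+\<omega>. f (walk y\<^sub>0 (\<lambda>j. 0) (\<lambda>j. \<xi> j \<omega>) i) \<partial>M)"
  using f
proof (induction i arbitrary: f)
  case (Suc i)
  note [measurable] = Suc.prems
  have "(\<lambda>y. \<integral>\<^sup>+z. f (y + of_real (sqrt 2) * (of_real (sqrt h) * z)) \<partial>cgauss) \<in> borel_measurable borel"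
    by measurable
  from Suc.IH[OF this] show ?case
    using nn_integral_walk_Suc[OF \<alpha> Suc.prems] nn_integral_walk_Suc[OF _ Suc.prems, of "\<lambda>j \<omega>. 0"] by simp
qed simp

lemma walk_law:
  assumes \<alpha>: "\<And>j. \<alpha> j \<in> borel_measurable (G j)" and f [measurable]: "f \<in> borel_measurable borel"
  shows "(\<integral>\<^sup>+\<omega>. f (walk y\<^sub>0 (\<lambda>j. \<alpha> j \<omega>) (\<lambda>j. \<xi> j \<omega>) i) \<partial>M) =
    (\<integral>\<^sup>+z. f (y\<^sub>0 + of_real (sqrt (2 * (real i * h))) * z) \<partial>cgauss)"
proof -
  have "(\<integral>\<^sup>+\<omega>. f (walk y\<^sub>0 (\<lambda>j. \<alpha> j \<omega>) (\<lambda>j. \<xi> j \<omega>) i) \<partial>M) = (\<integral>\<^sup>+\<omega>. f (y\<^sub>0 + of_real (sqrt 2) * (\<Sum>j<i. \<xi> j \<omega>)) \<partial>M)"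
    by (subst nn_integral_walk_phase_irrelevant[OF \<alpha> f]) (simp add: walk_def sum_distrib_left)
  also have "\<dots> = (\<integral>\<^sup>+v. f (y\<^sub>0 + of_real (sqrt 2) * v) \<partial>distr M borel (\<lambda>\<omega>. \<Sum>j<i. \<xi> j \<omega>))"
    by (subst nn_integral_distr) auto
  also have "\<dots> = (\<integral>\<^sup>+z. f (y\<^sub>0 + of_real (sqrt 2) * (of_real (sqrt (real i * h)) * z)) \<partial>cgauss)"
    unfolding sum_law by (subst nn_integral_distr) auto
  finally show ?thesis by (simp add: real_sqrt_mult mult_ac)
qed

end

context gaussian_increments
begin

context
  fixes \<alpha> :: "nat \<Rightarrow> 'a \<Rightarrow> real" and y\<^sub>0 :: complex
  assumes \<alpha>: "\<And>j. \<alpha> j \<in> borel_measurable (G j)"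
begin

abbreviation Y :: "nat \<Rightarrow> 'a \<Rightarrow> complex" where
  "Y i \<omega> \<equiv> walk y\<^sub>0 (\<lambda>j. \<alpha> j \<omega>) (\<lambda>j. \<xi> j \<omega>) i"

lemma Y_measurable [measurable]: "Y i \<in> borel_measurable M"
  by (rule measurable_G_M[OF walk_adapted[OF \<alpha>]])

lemma walk_distr: "distr M borel (Y i) = distr cgauss borel (\<lambda>z. y\<^sub>0 + of_real (sqrt (2 * (real i * h))) * z)"
proof (rule measure_eqI)
  fix A assume "A \<in> sets (distr M borel (Y i))"
  then have [measurable]: "A \<in> sets borel" by simp
  have "emeasure (distr M borel (Y i)) A = (\<integral>\<^sup>+y. indicator A y \<partial>distr M borel (Y i))"
    by (subst nn_integral_indicator) auto
  also have "\<dots> = (\<integral>\<^sup>+\<omega>. indicator A (Y i \<omega>) \<partial>M)"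
    by (subst nn_integral_distr) auto
  also have "\<dots> = (\<integral>\<^sup>+z. indicator A (y\<^sub>0 + of_real (sqrt (2 * (real i * h))) * z) \<partial>cgauss)"
    by (rule walk_law[OF \<alpha>]) auto
  also have "\<dots> = (\<integral>\<^sup>+y. indicator A y \<partial>distr cgauss borel (\<lambda>z. y\<^sub>0 + of_real (sqrt (2 * (real i * h))) * z))"
    by (subst nn_integral_distr) auto
  also have "\<dots> = emeasure (distr cgauss borel (\<lambda>z. y\<^sub>0 + of_real (sqrt (2 * (real i * h))) * z)) A"
    by (subst nn_integral_indicator) auto
  finally show "emeasure (distr M borel (Y i)) A = emeasure (distr cgauss borel (\<lambda>z. y\<^sub>0 + of_real (sqrt (2 * (real i * h))) * z)) A" .
qed simp

lemma integral_walk: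
  fixes g :: "complex \<Rightarrow> real"
  assumes g [measurable]: "g \<in> borel_measurable borel"
    and int: "integrable cgauss (\<lambda>z. g (y\<^sub>0 + of_real (sqrt (2 * (real i * h))) * z))"
  shows "integrable M (\<lambda>\<omega>. g (Y i \<omega>))"
    "(LINT \<omega>|M. g (Y i \<omega>)) = (LINT z|cgauss. g (y\<^sub>0 + of_real (sqrt (2 * (real i * h))) * z))"
proof -
  have "integrable (distr cgauss borel (\<lambda>z. y\<^sub>0 + of_real (sqrt (2 * (real i * h))) * z)) g"
    using int by (subst integrable_distr_eq) auto
  then have "integrable (distr M borel (Y i)) g" by (simp only: walk_distr)
  then show "integrable M (\<lambda>\<omega>. g (Y i \<omega>))" by (rule integrable_distr[rotated]) measurable
  have "(LINT \<omega>|M. g (Y i \<omega>)) = (LINT y|distr M borel (Y i). g y)"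
    by (rule integral_distr[symmetric]) auto
  also have "\<dots> = (LINT z|cgauss. g (y\<^sub>0 + of_real (sqrt (2 * (real i * h))) * z))"
    unfolding walk_distr by (rule integral_distr) auto
  finally show "(LINT \<omega>|M. g (Y i \<omega>)) = (LINT z|cgauss. g (y\<^sub>0 + of_real (sqrt (2 * (real i * h))) * z))" .
qed

lemma turning_adapted: "(\<lambda>\<omega>. turning \<beta> h (\<lambda>j. Y j \<omega>) i) \<in> borel_measurable (G i)"
proof (induction i)
  case (Suc i)
  note [measurable] = measurable_G_Suc[OF Suc] measurable_G_Suc[OF walk_adapted[OF \<alpha>, of y\<^sub>0 i]] walk_adapted[OF \<alpha>, of y\<^sub>0 "Suc i"]
  show ?case unfolding turning_Suc by measurable
qed simp

context
  fixes \<beta> \<mu> :: real and \<kappa> :: complex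
  assumes k: "0 < Re \<kappa>" "Re \<kappa> \<le> 1"
begin

definition spiral_at :: "nat \<Rightarrow> 'a \<Rightarrow> complex" where
  "spiral_at i \<omega> = of_real (norm (Y i \<omega>)) powr \<kappa> * cis (\<mu> * turning \<beta> h (\<lambda>j. Y j \<omega>) i)"

lemma spiral_at_adapted: "spiral_at i \<in> borel_measurable (G i)"
proof -
  note [measurable] = turning_adapted[of \<beta> i] walk_adapted[OF \<alpha>, of y\<^sub>0 i]
  show ?thesis unfolding spiral_at_def [abs_def] cis_conv_exp by measurable
qed

lemma norm_spiral_at: "norm (spiral_at i \<omega>) = norm (Y i \<omega>) powr Re \<kappa>"
  by (simp add: spiral_at_def norm_mult norm_powr_real_powr)

lemma integrable_spiral_at: "integrable M (spiral_at i)"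
proof (rule Bochner_Integration.integrable_bound)
  show "integrable M (\<lambda>\<omega>. norm (Y i \<omega>) powr Re \<kappa>)"
    using integrable_norm[OF integrable_spiral[OF k]] by (intro integral_walk) (simp_all)
  show "spiral_at i \<in> borel_measurable M" using spiral_at_adapted by (rule measurable_G_M)
qed (simp add: norm_spiral_at)

lemma spiral_at_Suc:
  assumes "Y i \<omega> \<noteq> 0"
  shows "spiral_at (Suc i) \<omega> = spiral_at i \<omega> * cis (\<mu> * (\<beta> * h / (norm (Y i \<omega>))\<^sup>2)) *
    spiral \<kappa> \<mu> (1 + of_real (sqrt 2) * cis (- \<alpha> i \<omega>) / Y i \<omega> * \<xi> i \<omega>)"
proof -
  define q where "q = Y (Suc i) \<omega> / Y i \<omega>"
  have q: "1 + of_real (sqrt 2) * cis (- \<alpha> i \<omega>) / Y i \<omega> * \<xi> i \<omega> = q"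
    using assms by (simp add: q_def walk_Suc field_simps)
  have "norm (Y (Suc i) \<omega>) = norm (Y i \<omega>) * norm q"
    using assms by (simp add: q_def norm_divide)
  then have "(of_real (norm (Y (Suc i) \<omega>)) :: complex) powr \<kappa> = of_real (norm (Y i \<omega>)) powr \<kappa> * of_real (norm q) powr \<kappa>"
    by (simp only: of_real_mult) (rule powr_times_real, auto)
  then show ?thesis
    unfolding q unfolding spiral_at_def turning_Suc spiral_def q_def[symmetric]
    by (simp add: distrib_left cis_mult[symmetric])
qed

text \<open>Given the past, one step multiplies \<open>spiral_at\<close> by a factor whose mean is close to \<open>1\<close> by \<open>spiral_step\<close>. The negative
  power of \<open>|Y|\<close> in this bound, times \<open>|spiral_at| = |Y|\<^sup>k\<close> with \<open>k = Re \<kappa>\<close>, is \<open>|Y|\<close> to the power \<open>- (2 - k / 2)\<close>.\<close>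

lemma spiral_at_step:
  assumes C: "0 \<le> C" "\<And>c. norm (exp (\<i> * of_real (\<beta> * \<mu> * (norm c)\<^sup>2 / 2)) * (LINT z|cgauss. spiral \<kappa> \<mu> (1 + c * z)) - 1)
         \<le> C * norm c powr (2 + Re \<kappa> / 2)"
    and K: "0 \<le> K" "\<And>\<sigma>. 0 \<le> \<sigma> \<Longrightarrow> (\<integral>\<^sup>+z. inv_powr2 (2 - Re \<kappa> / 2) (y\<^sub>0 + of_real \<sigma> * z) \<partial>cgauss) \<le> ennreal K"
  shows "norm ((LINT \<omega>|M. spiral_at (Suc i) \<omega>) - (LINT \<omega>|M. spiral_at i \<omega>)) \<le> C * (2 * h) powr (1 + Re \<kappa> / 4) * K"
proof -
  define q where "q = 2 - Re \<kappa> / 2"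
  have q: "0 < q" using k by (simp add: q_def)
  have IK: "(\<integral>\<^sup>+\<omega>. inv_powr2 q (Y i \<omega>) \<partial>M) \<le> ennreal K"
    using h by (subst walk_law[OF \<alpha>]) (auto simp: q_def intro!: K)
  then have "(\<integral>\<^sup>+\<omega>. inv_powr2 q (Y i \<omega>) \<partial>M) \<noteq> \<infinity>" by (auto simp: top_unique)
  then have "AE \<omega> in M. inv_powr2 q (Y i \<omega>) \<noteq> \<infinity>"
    by (intro nn_integral_noteq_infinite) measurable
  then have Y0: "AE \<omega> in M. Y i \<omega> \<noteq> 0"
    by eventually_elim (auto simp: inv_powr2_0)
  define X where "X \<omega> = ((spiral_at i \<omega>, Y i \<omega>), \<alpha> i \<omega>)" for \<omega>
  note [measurable] = spiral_at_adapted[of i] walk_adapted[OF \<alpha>, of y\<^sub>0 i] \<alpha>[of i]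
  have X: "X \<in> measurable (G i) ((borel \<Otimes>\<^sub>M borel) \<Otimes>\<^sub>M borel)" unfolding X_def [abs_def] by measurable
  define f where "f = (\<lambda>p. fst (fst (fst p)) * cis (\<mu> * (\<beta> * h / (norm (snd (fst (fst p))))\<^sup>2)) *
      spiral \<kappa> \<mu> (1 + of_real (sqrt 2) * cis (- snd (fst p)) / snd (fst (fst p)) * snd p))"
  have f [measurable]: "f \<in> borel_measurable (((borel \<Otimes>\<^sub>M borel) \<Otimes>\<^sub>M borel) \<Otimes>\<^sub>M borel)"
    unfolding f_def cis_conv_exp by measurable
  have NM: "spiral_at j \<in> borel_measurable M" for j using spiral_at_adapted by (rule measurable_G_M)
  have XM [measurable]: "X \<in> measurable M ((borel \<Otimes>\<^sub>M borel) \<Otimes>\<^sub>M borel)" using X by (rule measurable_G_M)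
  have Nf: "AE \<omega> in M. spiral_at (Suc i) \<omega> = f (X \<omega>, \<xi> i \<omega>)"
    using Y0 by eventually_elim (simp add: spiral_at_Suc f_def X_def)
  have fX: "(\<lambda>\<omega>. f (X \<omega>, \<xi> i \<omega>)) \<in> borel_measurable M" by measurable
  have "integrable M (\<lambda>\<omega>. f (X \<omega>, \<xi> i \<omega>))"
    using integrable_spiral_at[of "Suc i"] integrable_cong_AE[OF NM fX Nf] by simp
  note inc = integral_increment[OF X f this]
  define c where "c \<omega> = of_real (sqrt 2) * cis (- \<alpha> i \<omega>) / Y i \<omega> * of_real (sqrt h)" for \<omega>
  define m where "m \<omega> = (LINT z|cgauss. spiral \<kappa> \<mu> (1 + c \<omega> * z))" for \<omega>
  have inner: "(LINT z|cgauss. f (X \<omega>, of_real (sqrt h) * z)) = spiral_at i \<omega> * cis (\<mu> * (\<beta> * h / (norm (Y i \<omega>))\<^sup>2)) * m \<omega>" for \<omega>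
    unfolding f_def X_def m_def c_def fst_conv snd_conv integral_mult_right_zero by (simp only: mult.assoc)
  have "(LINT \<omega>|M. spiral_at (Suc i) \<omega>) = (LINT \<omega>|M. f (X \<omega>, \<xi> i \<omega>))"
    by (rule integral_cong_AE[OF NM fX Nf])
  also have "\<dots> = (LINT \<omega>|M. spiral_at i \<omega> * cis (\<mu> * (\<beta> * h / (norm (Y i \<omega>))\<^sup>2)) * m \<omega>)"
    unfolding inc(2) inner ..
  finally have "(LINT \<omega>|M. spiral_at (Suc i) \<omega>) - (LINT \<omega>|M. spiral_at i \<omega>) =
      (LINT \<omega>|M. spiral_at i \<omega> * cis (\<mu> * (\<beta> * h / (norm (Y i \<omega>))\<^sup>2)) * m \<omega> - spiral_at i \<omega>)"
    using inc(1) integrable_spiral_at[of i] unfolding inner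
    by (simp add: Bochner_Integration.integral_diff)
  moreover have "integrable M (\<lambda>\<omega>. spiral_at i \<omega> * cis (\<mu> * (\<beta> * h / (norm (Y i \<omega>))\<^sup>2)) * m \<omega> - spiral_at i \<omega>)"
    using inc(1) integrable_spiral_at[of i] unfolding inner by (rule Bochner_Integration.integrable_diff)
  ultimately have "ennreal (norm ((LINT \<omega>|M. spiral_at (Suc i) \<omega>) - (LINT \<omega>|M. spiral_at i \<omega>))) \<le>
     (\<integral>\<^sup>+\<omega>. ennreal (norm (spiral_at i \<omega> * cis (\<mu> * (\<beta> * h / (norm (Y i \<omega>))\<^sup>2)) * m \<omega> - spiral_at i \<omega>)) \<partial>M)"
    by (simp only: integral_norm_bound_ennreal)
  also have "\<dots> \<le> (\<integral>\<^sup>+\<omega>. ennreal (C * (2 * h) powr (1 + Re \<kappa> / 4)) * inv_powr2 q (Y i \<omega>) \<partial>M)"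
    using Y0
  proof (intro nn_integral_mono_AE, eventually_elim)
    fix \<omega> assume nz: "Y i \<omega> \<noteq> 0"
    define r where "r = norm (Y i \<omega>)"
    have r: "0 < r" using nz by (simp add: r_def)
    have nc: "norm (c \<omega>) = sqrt (2 * h) / r"
      using h by (simp add: c_def r_def norm_mult norm_divide real_sqrt_mult)
    have e: "cis (\<mu> * (\<beta> * h / (norm (Y i \<omega>))\<^sup>2)) = exp (\<i> * of_real (\<beta> * \<mu> * (norm (c \<omega>))\<^sup>2 / 2))"
      using h by (simp add: cis_conv_exp nc r_def power_divide mult_ac)
    have "norm (spiral_at i \<omega> * cis (\<mu> * (\<beta> * h / (norm (Y i \<omega>))\<^sup>2)) * m \<omega> - spiral_at i \<omega>) =
       norm (spiral_at i \<omega>) * norm (exp (\<i> * of_real (\<beta> * \<mu> * (norm (c \<omega>))\<^sup>2 / 2)) * m \<omega> - 1)"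
      unfolding e norm_mult[symmetric] by (simp add: algebra_simps)
    also have "\<dots> \<le> r powr Re \<kappa> * (C * norm (c \<omega>) powr (2 + Re \<kappa> / 2))"
      unfolding m_def norm_spiral_at r_def by (intro mult_left_mono C) auto
    also have "\<dots> = C * (2 * h) powr (1 + Re \<kappa> / 4) * r powr (- q)"
    proof -
      have "norm (c \<omega>) powr (2 + Re \<kappa> / 2) = sqrt (2 * h) powr (2 + Re \<kappa> / 2) / r powr (2 + Re \<kappa> / 2)"
        unfolding nc by (rule powr_divide)
      also have "sqrt (2 * h) powr (2 + Re \<kappa> / 2) = (2 * h) powr (1 + Re \<kappa> / 4)"
        using h by (simp add: powr_half_sqrt[symmetric] powr_powr field_simps)
      also have "(2 * h) powr (1 + Re \<kappa> / 4) / r powr (2 + Re \<kappa> / 2) = (2 * h) powr (1 + Re \<kappa> / 4) * r powr (- (2 + Re \<kappa> / 2))"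
        by (simp only: powr_minus_divide times_divide_eq_right mult_1_right)
      finally have "r powr Re \<kappa> * (C * norm (c \<omega>) powr (2 + Re \<kappa> / 2)) =
         C * (2 * h) powr (1 + Re \<kappa> / 4) * (r powr Re \<kappa> * r powr (- (2 + Re \<kappa> / 2)))" by simp
      also have "r powr Re \<kappa> * r powr (- (2 + Re \<kappa> / 2)) = r powr (- q)"
        by (simp add: q_def flip: powr_add)
      finally show ?thesis .
    qed
    finally have "ennreal (norm (spiral_at i \<omega> * cis (\<mu> * (\<beta> * h / (norm (Y i \<omega>))\<^sup>2)) * m \<omega> - spiral_at i \<omega>)) \<le>
       ennreal (C * (2 * h) powr (1 + Re \<kappa> / 4) * r powr (- q))" by (rule ennreal_leI)
    also have "\<dots> = ennreal (C * (2 * h) powr (1 + Re \<kappa> / 4)) * ennreal (r powr (- q))"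
      using C(1) by (intro ennreal_mult) auto
    also have "\<dots> \<le> ennreal (C * (2 * h) powr (1 + Re \<kappa> / 4)) * inv_powr2 q (Y i \<omega>)"
      unfolding r_def by (intro mult_left_mono inv_powr2_ge q nz) auto
    finally show "ennreal (norm (spiral_at i \<omega> * cis (\<mu> * (\<beta> * h / (norm (Y i \<omega>))\<^sup>2)) * m \<omega> - spiral_at i \<omega>)) \<le>
       ennreal (C * (2 * h) powr (1 + Re \<kappa> / 4)) * inv_powr2 q (Y i \<omega>)" .
  qed
  also have "\<dots> = ennreal (C * (2 * h) powr (1 + Re \<kappa> / 4)) * (\<integral>\<^sup>+\<omega>. inv_powr2 q (Y i \<omega>) \<partial>M)"
    by (rule nn_integral_cmult) measurable
  also have "\<dots> \<le> ennreal (C * (2 * h) powr (1 + Re \<kappa> / 4)) * ennreal K"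
    by (intro mult_left_mono IK) auto
  also have "\<dots> = ennreal (C * (2 * h) powr (1 + Re \<kappa> / 4) * K)"
    using C(1) K(1) by (intro ennreal_mult[symmetric]) auto
  finally show ?thesis using C(1) K(1) by (simp add: ennreal_le_iff)
qed

text \<open>Replacing \<open>|Y|\<^sup>\<kappa>\<close> by the constant \<open>s\<close> costs at most the first term, which does not depend on the mesh because it
  involves the law of \<open>Y\<close> at one time only.\<close>

lemma turning_char_bound:
  assumes C: "0 \<le> C" "\<And>c. norm (exp (\<i> * of_real (\<beta> * \<mu> * (norm c)\<^sup>2 / 2)) * (LINT z|cgauss. spiral \<kappa> \<mu> (1 + c * z)) - 1)
         \<le> C * norm c powr (2 + Re \<kappa> / 2)"
    and K: "0 \<le> K" "\<And>\<sigma>. 0 \<le> \<sigma> \<Longrightarrow> (\<integral>\<^sup>+z. inv_powr2 (2 - Re \<kappa> / 2) (y\<^sub>0 + of_real \<sigma> * z) \<partial>cgauss) \<le> ennreal K"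
  shows "norm (s * (LINT \<omega>|M. cis (\<mu> * turning \<beta> h (\<lambda>j. Y j \<omega>) n)) - of_real (norm y\<^sub>0) powr \<kappa>) \<le>
     (LINT z|cgauss. norm (s - of_real (norm (y\<^sub>0 + of_real (sqrt (2 * (real n * h))) * z)) powr \<kappa>))
       + real n * (C * (2 * h) powr (1 + Re \<kappa> / 4) * K)"
proof -
  let ?T = "\<lambda>\<omega>. turning \<beta> h (\<lambda>j. Y j \<omega>) n"
  have 1: "norm ((LINT \<omega>|M. spiral_at i \<omega>) - of_real (norm y\<^sub>0) powr \<kappa>) \<le> real i * (C * (2 * h) powr (1 + Re \<kappa> / 4) * K)" for i
  proof (induction i)
    case 0
    show ?case using prob_space by (simp add: spiral_at_def)
  next
    case (Suc i)
    have "norm ((LINT \<omega>|M. spiral_at (Suc i) \<omega>) - of_real (norm y\<^sub>0) powr \<kappa>) \<le>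
      norm ((LINT \<omega>|M. spiral_at (Suc i) \<omega>) - (LINT \<omega>|M. spiral_at i \<omega>)) + norm ((LINT \<omega>|M. spiral_at i \<omega>) - of_real (norm y\<^sub>0) powr \<kappa>)"
      using norm_triangle_ineq[of "(LINT \<omega>|M. spiral_at (Suc i) \<omega>) - (LINT \<omega>|M. spiral_at i \<omega>)" "(LINT \<omega>|M. spiral_at i \<omega>) - of_real (norm y\<^sub>0) powr \<kappa>"]
      by simp
    also have "\<dots> \<le> C * (2 * h) powr (1 + Re \<kappa> / 4) * K + real i * (C * (2 * h) powr (1 + Re \<kappa> / 4) * K)"
      by (intro add_mono spiral_at_step C K Suc.IH)
    also have "\<dots> = real (Suc i) * (C * (2 * h) powr (1 + Re \<kappa> / 4) * K)"
      by (simp only: of_nat_Suc distrib_right mult_1)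
    finally show ?case .
  qed
  have [measurable]: "?T \<in> borel_measurable M" by (rule measurable_G_M[OF turning_adapted])
  have i1: "integrable M (\<lambda>\<omega>. s * cis (\<mu> * ?T \<omega>))"
    by (rule integrable_const_bound[where B="norm s"]) (auto simp: norm_mult cis_conv_exp)
  let ?g = "\<lambda>y::complex. norm (s - of_real (norm y) powr \<kappa>)"
  have ig: "integrable cgauss (\<lambda>z. ?g (y\<^sub>0 + of_real (sqrt (2 * (real n * h))) * z))"
  proof (rule Bochner_Integration.integrable_bound)
    show "integrable cgauss (\<lambda>z. norm s + norm (spiral \<kappa> \<mu> (y\<^sub>0 + of_real (sqrt (2 * (real n * h))) * z)))"
      by (intro Bochner_Integration.integrable_add integrable_norm integrable_spiral k) auto
    show "AE z in cgauss. norm (?g (y\<^sub>0 + of_real (sqrt (2 * (real n * h))) * z)) \<le>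
        norm (norm s + norm (spiral \<kappa> \<mu> (y\<^sub>0 + of_real (sqrt (2 * (real n * h))) * z)))"
    proof (rule AE_I2)
      fix z
      let ?y = "y\<^sub>0 + of_real (sqrt (2 * (real n * h))) * z"
      have "norm (s - of_real (norm ?y) powr \<kappa>) \<le> norm s + norm (of_real (norm ?y) powr \<kappa> :: complex)"
        by (rule norm_triangle_ineq4)
      then show "norm (?g ?y) \<le> norm (norm s + norm (spiral \<kappa> \<mu> ?y))"
        by (simp add: norm_powr_real_powr)
    qed
  qed measurable
  note ie = integral_walk[where g="?g" and i=n, OF _ ig]
  have "norm ((LINT \<omega>|M. s * cis (\<mu> * ?T \<omega>)) - (LINT \<omega>|M. spiral_at n \<omega>)) = norm (LINT \<omega>|M. s * cis (\<mu> * ?T \<omega>) - spiral_at n \<omega>)"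
    by (simp only: Bochner_Integration.integral_diff[OF i1 integrable_spiral_at])
  also have "\<dots> \<le> (LINT \<omega>|M. norm (s * cis (\<mu> * ?T \<omega>) - spiral_at n \<omega>))"
    by (rule integral_norm_bound)
  also have "\<dots> = (LINT \<omega>|M. ?g (Y n \<omega>))"
  proof (rule Bochner_Integration.integral_cong[OF refl])
    fix \<omega>
    have "s * cis (\<mu> * ?T \<omega>) - spiral_at n \<omega> = (s - of_real (norm (Y n \<omega>)) powr \<kappa>) * cis (\<mu> * ?T \<omega>)"
      by (simp add: spiral_at_def algebra_simps)
    then show "norm (s * cis (\<mu> * ?T \<omega>) - spiral_at n \<omega>) = ?g (Y n \<omega>)" by (simp add: norm_mult)
  qed
  also have "\<dots> = (LINT z|cgauss. ?g (y\<^sub>0 + of_real (sqrt (2 * (real n * h))) * z))"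
    by (rule ie(2)) measurable
  finally have 2: "norm ((LINT \<omega>|M. s * cis (\<mu> * ?T \<omega>)) - (LINT \<omega>|M. spiral_at n \<omega>)) \<le> (LINT z|cgauss. ?g (y\<^sub>0 + of_real (sqrt (2 * (real n * h))) * z))" .
  have "norm ((LINT \<omega>|M. s * cis (\<mu> * ?T \<omega>)) - of_real (norm y\<^sub>0) powr \<kappa>) \<le>
     norm ((LINT \<omega>|M. s * cis (\<mu> * ?T \<omega>)) - (LINT \<omega>|M. spiral_at n \<omega>)) + norm ((LINT \<omega>|M. spiral_at n \<omega>) - of_real (norm y\<^sub>0) powr \<kappa>)"
    using norm_triangle_ineq[of "(LINT \<omega>|M. s * cis (\<mu> * ?T \<omega>)) - (LINT \<omega>|M. spiral_at n \<omega>)" "(LINT \<omega>|M. spiral_at n \<omega>) - of_real (norm y\<^sub>0) powr \<kappa>"]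
    by simp
  with 1[of n] 2 show ?thesis by simp
qed

end
end
end

section \<open>Letting time tend to infinity\<close>

context
  fixes r \<beta> \<xi> :: real
  assumes r: "0 < r" and \<beta>: "0 < \<beta>" and \<xi>: "\<xi> \<noteq> 0"
begin

text \<open>The logarithm in the normalisation of the theorem, for the initial radius \<open>r\<close>.\<close>

definition log_scale :: "real \<Rightarrow> real" where
  "log_scale t = ln (4 * t / (r\<^sup>2 * exp euler_mascheroni))"

text \<open>The frequency at which the characteristic function of \<open>\<Theta>(t)\<close> is that of the rescaled angle at \<open>\<xi>\<close>.\<close>

definition freq :: "real \<Rightarrow> real" where
  "freq t = 8 * \<xi> / (\<beta> * (log_scale t)\<^sup>2)"

text \<open>The exponent \<open>\<kappa>\<close> belonging to the frequency \<open>freq t\<close>; for large \<open>t\<close> the principal root has positive real part.\<close>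

definition expo :: "real \<Rightarrow> complex" where
  "expo t = csqrt ((of_real (freq t))\<^sup>2 - \<i> * of_real (\<beta> * freq t))"

lemma log_scale_at_top: "filterlim log_scale at_top at_top"
proof -
  have c: "4 / (r\<^sup>2 * exp euler_mascheroni) > 0" using r by simp
  have "filterlim (\<lambda>t. ln (4 / (r\<^sup>2 * exp euler_mascheroni) * t)) at_top at_top"
    by (intro filterlim_compose[OF ln_at_top] filterlim_tendsto_pos_mult_at_top[OF tendsto_const c] filterlim_ident)
  then show ?thesis by (simp add: log_scale_def [abs_def])
qed

lemma eventually_log_scale_pos: "\<forall>\<^sub>F t in at_top. 0 < log_scale t"
  using log_scale_at_top by (simp add: filterlim_at_top_dense)

lemma expo_squared: "(expo t)\<^sup>2 = (of_real (freq t))\<^sup>2 - \<i> * of_real (\<beta> * freq t)"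
  by (simp add: expo_def)

lemma Re_expo_pos:
  assumes "0 < log_scale t"
  shows "0 < Re (expo t)"
proof -
  have f: "\<beta> * freq t \<noteq> 0" using assms \<beta> \<xi> by (simp add: freq_def)
  have "Re (expo t) \<noteq> 0"
  proof
    assume "Re (expo t) = 0"
    then have "Im ((expo t)\<^sup>2) = 0" by (simp add: power2_eq_square)
    then show False using f unfolding expo_squared by (simp add: power2_eq_square)
  qed
  moreover have "0 \<le> Re (expo t)" unfolding expo_def using csqrt_principal[of "(of_real (freq t))\<^sup>2 - \<i> * of_real (\<beta> * freq t)"] by auto
  ultimately show ?thesis by simp
qed

lemma expo_log_scale_tendsto: "((\<lambda>t. expo t * of_real (log_scale t / 2)) \<longlongrightarrow> csqrt (- 2 * \<i> * of_real \<xi>)) at_top"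
proof -
  have inv: "((\<lambda>t. 1 / log_scale t) \<longlongrightarrow> 0) at_top"
    using tendsto_inverse_0_at_top[OF log_scale_at_top] by (simp add: inverse_eq_divide)
  have "((\<lambda>t. of_real (16 * \<xi>\<^sup>2 / \<beta>\<^sup>2 * (1 / log_scale t)\<^sup>2) - 2 * \<i> * of_real \<xi>) \<longlongrightarrow> of_real (16 * \<xi>\<^sup>2 / \<beta>\<^sup>2 * 0\<^sup>2) - 2 * \<i> * of_real \<xi>) at_top"
    by (intro tendsto_intros inv)
  then have a: "((\<lambda>t. of_real (16 * \<xi>\<^sup>2 / \<beta>\<^sup>2 * (1 / log_scale t)\<^sup>2) - 2 * \<i> * of_real \<xi>) \<longlongrightarrow> - 2 * \<i> * of_real \<xi>) at_top"
    by simp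
  have "- 2 * \<i> * of_real \<xi> \<notin> \<real>\<^sub>\<le>\<^sub>0" using \<xi> by (auto simp: complex_nonpos_Reals_iff)
  from isCont_tendsto_compose[OF continuous_at_csqrt[OF this] a]
  have "((\<lambda>t. csqrt (of_real (16 * \<xi>\<^sup>2 / \<beta>\<^sup>2 * (1 / log_scale t)\<^sup>2) - 2 * \<i> * of_real \<xi>)) \<longlongrightarrow> csqrt (- 2 * \<i> * of_real \<xi>)) at_top" .
  moreover have "\<forall>\<^sub>F t in at_top. csqrt (of_real (16 * \<xi>\<^sup>2 / \<beta>\<^sup>2 * (1 / log_scale t)\<^sup>2) - 2 * \<i> * of_real \<xi>) = expo t * of_real (log_scale t / 2)"
    using eventually_log_scale_pos
  proof eventually_elim
    fix t assume L: "0 < log_scale t"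
    show "csqrt (of_real (16 * \<xi>\<^sup>2 / \<beta>\<^sup>2 * (1 / log_scale t)\<^sup>2) - 2 * \<i> * of_real \<xi>) = expo t * of_real (log_scale t / 2)"
    proof (rule csqrt_unique)
      have "(expo t * of_real (log_scale t / 2))\<^sup>2 = of_real ((freq t)\<^sup>2 * (log_scale t / 2)\<^sup>2) - \<i> * of_real (\<beta> * freq t * (log_scale t / 2)\<^sup>2)"
        unfolding power_mult_distrib expo_squared by (simp add: algebra_simps)
      also have "(freq t)\<^sup>2 * (log_scale t / 2)\<^sup>2 = 16 * \<xi>\<^sup>2 / \<beta>\<^sup>2 * (1 / log_scale t)\<^sup>2"
        using L \<beta> by (simp add: freq_def field_simps power2_eq_square)
      also have "\<beta> * freq t * (log_scale t / 2)\<^sup>2 = 2 * \<xi>"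
        using L \<beta> by (simp add: freq_def field_simps power2_eq_square)
      finally show "(expo t * of_real (log_scale t / 2))\<^sup>2 = of_real (16 * \<xi>\<^sup>2 / \<beta>\<^sup>2 * (1 / log_scale t)\<^sup>2) - 2 * \<i> * of_real \<xi>"
        by simp
      show "0 < Re (expo t * of_real (log_scale t / 2)) \<or> Re (expo t * of_real (log_scale t / 2)) = 0 \<and> 0 \<le> Im (expo t * of_real (log_scale t / 2))"
        using Re_expo_pos[OF L] L by simp
    qed
  qed
  ultimately show ?thesis by (rule Lim_transform_eventually)
qed

lemma expo_tendsto_0: "(expo \<longlongrightarrow> 0) at_top"
proof -
  have inv: "((\<lambda>t. 1 / log_scale t) \<longlongrightarrow> 0) at_top"
    using tendsto_inverse_0_at_top[OF log_scale_at_top] by (simp add: inverse_eq_divide)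
  have "((\<lambda>t. expo t * of_real (log_scale t / 2) * of_real (2 * (1 / log_scale t))) \<longlongrightarrow> csqrt (- 2 * \<i> * of_real \<xi>) * of_real (2 * 0)) at_top"
    by (intro tendsto_intros inv expo_log_scale_tendsto)
  moreover have "\<forall>\<^sub>F t in at_top. expo t * of_real (log_scale t / 2) * of_real (2 * (1 / log_scale t)) = expo t"
    using eventually_log_scale_pos
  proof eventually_elim
    fix t assume "0 < log_scale t"
    then have "log_scale t / 2 * (2 * (1 / log_scale t)) = 1" by simp
    then show "expo t * of_real (log_scale t / 2) * of_real (2 * (1 / log_scale t)) = expo t"
      by (simp only: mult.assoc of_real_mult[symmetric]) simp
  qed
  ultimately show ?thesis by (simp add: Lim_transform_eventually)
qed

lemma eventually_expo_admissible: "\<forall>\<^sub>F t in at_top. 1 \<le> t \<and> 0 < Re (expo t) \<and> Re (expo t) \<le> 1"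
proof -
  have "\<forall>\<^sub>F t in at_top. norm (expo t) < 1"
    using expo_tendsto_0 tendstoD[of expo 0 at_top 1] by simp
  with eventually_log_scale_pos eventually_ge_at_top[of 1] show ?thesis
  proof eventually_elim
    case (elim t)
    then show ?case using Re_expo_pos[of t] abs_Re_le_cmod[of "expo t"] by simp
  qed
qed

text \<open>The constants \<open>4\<close> and \<open>e\<^sup>\<gamma>\<close> inside the logarithm contribute a factor \<open>exp (O (\<kappa>))\<close>, which tends to \<open>1\<close>.\<close>

lemma prefactor_tendsto:
  "((\<lambda>t. of_real r powr expo t / of_real t powr (expo t / 2)) \<longlongrightarrow> exp (- csqrt (- 2 * \<i> * of_real \<xi>))) at_top"
proof -
  have "((\<lambda>t. exp (- (expo t * of_real (log_scale t / 2)) + expo t * of_real ((ln 4 - euler_mascheroni) / 2))) \<longlongrightarrow>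
     exp (- csqrt (- 2 * \<i> * of_real \<xi>) + 0 * of_real ((ln 4 - euler_mascheroni) / 2))) at_top"
    by (intro tendsto_intros expo_log_scale_tendsto expo_tendsto_0)
  moreover have "\<forall>\<^sub>F t in at_top. exp (- (expo t * of_real (log_scale t / 2)) + expo t * of_real ((ln 4 - euler_mascheroni) / 2))
     = of_real r powr expo t / of_real t powr (expo t / 2)"
    using eventually_gt_at_top[of 0]
  proof eventually_elim
    fix t :: real assume t: "0 < t"
    have "log_scale t = ln 4 + ln t - 2 * ln r - euler_mascheroni"
      using r t by (simp add: log_scale_def ln_div ln_mult ln_realpow)
    then have e: "- (log_scale t / 2) + (ln 4 - euler_mascheroni) / 2 = ln r - ln t / 2" by (simp add: field_simps)
    have "of_real r powr expo t / of_real t powr (expo t / 2) = exp (expo t * of_real (ln r) - expo t / 2 * of_real (ln t))"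
      using r t by (simp add: powr_def Ln_of_real exp_diff)
    also have "expo t * of_real (ln r) - expo t / 2 * of_real (ln t) = expo t * of_real (ln r - ln t / 2)"
      by (simp add: algebra_simps)
    also have "\<dots> = - (expo t * of_real (log_scale t / 2)) + expo t * of_real ((ln 4 - euler_mascheroni) / 2)"
      unfolding e[symmetric] by (simp only: of_real_add of_real_minus) (simp add: algebra_simps)
    finally show "exp (- (expo t * of_real (log_scale t / 2)) + expo t * of_real ((ln 4 - euler_mascheroni) / 2))
     = of_real r powr expo t / of_real t powr (expo t / 2)" ..
  qed
  ultimately show ?thesis by (simp add: Lim_transform_eventually)
qed

lemma AE_cgauss_nonzero: "AE z in cgauss. z \<noteq> 0"
proof -
  have "AE x in std_normal_distribution. x \<noteq> 0"
    by (subst AE_density) (auto intro: AE_mp[OF AE_lborel_singleton[of 0]])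
  then have "AE x in distr cgauss std_normal_distribution Re. x \<noteq> 0" by (simp only: distr_cgauss_Re)
  then have "AE z in cgauss. Re z \<noteq> 0" by (rule AE_distrD[rotated]) measurable
  then show ?thesis by eventually_elim auto
qed

text \<open>At time \<open>t\<close> the radius divided by \<open>\<surd>t\<close> converges to \<open>\<surd>2 |z|\<close>, which is almost surely positive, and a positive number
  to a power that tends to \<open>0\<close> tends to \<open>1\<close>.\<close>

lemma remainder_tendsto_0:
  "((\<lambda>t. LINT z|cgauss. norm (1 - of_real (norm (y\<^sub>0 / of_real (sqrt t) + of_real (sqrt 2) * z)) powr expo t)) \<longlongrightarrow> 0) at_top"
proof -
  let ?g = "\<lambda>t z. norm (1 - of_real (norm (y\<^sub>0 / of_real (sqrt t) + of_real (sqrt 2) * z)) powr expo t)"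
  have "((\<lambda>t. LINT z|cgauss. ?g t z) \<longlongrightarrow> (LINT z|cgauss. 0)) at_top"
  proof (rule integral_dominated_convergence_at_top)
    show "integrable cgauss (\<lambda>z. (2 + norm y\<^sub>0) + sqrt 2 * norm z)"
      using integrable_norm[OF integrable_cgauss_moments(1)] by simp
    show "\<forall>\<^sub>F t in at_top. AE z in cgauss. norm (?g t z) \<le> (2 + norm y\<^sub>0) + sqrt 2 * norm z"
      using eventually_expo_admissible
    proof eventually_elim
      fix t assume t: "1 \<le> t \<and> 0 < Re (expo t) \<and> Re (expo t) \<le> 1"
      show "AE z in cgauss. norm (?g t z) \<le> (2 + norm y\<^sub>0) + sqrt 2 * norm z"
      proof (rule AE_I2)
        fix z
        let ?y = "y\<^sub>0 / of_real (sqrt t) + of_real (sqrt 2) * z"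
        have "norm (1 - (of_real (norm ?y) :: complex) powr expo t) \<le> 1 + norm ?y powr Re (expo t)"
          using norm_triangle_ineq4[of 1 "(of_real (norm ?y) :: complex) powr expo t"] by (simp add: norm_powr_real_powr)
        also have "\<dots> \<le> 1 + (1 + norm ?y)" using t by (intro add_left_mono powr_le_one_plus) auto
        also have "norm ?y \<le> norm y\<^sub>0 / sqrt t + sqrt 2 * norm z"
          using t norm_triangle_ineq[of "y\<^sub>0 / of_real (sqrt t)" "of_real (sqrt 2) * z"] by (simp add: norm_mult norm_divide)
        also have "norm y\<^sub>0 / sqrt t \<le> norm y\<^sub>0 / 1" using t by (intro divide_left_mono) auto
        finally show "norm (norm (1 - of_real (norm ?y) powr expo t)) \<le> (2 + norm y\<^sub>0) + sqrt 2 * norm z" by simp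
      qed
    qed
    show "AE z in cgauss. ((\<lambda>t. ?g t z) \<longlongrightarrow> 0) at_top"
      using AE_cgauss_nonzero
    proof eventually_elim
      fix z :: complex assume z: "z \<noteq> 0"
      define b where "b t = norm (y\<^sub>0 / of_real (sqrt t) + of_real (sqrt 2) * z)" for t
      have b: "(b \<longlongrightarrow> norm (0 + of_real (sqrt 2) * z)) at_top"
      proof -
        have "((\<lambda>t. y\<^sub>0 / of_real (sqrt t)) \<longlongrightarrow> 0) at_top"
        proof -
          have "((\<lambda>t::real. 1 / sqrt t) \<longlongrightarrow> 0) at_top" by real_asymp
          then have "((\<lambda>t. y\<^sub>0 * of_real (1 / sqrt t)) \<longlongrightarrow> y\<^sub>0 * of_real 0) at_top" by (intro tendsto_intros)
          then show ?thesis by simp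
        qed
        then show ?thesis unfolding b_def [abs_def] by (intro tendsto_intros)
      qed
      have pos: "0 < norm (0 + of_real (sqrt 2) * z)" using z by simp
      have lb: "((\<lambda>t. ln (b t)) \<longlongrightarrow> ln (norm (0 + of_real (sqrt 2) * z))) at_top"
        using pos by (intro tendsto_ln b) auto
      have "((\<lambda>t. norm (1 - exp (expo t * of_real (ln (b t))))) \<longlongrightarrow> norm (1 - exp (0 * of_real (ln (norm (0 + of_real (sqrt 2) * z))) :: complex))) at_top"
        by (intro tendsto_intros expo_tendsto_0 lb)
      moreover have "\<forall>\<^sub>F t in at_top. norm (1 - exp (expo t * of_real (ln (b t)))) = norm (1 - of_real (b t) powr expo t)"
        using order_tendstoD(1)[OF b pos] by eventually_elim (simp add: powr_def Ln_of_real)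
      ultimately show "((\<lambda>t. ?g t z) \<longlongrightarrow> 0) at_top"
        unfolding b_def by (simp add: Lim_transform_eventually)
    qed
  qed auto
  then show ?thesis by simp
qed

text \<open>The factor \<open>t\<close> to the power \<open>\<kappa> / 2\<close> is \<open>\<surd>t\<close> to the power \<open>\<kappa>\<close> and can be taken out of the radius.\<close>

lemma remainder_rescale:
  assumes t: "0 < t"
  shows "(LINT z|cgauss. norm (of_real t powr (expo t / 2) - of_real (norm (y\<^sub>0 + of_real (sqrt (2 * t)) * z)) powr expo t)) =
    norm (of_real t powr (expo t / 2)) * (LINT z|cgauss. norm (1 - of_real (norm (y\<^sub>0 / of_real (sqrt t) + of_real (sqrt 2) * z)) powr expo t))"
proof -
  have "norm (of_real t powr (expo t / 2) - of_real (norm (y\<^sub>0 + of_real (sqrt (2 * t)) * z)) powr expo t) =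
    norm (of_real t powr (expo t / 2)) * norm (1 - of_real (norm (y\<^sub>0 / of_real (sqrt t) + of_real (sqrt 2) * z)) powr expo t)" for z
  proof -
    have "y\<^sub>0 + of_real (sqrt (2 * t)) * z = of_real (sqrt t) * (y\<^sub>0 / of_real (sqrt t) + of_real (sqrt 2) * z)"
      using t by (simp add: field_simps real_sqrt_mult)
    then have "norm (y\<^sub>0 + of_real (sqrt (2 * t)) * z) = sqrt t * norm (y\<^sub>0 / of_real (sqrt t) + of_real (sqrt 2) * z)"
      using t by (simp only: norm_mult) simp
    then have "(of_real (norm (y\<^sub>0 + of_real (sqrt (2 * t)) * z)) :: complex) powr expo t =
        of_real (sqrt t) powr expo t * of_real (norm (y\<^sub>0 / of_real (sqrt t) + of_real (sqrt 2) * z)) powr expo t"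
      using t by (simp only: of_real_mult) (rule powr_times_real, auto)
    moreover have "(of_real (sqrt t) :: complex) powr expo t = of_real t powr (expo t / 2)"
      using t by (simp add: powr_def Ln_of_real ln_sqrt)
    ultimately show ?thesis unfolding norm_mult[symmetric] by (simp add: right_diff_distrib)
  qed
  then show ?thesis by simp
qed

end

section \<open>From the stochastic differential equation to the walk\<close>

definition to_complex :: "real^2 \<Rightarrow> complex" where
  "to_complex x = Complex (x $ 1) (x $ 2)"

lemma bounded_linear_to_complex: "bounded_linear to_complex"
proof -
  have "linear to_complex"
    by (rule linearI) (simp_all add: to_complex_def complex_eq_iff)
  then show ?thesis by (rule linear_conv_bounded_linear[THEN iffD1])
qed

lemma norm_to_complex [simp]: "norm (to_complex x) = norm x"
  by (simp add: to_complex_def norm_vec_def L2_set_def sum_2 cmod_def)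

lemma to_complex_eq_0_iff [simp]: "to_complex x = 0 \<longleftrightarrow> x = 0"
  by (metis norm_to_complex norm_eq_zero)

lemma measurable_to_complex [measurable]: "to_complex \<in> borel_measurable borel"
  by (intro borel_measurable_continuous_onI linear_continuous_on bounded_linear_to_complex)

lemma to_complex_drift: "to_complex (vortex_drift \<beta> x) = \<i> * of_real \<beta> / cnj (to_complex x)"
proof (cases "x = 0")
  case False
  have p: "to_complex (perp x) = \<i> * to_complex x"
    by (simp add: to_complex_def perp_def complex_eq_iff vector_2)
  have "to_complex (vortex_drift \<beta> x) = of_real (\<beta> / (norm x)\<^sup>2) * (\<i> * to_complex x)"
    unfolding vortex_drift_def linear_cmul[OF bounded_linear.linear[OF bounded_linear_to_complex]] p by (simp add: scaleR_conv_of_real)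
  also have "of_real ((norm x)\<^sup>2) = to_complex x * cnj (to_complex x)"
    using complex_norm_square[of "to_complex x"] by simp
  then have "of_real (\<beta> / (norm x)\<^sup>2) * (\<i> * to_complex x) = \<i> * of_real \<beta> / cnj (to_complex x)"
    using False by (simp only: of_real_divide) (simp add: field_simps)
  finally show ?thesis .
qed (simp add: vortex_drift_def linear_0[OF bounded_linear.linear[OF bounded_linear_to_complex]])

lemma to_complex_polar: "polar_angle x \<theta> \<Longrightarrow> to_complex x = of_real (norm x) * cis \<theta>"
proof -
  assume "polar_angle x \<theta>"
  then have "x $ 1 = norm x * cos \<theta>" "x $ 2 = norm x * sin \<theta>"
    unfolding polar_angle_def by (metis vector_scaleR_component real_scaleR_def vector_2)+
  then show ?thesis by (simp add: to_complex_def complex_eq_iff)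
qed

text \<open>Divided by the standard deviation, the coordinates of the increment are independent standard normal
  variables. For \<open>s = t\<close> both sides are the point mass at \<open>0\<close>.\<close>

lemma brownian_increment_law:
  assumes W: "planar_brownian_motion M F W" and M: "prob_space M" and st: "0 \<le> s" "s \<le> t"
  shows "distr M borel (\<lambda>\<omega>. to_complex (W t \<omega>) - to_complex (W s \<omega>)) = distr cgauss borel (\<lambda>z. of_real (sqrt (t - s)) * z)"
proof (cases "s = t")
  case True
  then show ?thesis
    using prob_space.distr_const[OF M, of 0 borel] cgauss.distr_const[of 0 borel] by simp
next
  case False
  interpret prob_space M by (rule M)
  define \<sigma> where "\<sigma> = sqrt (t - s)"
  have s: "0 < \<sigma>" using st False by (simp add: \<sigma>_def)
  define f where "f p = (p t - p s) / \<sigma>" for p :: "real \<Rightarrow> real"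
  have f: "f \<in> borel_measurable (PiM {0..} (\<lambda>_. borel))"
  proof -
    have "(\<lambda>p. p u) \<in> borel_measurable (PiM {0..} (\<lambda>_. borel))" if "0 \<le> u" for u :: real
      by (rule measurable_component_singleton) (use that in simp)
    then show ?thesis unfolding f_def
      using st by (intro borel_measurable_divide borel_measurable_diff) auto
  qed
  define U V where "U \<omega> = (W t \<omega> $ 1 - W s \<omega> $ 1) / \<sigma>" and "V \<omega> = (W t \<omega> $ 2 - W s \<omega> $ 2) / \<sigma>" for \<omega>
  have "indep_var (PiM {0..} (\<lambda>_. borel)) (\<lambda>\<omega>. \<lambda>t\<in>{0..}. W t \<omega> $ 1)
       (PiM {0..} (\<lambda>_. borel)) (\<lambda>\<omega>. \<lambda>t\<in>{0..}. W t \<omega> $ 2)"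
    using W by (simp add: planar_brownian_motion_def)
  from indep_var_compose[OF this f f]
  have ind: "indep_var borel U borel V"
    using st by (simp add: comp_def f_def U_def [abs_def] V_def [abs_def])
  have rv: "U \<in> borel_measurable M" "V \<in> borel_measurable M"
    using indep_var_rv1[OF ind] indep_var_rv2[OF ind] by auto
  have law: "distr M borel U = std_normal_distribution" "distr M borel V = std_normal_distribution"
  proof -
    have "distributed M lborel (\<lambda>\<omega>. W t \<omega> $ 1 - W s \<omega> $ 1) (\<lambda>x. ennreal (normal_density 0 \<sigma> x))"
      "distributed M lborel (\<lambda>\<omega>. W t \<omega> $ 2 - W s \<omega> $ 2) (\<lambda>x. ennreal (normal_density 0 \<sigma> x))"
      using W st False unfolding planar_brownian_motion_def standard_brownian_motion_def \<sigma>_def by auto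
    then have "distributed M lborel U std_normal_density" "distributed M lborel V std_normal_density"
      unfolding normal_standard_normal_convert[OF s] U_def V_def by simp_all
    then have "distr M lborel U = std_normal_distribution" "distr M lborel V = std_normal_distribution"
      by (auto dest: distributed_distr_eq_density)
    moreover have "distr M borel X = distr M lborel X" for X :: "'a \<Rightarrow> real" by (rule distr_cong) auto
    ultimately show "distr M borel U = std_normal_distribution" "distr M borel V = std_normal_distribution" by simp_all
  qed
  have cm: "(\<lambda>(x, y). Complex x y) \<in> measurable (borel \<Otimes>\<^sub>M borel) borel" by measurable
  have pm: "(\<lambda>\<omega>. (U \<omega>, V \<omega>)) \<in> measurable M (borel \<Otimes>\<^sub>M borel)" using rv by measurable
  have "distr M (borel \<Otimes>\<^sub>M borel) (\<lambda>\<omega>. (U \<omega>, V \<omega>)) = std_normal_distribution \<Otimes>\<^sub>M std_normal_distribution"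
    using ind unfolding indep_var_distribution_eq law by simp
  then have "cgauss = distr (distr M (borel \<Otimes>\<^sub>M borel) (\<lambda>\<omega>. (U \<omega>, V \<omega>))) borel (\<lambda>(x, y). Complex x y)"
    by (simp add: cgauss_def)
  also have "\<dots> = distr M borel ((\<lambda>(x, y). Complex x y) \<circ> (\<lambda>\<omega>. (U \<omega>, V \<omega>)))"
    by (rule distr_distr[OF cm pm])
  finally have "distr cgauss borel (\<lambda>z. of_real \<sigma> * z) = distr (distr M borel ((\<lambda>(x, y). Complex x y) \<circ> (\<lambda>\<omega>. (U \<omega>, V \<omega>)))) borel (\<lambda>z. of_real \<sigma> * z)"
    by simp
  also have "\<dots> = distr M borel ((\<lambda>z. of_real \<sigma> * z) \<circ> ((\<lambda>(x, y). Complex x y) \<circ> (\<lambda>\<omega>. (U \<omega>, V \<omega>))))"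
    by (rule distr_distr[OF _ measurable_comp[OF pm cm]]) measurable
  also have "((\<lambda>z. of_real \<sigma> * z) \<circ> ((\<lambda>(x, y). Complex x y) \<circ> (\<lambda>\<omega>. (U \<omega>, V \<omega>)))) = (\<lambda>\<omega>. to_complex (W t \<omega>) - to_complex (W s \<omega>))"
    using s by (auto simp: fun_eq_iff complex_eq_iff to_complex_def U_def V_def)
  finally show ?thesis by (simp add: \<sigma>_def)
qed

lemma gaussian_increments_brownian:
  assumes W: "planar_brownian_motion M F W" and M: "prob_space M" and h: "0 < h"
  shows "gaussian_increments M (\<lambda>i. F (real i * h))
    (\<lambda>i \<omega>. to_complex (W (real (Suc i) * h) \<omega>) - to_complex (W (real i * h) \<omega>)) h"
proof -
  interpret prob_space M by (rule M)
  have fil: "filtration (space M) F" and FM: "\<And>t. 0 \<le> t \<Longrightarrow> sets (F t) \<subseteq> sets M"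
    and WF: "\<And>t. 0 \<le> t \<Longrightarrow> W t \<in> borel_measurable (F t)"
    and ind: "\<And>s t. 0 \<le> s \<Longrightarrow> s < t \<Longrightarrow> indep_set (sets (F s)) (sets (vimage_algebra (space M) (\<lambda>\<omega>. W t \<omega> - W s \<omega>) borel))"
    using W by (auto simp: planar_brownian_motion_def)
  interpret F: filtration "space M" F by (rule fil)
  have nn: "0 \<le> real i * h" for i using h by simp
  have lt: "real i * h < real (Suc i) * h" for i using h by simp
  have W_le: "W s \<in> borel_measurable (F t)" if "0 \<le> s" "s \<le> t" for s t
    by (rule measurable_from_subalg[OF _ WF[OF that(1)]])
       (use F.sets_F_mono[OF that(2)] in \<open>auto simp: subalgebra_def F.space_F\<close>)
  let ?\<xi> = "\<lambda>i \<omega>. to_complex (W (real (Suc i) * h) \<omega>) - to_complex (W (real i * h) \<omega>)"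
  have diff: "?\<xi> i \<omega> = to_complex (W (real (Suc i) * h) \<omega> - W (real i * h) \<omega>)" for i \<omega>
    by (simp add: to_complex_def complex_eq_iff)
  show ?thesis
  proof unfold_locales
    show "0 < h" by (rule h)
    show "space (F (real i * h)) = space M" for i by (rule F.space_F)
    show "sets (F (real i * h)) \<subseteq> sets M" for i by (rule FM[OF nn])
    show "sets (F (real i * h)) \<subseteq> sets (F (real (Suc i) * h))" for i
      by (rule F.sets_F_mono) (use lt[of i] in simp)
    show "?\<xi> i \<in> borel_measurable (F (real (Suc i) * h))" for i
    proof -
      have [measurable]: "W (real (Suc i) * h) \<in> borel_measurable (F (real (Suc i) * h))"
        "W (real i * h) \<in> borel_measurable (F (real (Suc i) * h))"
        using nn[of i] nn[of "Suc i"] lt[of i] by (auto intro!: W_le)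
      show ?thesis by measurable
    qed
    show "indep_set (sets (F (real i * h))) (sets (vimage_algebra (space M) (?\<xi> i) borel))" for i
    proof -
      let ?D = "\<lambda>\<omega>. W (real (Suc i) * h) \<omega> - W (real i * h) \<omega>"
      have "sets (vimage_algebra (space M) (?\<xi> i) borel) \<subseteq> sets (vimage_algebra (space M) ?D borel)"
      proof -
        have "?D \<in> measurable (vimage_algebra (space M) ?D borel) borel"
          by (rule measurable_vimage_algebra1) auto
        then have "(\<lambda>\<omega>. to_complex (?D \<omega>)) \<in> measurable (vimage_algebra (space M) ?D borel) borel"
          by measurable
        then have "?\<xi> i \<in> measurable (vimage_algebra (space M) ?D borel) borel" by (simp only: diff)
        then have "{?\<xi> i -` A \<inter> space M | A. A \<in> sets borel} \<subseteq> sets (vimage_algebra (space M) ?D borel)"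
          by (auto dest: measurable_sets)
        then show ?thesis
          using sets.sigma_sets_subset[of _ "vimage_algebra (space M) ?D borel"] by (simp add: sets_vimage_algebra)
      qed
      with ind[OF nn lt, of i] show ?thesis
        unfolding indep_set_def by (elim indep_sets_mono_sets) (auto split: bool.split)
    qed
    show "distr M borel (?\<xi> i) = distr cgauss borel (\<lambda>z. of_real (sqrt h) * z)" for i
    proof -
      have "real (Suc i) * h - real i * h = h" by (simp add: algebra_simps)
      then show ?thesis
        using brownian_increment_law[OF W M nn[of i] less_imp_le[OF lt[of i]]] by (simp only:)
    qed
    show "distr M borel (\<lambda>\<omega>. \<Sum>j<i. ?\<xi> j \<omega>) = distr cgauss borel (\<lambda>z. of_real (sqrt (real i * h)) * z)" for i
    proof -
      have "(\<Sum>j<i. ?\<xi> j \<omega>) = to_complex (W (real i * h) \<omega>) - to_complex (W 0 \<omega>)" for \<omega>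
        using sum_lessThan_telescope[of "\<lambda>j. to_complex (W (real j * h) \<omega>)" i] by simp
      then show ?thesis
        using brownian_increment_law[OF W M order_refl nn[of i]] by simp
    qed
  qed
qed

lemma bounded_linear_perp: "bounded_linear perp"
proof -
  have "linear perp"
    by (rule linearI) (simp_all add: perp_def vec_eq_iff forall_2)
  then show ?thesis by (rule linear_conv_bounded_linear[THEN iffD1])
qed

lemma turning_tendsto_winding:
  fixes R W :: "real \<Rightarrow> real^2" and \<Theta> :: "real \<Rightarrow> real"
  assumes t: "0 < t"
    and path: "continuous_on {0..} R" "\<forall>t\<ge>0. R t \<noteq> 0" "R 0 = r\<^sub>0"
      "\<forall>t\<ge>0. R t = r\<^sub>0 + integral {0..t} (\<lambda>s. vortex_drift \<beta> (R s)) + sqrt 2 *\<^sub>R W t"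
    and angle: "\<Theta> 0 = 0" "continuous_on {0..} \<Theta>" "\<forall>t\<ge>0. polar_angle (R t) (\<theta>\<^sub>0 + \<Theta> t)"
  shows "(\<lambda>n. let h = t / real n in
     turning \<beta> h (walk (cis (- a) * to_complex r\<^sub>0) (phase \<beta> h a (\<lambda>j. to_complex (R (real j * h))))
       (\<lambda>j. to_complex (W (real (Suc j) * h)) - to_complex (W (real j * h)))) n) \<longlonglongrightarrow> \<Theta> t"
proof -
  define r where "r u = to_complex (R u)" for u
  define w where "w u = to_complex (W u)" for u
  have contR: "continuous_on {0..t} (\<lambda>u. R u)" using path by (auto intro: continuous_on_subset)
  have cr: "continuous_on {0..t} r"
    unfolding r_def by (intro bounded_linear.continuous_on[OF bounded_linear_to_complex] contR)
  have r0': "r 0 = to_complex r\<^sub>0" using path by (simp add: r_def)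
  have rnz: "r u \<noteq> 0" if "0 \<le> u" for u using path that by (simp add: r_def)
  have sde: "r u = r 0 + integral {0..u} (\<lambda>v. \<i> * of_real \<beta> / cnj (r v)) + of_real (sqrt 2) * w u"
    if u: "0 \<le> u" "u \<le> t" for u
  proof -
    have vd: "continuous_on {0..u} (\<lambda>v. vortex_drift \<beta> (R v))"
    proof -
      have "continuous_on {0..u} (\<lambda>v. R v)" using contR u by (auto intro: continuous_on_subset)
      moreover have "R v \<noteq> 0" if "v \<in> {0..u}" for v using path that by auto
      ultimately show ?thesis unfolding vortex_drift_def
        by (intro continuous_intros bounded_linear.continuous_on[OF bounded_linear_perp]) auto
    qed
    have "to_complex (integral {0..u} (\<lambda>v. vortex_drift \<beta> (R v))) = integral {0..u} (to_complex \<circ> (\<lambda>v. vortex_drift \<beta> (R v)))"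
      by (intro integral_linear[symmetric] integrable_continuous_interval vd bounded_linear_to_complex)
    also have "\<dots> = integral {0..u} (\<lambda>v. \<i> * of_real \<beta> / cnj (r v))"
      by (simp add: comp_def to_complex_drift r_def)
    finally have 1: "to_complex (integral {0..u} (\<lambda>v. vortex_drift \<beta> (R v))) = integral {0..u} (\<lambda>v. \<i> * of_real \<beta> / cnj (r v))" .
    have "r u = to_complex (r\<^sub>0 + integral {0..u} (\<lambda>s. vortex_drift \<beta> (R s)) + sqrt 2 *\<^sub>R W u)"
      using path u by (metis r_def)
    also have "\<dots> = to_complex r\<^sub>0 + to_complex (integral {0..u} (\<lambda>s. vortex_drift \<beta> (R s))) + sqrt 2 *\<^sub>R to_complex (W u)"
      using bounded_linear.linear[OF bounded_linear_to_complex] by (simp add: linear_add linear_cmul)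
    finally show ?thesis by (simp add: 1 r0' w_def scaleR_conv_of_real)
  qed
  have pol: "r u = of_real (norm (r u)) * cis (\<theta>\<^sub>0 + \<Theta> u)" if "0 \<le> u" for u
    unfolding r_def norm_to_complex by (rule to_complex_polar[OF angle(3)[rule_format, OF that]])
  have "(\<lambda>n. let h = t / real n in
     turning \<beta> h (walk (cis (- a) * r 0) (phase \<beta> h a (\<lambda>j. r (real j * h)))
       (\<lambda>j. w (real (Suc j) * h) - w (real j * h))) n) \<longlonglongrightarrow> \<Theta> t"
  proof (rule turning_tendsto_angle[OF t cr, where \<theta>="\<lambda>u. \<Theta> u" and \<theta>\<^sub>0=\<theta>\<^sub>0])
    show "continuous_on {0..t} (\<lambda>u. \<Theta> u)" using angle by (auto intro: continuous_on_subset)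
    show "r u \<noteq> 0" if "0 \<le> u" for u using that by (rule rnz)
    show "r u = r 0 + integral {0..u} (\<lambda>v. \<i> * of_real \<beta> / cnj (r v)) + of_real (sqrt 2) * w u"
      if "0 \<le> u" "u \<le> t" for u using that by (rule sde)
    show "r u = of_real (norm (r u)) * cis (\<theta>\<^sub>0 + \<Theta> u)" if "0 \<le> u" for u using that by (rule pol)
    show "\<Theta> 0 = 0" by (rule angle)
  qed
  then show ?thesis by (simp only: r_def w_def path(3))
qed

text \<open>The mesh tends to \<open>0\<close> at a fixed time \<open>t\<close>. The initial phase \<open>\<theta>\<^sub>0 - \<pi> / 4\<close> makes the walk start on the
  diagonal, as \<open>cgauss_inverse_moment\<close> requires.\<close>

lemma winding_char_bound:
  fixes M :: "'a measure" and R :: "real \<Rightarrow> 'a \<Rightarrow> real^2" and s :: complex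
  assumes M: "prob_space M" and \<beta>: "\<beta> > 0" and r0: "r\<^sub>0 \<noteq> 0"
    and sol: "vortex_sde_solution M F W \<beta> r\<^sub>0 R"
    and polar0: "polar_angle r\<^sub>0 \<theta>\<^sub>0"
    and wind: "total_winding_angle M \<theta>\<^sub>0 R \<Theta>"
    and t: "0 < t" and k: "0 < Re \<kappa>" "Re \<kappa> \<le> 1"
    and \<kappa>: "\<kappa>\<^sup>2 = (of_real \<mu>)\<^sup>2 - \<i> * of_real (\<beta> * \<mu>)"
  defines "y\<^sub>0 \<equiv> Complex (norm r\<^sub>0 / sqrt 2) (norm r\<^sub>0 / sqrt 2)"
  shows "norm (s * (LINT \<omega>|M. cis (\<mu> * \<Theta> t \<omega>)) - of_real (norm r\<^sub>0) powr \<kappa>) \<le>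
     (LINT z|cgauss. norm (s - of_real (norm (y\<^sub>0 + of_real (sqrt (2 * t)) * z)) powr \<kappa>))"
proof -
  interpret prob_space M by (rule M)
  have W: "planar_brownian_motion M F W" and RF: "\<And>t. 0 \<le> t \<Longrightarrow> R t \<in> borel_measurable (F t)"
    using sol by (auto simp: vortex_sde_solution_def)
  have \<Theta>M: "\<Theta> t \<in> borel_measurable M" using wind t by (simp add: total_winding_angle_def)
  have b: "0 < norm r\<^sub>0 / sqrt 2" using r0 by simp
  define a where "a = \<theta>\<^sub>0 - pi / 4"
  have y0: "cis (- a) * to_complex r\<^sub>0 = y\<^sub>0"
  proof -
    have "cis (- a) * to_complex r\<^sub>0 = of_real (norm r\<^sub>0) * cis (pi / 4)"
      unfolding to_complex_polar[OF polar0] a_def by (simp add: cis_mult algebra_simps)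
    also have "\<dots> = y\<^sub>0"
      by (simp add: y\<^sub>0_def complex_eq_iff cos_45 sin_45 real_div_sqrt field_simps)
    finally show ?thesis .
  qed
  have ny0: "norm y\<^sub>0 = norm r\<^sub>0"
    by (metis y0 norm_mult norm_cis mult_1 norm_to_complex)
  obtain C where C: "0 \<le> C" "\<And>c. norm (exp (\<i> * of_real (\<beta> * \<mu> * (norm c)\<^sup>2 / 2)) * (LINT z|cgauss. spiral \<kappa> \<mu> (1 + c * z)) - 1)
         \<le> C * norm c powr (2 + Re \<kappa> / 2)"
    using spiral_step[OF k \<kappa>] by blast
  obtain K where K: "0 \<le> K" "\<And>\<sigma>. 0 \<le> \<sigma> \<Longrightarrow> (\<integral>\<^sup>+z. inv_powr2 (2 - Re \<kappa> / 2) (y\<^sub>0 + of_real \<sigma> * z) \<partial>cgauss) \<le> ennreal K"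
    using cgauss_inverse_moment[of "2 - Re \<kappa> / 2" "norm r\<^sub>0 / sqrt 2"] k b unfolding y\<^sub>0_def by auto
  define T where "T n \<omega> = (let h = t / real n in
     turning \<beta> h (walk (cis (- a) * to_complex r\<^sub>0) (phase \<beta> h a (\<lambda>j. to_complex (R (real j * h) \<omega>)))
       (\<lambda>j. to_complex (W (real (Suc j) * h) \<omega>) - to_complex (W (real j * h) \<omega>))) n)" for n \<omega>
  have step: "T n \<in> borel_measurable M \<and> norm (s * (LINT \<omega>|M. cis (\<mu> * T n \<omega>)) - of_real (norm r\<^sub>0) powr \<kappa>) \<le>
     (LINT z|cgauss. norm (s - of_real (norm (y\<^sub>0 + of_real (sqrt (2 * t)) * z)) powr \<kappa>))
       + real n * (C * (2 * (t / real n)) powr (1 + Re \<kappa> / 4) * K)" if n: "0 < n" for n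
  proof -
    define h where "h = t / real n"
    have h: "0 < h" "real n * h = t" using t n by (simp_all add: h_def)
    interpret I: gaussian_increments M "\<lambda>i. F (real i * h)"
      "\<lambda>i \<omega>. to_complex (W (real (Suc i) * h) \<omega>) - to_complex (W (real i * h) \<omega>)" h
      by (rule gaussian_increments_brownian[OF W M h(1)])
    define \<alpha> where "\<alpha> j \<omega> = phase \<beta> h a (\<lambda>j. to_complex (R (real j * h) \<omega>)) j" for j \<omega>
    have \<alpha>: "\<alpha> j \<in> borel_measurable (F (real j * h))" for j
    proof -
      interpret F: filtration "space M" F using W by (simp add: planar_brownian_motion_def)
      have "R (real i * h) \<in> borel_measurable (F (real j * h))" if "i < j" for i
      proof (rule measurable_from_subalg)
        show "R (real i * h) \<in> borel_measurable (F (real i * h))" using h by (intro RF) simp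
        have "real i * h \<le> real j * h" using that h by (intro mult_right_mono) auto
        then show "subalgebra (F (real j * h)) (F (real i * h))"
          using F.sets_F_mono by (auto simp: subalgebra_def F.space_F)
      qed
      then show ?thesis unfolding \<alpha>_def [abs_def] phase_def
        by (intro borel_measurable_add borel_measurable_const borel_measurable_sum borel_measurable_divide
            borel_measurable_power borel_measurable_norm measurable_compose[OF _ measurable_to_complex]) auto
    qed
    have T: "T n \<omega> = turning \<beta> h (\<lambda>j. walk y\<^sub>0 (\<lambda>j. \<alpha> j \<omega>) (\<lambda>j. to_complex (W (real (Suc j) * h) \<omega>) - to_complex (W (real j * h) \<omega>)) j) n" for \<omega>
      by (simp add: T_def Let_def h_def[symmetric] y0 \<alpha>_def [abs_def])
    have "T n \<in> borel_measurable M"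
      unfolding T [abs_def] by (rule I.measurable_G_M[OF I.turning_adapted[OF \<alpha>]])
    moreover have "norm (s * (LINT \<omega>|M. cis (\<mu> * T n \<omega>)) - of_real (norm y\<^sub>0) powr \<kappa>) \<le>
     (LINT z|cgauss. norm (s - of_real (norm (y\<^sub>0 + of_real (sqrt (2 * (real n * h))) * z)) powr \<kappa>))
       + real n * (C * (2 * h) powr (1 + Re \<kappa> / 4) * K)"
      unfolding T by (rule I.turning_char_bound[OF \<alpha> k C K])
    ultimately show ?thesis by (simp only: ny0 h) (simp add: h_def)
  qed
  have lim: "AE \<omega> in M. (\<lambda>n. T n \<omega>) \<longlonglongrightarrow> \<Theta> t \<omega>"
  proof -
    have "AE \<omega> in M. continuous_on {0..} (\<lambda>t. R t \<omega>) \<and> (\<forall>t\<ge>0. R t \<omega> \<noteq> 0) \<and> R 0 \<omega> = r\<^sub>0 \<and>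
        (\<forall>t\<ge>0. R t \<omega> = r\<^sub>0 + integral {0..t} (\<lambda>s. vortex_drift \<beta> (R s \<omega>)) + sqrt 2 *\<^sub>R W t \<omega>)"
      by (fact sol[unfolded vortex_sde_solution_def, THEN conjunct2, THEN conjunct2])
    moreover have "AE \<omega> in M. \<Theta> 0 \<omega> = 0 \<and> continuous_on {0..} (\<lambda>t. \<Theta> t \<omega>) \<and> (\<forall>t\<ge>0. polar_angle (R t \<omega>) (\<theta>\<^sub>0 + \<Theta> t \<omega>))"
      by (fact wind[unfolded total_winding_angle_def, THEN conjunct2])
    ultimately show ?thesis
    proof (rule eventually_elim2)
      fix \<omega>
      assume p: "continuous_on {0..} (\<lambda>t. R t \<omega>) \<and> (\<forall>t\<ge>0. R t \<omega> \<noteq> 0) \<and> R 0 \<omega> = r\<^sub>0 \<and>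
          (\<forall>t\<ge>0. R t \<omega> = r\<^sub>0 + integral {0..t} (\<lambda>s. vortex_drift \<beta> (R s \<omega>)) + sqrt 2 *\<^sub>R W t \<omega>)"
        and q: "\<Theta> 0 \<omega> = 0 \<and> continuous_on {0..} (\<lambda>t. \<Theta> t \<omega>) \<and> (\<forall>t\<ge>0. polar_angle (R t \<omega>) (\<theta>\<^sub>0 + \<Theta> t \<omega>))"
      show "(\<lambda>n. T n \<omega>) \<longlonglongrightarrow> \<Theta> t \<omega>"
        unfolding T_def
        by (rule turning_tendsto_winding[OF t, where R="\<lambda>u. R u \<omega>" and W="\<lambda>u. W u \<omega>" and \<Theta>="\<lambda>u. \<Theta> u \<omega>" and \<theta>\<^sub>0=\<theta>\<^sub>0])
           (use p q in blast)+
    qed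
  qed
  have TM: "T (Suc n) \<in> borel_measurable M" for n using step by simp
  have char_lim: "(\<lambda>n. LINT \<omega>|M. cis (\<mu> * T (Suc n) \<omega>)) \<longlonglongrightarrow> (LINT \<omega>|M. cis (\<mu> * \<Theta> t \<omega>))"
  proof (rule integral_dominated_convergence[where w="\<lambda>_. 1"])
    show "AE \<omega> in M. (\<lambda>n. cis (\<mu> * T (Suc n) \<omega>)) \<longlonglongrightarrow> cis (\<mu> * \<Theta> t \<omega>)"
      using lim by eventually_elim (intro tendsto_intros LIMSEQ_Suc)
  qed (use TM \<Theta>M in \<open>auto simp: cis_conv_exp\<close>)
  have "(\<lambda>n. real n * (C * (2 * (t / real n)) powr (1 + Re \<kappa> / 4) * K)) \<longlonglongrightarrow> 0"
  proof -
    have "(\<lambda>n. (2 * t) powr (1 + Re \<kappa> / 4) * C * K * real n powr (- (Re \<kappa> / 4))) \<longlonglongrightarrow> (2 * t) powr (1 + Re \<kappa> / 4) * C * K * 0"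
      using k by (intro tendsto_intros tendsto_neg_powr filterlim_real_sequentially) auto
    moreover have "\<forall>\<^sub>F n in sequentially. (2 * t) powr (1 + Re \<kappa> / 4) * C * K * real n powr (- (Re \<kappa> / 4)) = real n * (C * (2 * (t / real n)) powr (1 + Re \<kappa> / 4) * K)"
      using eventually_gt_at_top[of 0]
    proof eventually_elim
      fix n :: nat assume n: "0 < n"
      have "(2 * (t / real n)) powr (1 + Re \<kappa> / 4) = (2 * t) powr (1 + Re \<kappa> / 4) / real n powr (1 + Re \<kappa> / 4)"
        by (simp add: powr_divide[symmetric])
      also have "real n powr (1 + Re \<kappa> / 4) = real n * real n powr (Re \<kappa> / 4)"
        using n by (simp add: powr_add)
      finally show "(2 * t) powr (1 + Re \<kappa> / 4) * C * K * real n powr (- (Re \<kappa> / 4)) = real n * (C * (2 * (t / real n)) powr (1 + Re \<kappa> / 4) * K)"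
        using n by (simp add: powr_minus field_simps)
    qed
    ultimately show ?thesis by (simp add: Lim_transform_eventually)
  qed
  from LIMSEQ_Suc[OF this] have upper: "(\<lambda>n. (LINT z|cgauss. norm (s - of_real (norm (y\<^sub>0 + of_real (sqrt (2 * t)) * z)) powr \<kappa>))
       + real (Suc n) * (C * (2 * (t / real (Suc n))) powr (1 + Re \<kappa> / 4) * K)) \<longlonglongrightarrow>
       (LINT z|cgauss. norm (s - of_real (norm (y\<^sub>0 + of_real (sqrt (2 * t)) * z)) powr \<kappa>)) + 0"
    by (intro tendsto_intros)
  have "(\<lambda>n. norm (s * (LINT \<omega>|M. cis (\<mu> * T (Suc n) \<omega>)) - of_real (norm r\<^sub>0) powr \<kappa>)) \<longlonglongrightarrow>
     norm (s * (LINT \<omega>|M. cis (\<mu> * \<Theta> t \<omega>)) - of_real (norm r\<^sub>0) powr \<kappa>)"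
    by (intro tendsto_intros char_lim)
  from this upper have "norm (s * (LINT \<omega>|M. cis (\<mu> * \<Theta> t \<omega>)) - of_real (norm r\<^sub>0) powr \<kappa>) \<le>
     (LINT z|cgauss. norm (s - of_real (norm (y\<^sub>0 + of_real (sqrt (2 * t)) * z)) powr \<kappa>)) + 0"
    by (rule LIMSEQ_le) (intro exI allI impI, rule conjunct2[OF step], simp)
  then show ?thesis by simp
qed

section \<open>Convergence in distribution\<close>

lemma limit_law_no_atom: "measure limit_law {x} = 0"
proof -
  have "emeasure limit_law {x} = (\<integral>\<^sup>+y. ennreal (limit_density y) * indicator {x} y \<partial>lborel)"
    unfolding limit_law_def by (rule emeasure_density) auto
  also have "\<dots> = (\<integral>\<^sup>+(y::real). 0 \<partial>lborel)"
  proof (rule nn_integral_cong_AE)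
    show "AE y in lborel. ennreal (limit_density y) * indicator {x} y = 0"
      using AE_lborel_singleton[of x] by eventually_elim simp
  qed
  finally show ?thesis by (simp add: measure_def)
qed

lemma limit_law_interval:
  assumes "0 < y"
  shows "measure limit_law {0<..<y} = cdf limit_law y"
proof -
  interpret L: real_distribution limit_law by (rule real_distribution_limit_law)
  have "cdf limit_law y - cdf limit_law 0 = measure limit_law {0<..y}"
    using assms by (rule L.cdf_diff_eq)
  also have "{0<..y} = {0<..<y} \<union> {y}" using assms by auto
  also have "measure limit_law ({0<..<y} \<union> {y}) = measure limit_law {0<..<y} + measure limit_law {y}"
    by (rule L.finite_measure_Union) auto
  also have "cdf limit_law 0 = 0" unfolding limit_law_def by (rule cdf_limit_law_0)
  finally show ?thesis by (simp add: limit_law_no_atom)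
qed

text \<open>The Gamma law is the law of the reciprocal of a variable with the limit law.\<close>

lemma cdf_gamma_eq_limit_law:
  assumes "0 < x"
  shows "cdf (gamma_distribution (1/2) (1/2)) x = 1 - measure limit_law {0<..<1/x}"
proof -
  have "cdf limit_law (1 / x) = 1 - 2 * gauss_prim (1 / sqrt (1 / x))"
    unfolding limit_law_def using assms by (intro cdf_limit_law) simp
  then show ?thesis using assms by (simp add: limit_law_interval cdf_gamma_half real_sqrt_divide)
qed

text \<open>For \<open>x > 0\<close> the event \<open>1 / X > x\<close> says that \<open>X\<close> lies in the interval from \<open>0\<close> to \<open>1 / x\<close>, whose endpoints have
  no mass in the limit. For \<open>x \<le> 0\<close> the event \<open>1 / X \<le> x\<close> forces \<open>X \<le> 0\<close>; the convention \<open>1 / 0 = 0\<close>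
  does not disturb this.\<close>

lemma cdf_reciprocal_tendsto:
  assumes X: "\<And>n. X n \<in> borel_measurable M" and M: "prob_space M"
    and conv: "weak_conv_m (\<lambda>n. distr M borel (X n)) limit_law"
  shows "(\<lambda>n. cdf (distr M borel (\<lambda>\<omega>. 1 / X n \<omega>)) x) \<longlonglongrightarrow> cdf (gamma_distribution (1/2) (1/2)) x"
proof -
  interpret prob_space M by (rule M)
  interpret L: real_distribution limit_law by (rule real_distribution_limit_law)
  note [measurable] = X
  have D: "real_distribution (distr M borel (X n))" for n by (rule real_distribution_distr) measurable
  interpret D: real_distribution "distr M borel (X n)" for n by (rule D)
  have cdfZ: "cdf (distr M borel (\<lambda>\<omega>. 1 / X n \<omega>)) x = prob {\<omega> \<in> space M. 1 / X n \<omega> \<le> x}" for n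
    unfolding cdf_def by (subst measure_distr) (auto intro!: arg_cong[where f=prob])
  show ?thesis
  proof (cases "0 < x")
    case True
    have fr: "frontier {0<..<1/x} = {0, 1/x}"
      using True by (auto simp: frontier_def interior_open)
    have "measure limit_law {0, 1/x} = measure limit_law ({0} \<union> {1/x})" by (simp add: insert_commute)
    also have "\<dots> \<le> measure limit_law {0} + measure limit_law {1/x}"
      by (rule measure_Un_le) auto
    finally have "measure limit_law (frontier {0<..<1/x}) = 0"
      unfolding fr by (simp add: limit_law_no_atom measure_le_0_iff)
    then have "(\<lambda>n. measure (distr M borel (X n)) {0<..<1/x}) \<longlonglongrightarrow> measure limit_law {0<..<1/x}"
      by (intro weak_conv_imp_continuity_set_conv[OF D real_distribution_limit_law conv]) (auto simp: L.emeasure_eq_measure)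
    then have "(\<lambda>n. 1 - measure (distr M borel (X n)) {0<..<1/x}) \<longlonglongrightarrow> 1 - measure limit_law {0<..<1/x}"
      by (intro tendsto_intros)
    moreover have "1 - measure (distr M borel (X n)) {0<..<1/x} = cdf (distr M borel (\<lambda>\<omega>. 1 / X n \<omega>)) x" for n
    proof -
      have "measure (distr M borel (X n)) {0<..<1/x} = prob {\<omega> \<in> space M. 0 < X n \<omega> \<and> X n \<omega> < 1 / x}"
        by (subst measure_distr) (auto intro!: arg_cong[where f=prob])
      moreover have "prob {\<omega> \<in> space M. 1 / X n \<omega> \<le> x} = 1 - prob {\<omega> \<in> space M. \<not> 1 / X n \<omega> \<le> x}"
        using prob_neg[of "\<lambda>\<omega>. 1 / X n \<omega> \<le> x"] by simp
      moreover have "\<not> 1 / v \<le> x \<longleftrightarrow> 0 < v \<and> v < 1 / x" for v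
      proof (cases "0 < v")
        case pos: True
        then show ?thesis using True by (auto simp: field_simps)
      next
        case False
        then have "1 / v \<le> 0" by (simp add: divide_nonpos_nonpos divide_le_0_iff)
        then have "1 / v \<le> x" using True by linarith
        with False show ?thesis by simp
      qed
      ultimately show ?thesis by (simp add: cdfZ)
    qed
    ultimately show ?thesis by (simp add: cdf_gamma_eq_limit_law[OF True])
  next
    case False
    then have x: "x \<le> 0" by simp
    have "isCont (cdf limit_law) 0" by (simp add: L.isCont_cdf limit_law_no_atom)
    then have "(\<lambda>n. cdf (distr M borel (X n)) 0) \<longlonglongrightarrow> cdf limit_law 0"
      using conv by (simp add: weak_conv_m_def weak_conv_def)
    then have lim: "(\<lambda>n. cdf (distr M borel (X n)) 0) \<longlonglongrightarrow> 0" using cdf_limit_law_0 by (simp add: limit_law_def)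
    have up: "cdf (distr M borel (\<lambda>\<omega>. 1 / X n \<omega>)) x \<le> cdf (distr M borel (X n)) 0" for n
    proof -
      have "cdf (distr M borel (X n)) 0 = prob {\<omega> \<in> space M. X n \<omega> \<le> 0}"
        unfolding cdf_def by (subst measure_distr) (auto intro!: arg_cong[where f=prob])
      moreover have "v \<le> 0" if "1 / v \<le> x" for v
      proof (rule ccontr)
        assume "\<not> v \<le> 0"
        then have "0 < 1 / v" by simp
        with that x show False by linarith
      qed
      then have "prob {\<omega> \<in> space M. 1 / X n \<omega> \<le> x} \<le> prob {\<omega> \<in> space M. X n \<omega> \<le> 0}"
        by (intro finite_measure_mono) auto
      ultimately show ?thesis by (simp add: cdfZ)
    qed
    have "(\<lambda>n. cdf (distr M borel (\<lambda>\<omega>. 1 / X n \<omega>)) x) \<longlonglongrightarrow> 0"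
    proof (rule tendsto_sandwich[OF _ _ tendsto_const lim])
      show "\<forall>\<^sub>F n in sequentially. 0 \<le> cdf (distr M borel (\<lambda>\<omega>. 1 / X n \<omega>)) x"
        by (simp add: cdf_def)
    qed (simp add: up)
    then show ?thesis using x by (simp add: cdf_gamma_half_nonpos)
  qed
qed

text \<open>The bound of \<open>winding_char_bound\<close> is applied with \<open>s = t\<close> to the power \<open>\<kappa> / 2\<close> and then divided by \<open>s\<close>.\<close>

lemma winding_char_tendsto:
  fixes M :: "'a measure" and R :: "real \<Rightarrow> 'a \<Rightarrow> real^2"
  assumes M: "prob_space M" and \<beta>: "\<beta> > 0" and r0: "r\<^sub>0 \<noteq> 0"
    and sol: "vortex_sde_solution M F W \<beta> r\<^sub>0 R"
    and polar0: "polar_angle r\<^sub>0 \<theta>\<^sub>0"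
    and wind: "total_winding_angle M \<theta>\<^sub>0 R \<Theta>"
  shows "((\<lambda>t. char (distr M borel (\<lambda>\<omega>. 8 * \<Theta> t \<omega> / (\<beta> * (ln (4 * t / ((norm r\<^sub>0)\<^sup>2 * exp euler_mascheroni)))\<^sup>2))) \<xi>)
    \<longlongrightarrow> char limit_law \<xi>) at_top"
proof -
  interpret prob_space M by (rule M)
  define r where "r = norm r\<^sub>0"
  define X where "X t \<omega> = 8 * \<Theta> t \<omega> / (\<beta> * (ln (4 * t / (r\<^sup>2 * exp euler_mascheroni)))\<^sup>2)" for t \<omega>
  have X_measurable: "X t \<in> borel_measurable M" if "0 \<le> t" for t
  proof -
    have [measurable]: "\<Theta> t \<in> borel_measurable M" using wind that by (simp add: total_winding_angle_def)
    show ?thesis unfolding X_def [abs_def] by measurable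
  qed
  have "((\<lambda>t. char (distr M borel (X t)) \<xi>) \<longlongrightarrow> char limit_law \<xi>) at_top"
  proof (cases "\<xi> = 0")
    case True
    interpret L: real_distribution limit_law by (rule real_distribution_limit_law)
    have "\<forall>\<^sub>F t in at_top. char limit_law 0 = char (distr M borel (X t)) 0"
      using eventually_ge_at_top[of 0]
    proof eventually_elim
      fix t :: real assume "0 \<le> t"
      then have [measurable]: "X t \<in> borel_measurable M" by (rule X_measurable)
      interpret D: prob_space "distr M borel (X t)"
        by (rule prob_space_distr) measurable
      have "measure limit_law UNIV = 1" using L.prob_space by simp
      moreover have "measure (distr M borel (X t)) UNIV = 1"
        using D.prob_space by simp
      ultimately show "char limit_law 0 = char (distr M borel (X t)) 0"
        by (simp add: char_def)
    qed
    then show ?thesis unfolding True by (rule Lim_transform_eventually[OF tendsto_const])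
  next
    case \<xi>: False
    have r: "0 < r" using r0 by (simp add: r_def)
    define y\<^sub>0 where "y\<^sub>0 = Complex (norm r\<^sub>0 / sqrt 2) (norm r\<^sub>0 / sqrt 2)"
    define E where "E t = char (distr M borel (X t)) \<xi>" for t
    define p where "p t = of_real r powr expo r \<beta> \<xi> t / of_real t powr (expo r \<beta> \<xi> t / 2)" for t
    have bound: "\<forall>\<^sub>F t in at_top. norm (E t - p t) \<le>
      (LINT z|cgauss. norm (1 - of_real (norm (y\<^sub>0 / of_real (sqrt t) + of_real (sqrt 2) * z)) powr expo r \<beta> \<xi> t))"
      using eventually_expo_admissible[OF r \<beta> \<xi>]
    proof eventually_elim
      fix t assume adm: "1 \<le> t \<and> 0 < Re (expo r \<beta> \<xi> t) \<and> Re (expo r \<beta> \<xi> t) \<le> 1"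
      let ?\<kappa> = "expo r \<beta> \<xi> t" and ?\<mu> = "freq r \<beta> \<xi> t"
      define s where "s = (of_real t :: complex) powr (?\<kappa> / 2)"
      define I where "I = (LINT z|cgauss. norm (1 - of_real (norm (y\<^sub>0 / of_real (sqrt t) + of_real (sqrt 2) * z)) powr ?\<kappa>))"
      have t: "0 < t" using adm by simp
      have s: "s \<noteq> 0" using t by (simp add: s_def)
      have "E t = (LINT \<omega>|M. cis (?\<mu> * \<Theta> t \<omega>))"
      proof -
        have [measurable]: "X t \<in> borel_measurable M" using t by (intro X_measurable) simp
        have "E t = (LINT \<omega>|M. iexp (\<xi> * X t \<omega>))"
          unfolding E_def char_def by (subst integral_distr) auto
        also have "\<dots> = (LINT \<omega>|M. cis (?\<mu> * \<Theta> t \<omega>))"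
          by (simp add: X_def freq_def[OF r \<beta> \<xi>] log_scale_def[OF r \<beta> \<xi>] cis_conv_exp mult_ac)
        finally show ?thesis .
      qed
      then have "norm (s * E t - of_real r powr ?\<kappa>) = norm (s * (LINT \<omega>|M. cis (?\<mu> * \<Theta> t \<omega>)) - of_real (norm r\<^sub>0) powr ?\<kappa>)"
        by (simp only: r_def)
      also have "\<dots> \<le> (LINT z|cgauss. norm (s - of_real (norm (y\<^sub>0 + of_real (sqrt (2 * t)) * z)) powr ?\<kappa>))"
        unfolding y\<^sub>0_def
        by (rule winding_char_bound[OF M \<beta> r0 sol polar0 wind t _ _ expo_squared[OF r \<beta> \<xi>]]) (use adm in blast)+
      also have "\<dots> = norm s * I"
        unfolding s_def I_def by (rule remainder_rescale[OF r \<beta> \<xi> t])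
      finally have "norm (s * E t - of_real r powr ?\<kappa>) \<le> norm s * I" .
      moreover have "s * E t - of_real r powr ?\<kappa> = s * (E t - p t)"
        using s by (simp add: p_def s_def[symmetric] field_simps)
      ultimately have "norm s * norm (E t - p t) \<le> norm s * I" by (simp only: norm_mult)
      then show "norm (E t - p t) \<le> I" using s by simp
    qed
    have "((\<lambda>t. E t - p t) \<longlongrightarrow> 0) at_top"
      by (rule Lim_null_comparison[OF bound remainder_tendsto_0[OF r \<beta> \<xi>]])
    moreover have "(p \<longlongrightarrow> char limit_law \<xi>) at_top"
      using prefactor_tendsto[OF r \<beta> \<xi>] unfolding p_def [abs_def] char_limit_law[OF \<xi>] .
    ultimately have "((\<lambda>t. (E t - p t) + p t) \<longlongrightarrow> 0 + char limit_law \<xi>) at_top" by (rule tendsto_add)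
    then show ?thesis by (simp add: E_def)
  qed
  then show ?thesis unfolding X_def [abs_def] r_def .
qed

theorem mainTheorem1:
  fixes M :: "'a measure"
    and F :: "real \<Rightarrow> 'a measure"
    and W R :: "real \<Rightarrow> 'a \<Rightarrow> real^2"
    and \<Theta> :: "real \<Rightarrow> 'a \<Rightarrow> real"
    and \<beta> \<theta>\<^sub>0 :: real
    and r\<^sub>0 :: "real^2"
  assumes "prob_space M"
    and "\<beta> > 0"
    and "r\<^sub>0 \<noteq> 0"
    and "vortex_sde_solution M F W \<beta> r\<^sub>0 R"
    and "polar_angle r\<^sub>0 \<theta>\<^sub>0"
    and "total_winding_angle M \<theta>\<^sub>0 R \<Theta>"
  shows "conv_in_distribution M
           (\<lambda>t \<omega>. \<beta> * (ln (4 * t / ((norm r\<^sub>0)\<^sup>2 * exp euler_mascheroni)))\<^sup>2 / (8 * \<Theta> t \<omega>))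
           (gamma_distribution (1/2) (1/2)) at_top
       \<and> conv_in_distribution M
           (\<lambda>t \<omega>. 8 * \<Theta> t \<omega> / (\<beta> * (ln (4 * t / ((norm r\<^sub>0)\<^sup>2 * exp euler_mascheroni)))\<^sup>2))
           (density lborel (\<lambda>x. ennreal (limit_density x))) at_top"
proof -
  interpret prob_space M by (rule assms(1))
  define X where "X t \<omega> = 8 * \<Theta> t \<omega> / (\<beta> * (ln (4 * t / ((norm r\<^sub>0)\<^sup>2 * exp euler_mascheroni)))\<^sup>2)" for t \<omega>
  have X: "X t \<in> borel_measurable M" if "0 \<le> t" for t
  proof -
    have [measurable]: "\<Theta> t \<in> borel_measurable M" using assms(6) that by (simp add: total_winding_angle_def)
    show ?thesis unfolding X_def [abs_def] by measurable
  qed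
  have recip: "\<beta> * (ln (4 * t / ((norm r\<^sub>0)\<^sup>2 * exp euler_mascheroni)))\<^sup>2 / (8 * \<Theta> t \<omega>) = 1 / X t \<omega>" for t \<omega>
    by (simp add: X_def)
  have char: "((\<lambda>t. char (distr M borel (X t)) \<xi>) \<longlongrightarrow> char limit_law \<xi>) at_top" for \<xi>
    unfolding X_def [abs_def] by (rule winding_char_tendsto[OF assms])
  \<comment> \<open>measurability is only given for nonnegative times, hence the truncation of \<open>\<tau>\<close>\<close>
  have seq: "weak_conv_m (\<lambda>n. distr M borel (X (max 0 (\<tau> n)))) limit_law" if \<tau>: "filterlim \<tau> at_top sequentially" for \<tau> :: "nat \<Rightarrow> real"
  proof (rule levy_continuity)
    show "real_distribution (distr M borel (X (max 0 (\<tau> n))))" for n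
      by (rule real_distribution_distr) (simp add: X)
    have "filterlim (\<lambda>n. max 0 (\<tau> n)) at_top sequentially"
      by (rule filterlim_at_top_mono[OF \<tau>]) simp
    then show "(\<lambda>n. char (distr M borel (X (max 0 (\<tau> n)))) \<xi>) \<longlonglongrightarrow> char limit_law \<xi>" for \<xi>
      by (rule filterlim_compose[OF char])
  qed (rule real_distribution_limit_law)
  have ev: "\<forall>\<^sub>F n in sequentially. max 0 (\<tau> n) = \<tau> n" if \<tau>: "filterlim \<tau> at_top sequentially" for \<tau> :: "nat \<Rightarrow> real"
  proof -
    have "\<forall>\<^sub>F n in sequentially. 0 \<le> \<tau> n" using \<tau> by (simp add: filterlim_at_top)
    then show ?thesis by eventually_elim simp
  qed
  have second: "((\<lambda>t. cdf (distr M borel (X t)) x) \<longlongrightarrow> cdf limit_law x) at_top" for x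
  proof (rule tendsto_at_topI_sequentially)
    fix \<tau> :: "nat \<Rightarrow> real" assume \<tau>: "filterlim \<tau> at_top sequentially"
    interpret L: real_distribution limit_law by (rule real_distribution_limit_law)
    have "isCont (cdf limit_law) x" by (simp add: L.isCont_cdf limit_law_no_atom)
    then have "(\<lambda>n. cdf (distr M borel (X (max 0 (\<tau> n)))) x) \<longlonglongrightarrow> cdf limit_law x"
      using seq[OF \<tau>] by (simp add: weak_conv_m_def weak_conv_def)
    then show "(\<lambda>n. cdf (distr M borel (X (\<tau> n))) x) \<longlonglongrightarrow> cdf limit_law x"
      by (rule Lim_transform_eventually) (use ev[OF \<tau>] in eventually_elim, simp)
  qed
  have first: "((\<lambda>t. cdf (distr M borel (\<lambda>\<omega>. 1 / X t \<omega>)) x) \<longlongrightarrow> cdf (gamma_distribution (1/2) (1/2)) x) at_top" for x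
  proof (rule tendsto_at_topI_sequentially)
    fix \<tau> :: "nat \<Rightarrow> real" assume \<tau>: "filterlim \<tau> at_top sequentially"
    have "(\<lambda>n. cdf (distr M borel (\<lambda>\<omega>. 1 / X (max 0 (\<tau> n)) \<omega>)) x) \<longlonglongrightarrow> cdf (gamma_distribution (1/2) (1/2)) x"
      by (rule cdf_reciprocal_tendsto[OF _ assms(1) seq[OF \<tau>]]) (simp add: X)
    then show "(\<lambda>n. cdf (distr M borel (\<lambda>\<omega>. 1 / X (\<tau> n) \<omega>)) x) \<longlonglongrightarrow> cdf (gamma_distribution (1/2) (1/2)) x"
      by (rule Lim_transform_eventually) (use ev[OF \<tau>] in eventually_elim, simp)
  qed
  have A: "conv_in_distribution M (\<lambda>t \<omega>. 1 / X t \<omega>) (gamma_distribution (1/2) (1/2)) at_top"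
    unfolding conv_in_distribution_def by (intro allI impI first)
  have B: "conv_in_distribution M X limit_law at_top"
    unfolding conv_in_distribution_def by (intro allI impI second)
  show ?thesis
  proof (rule conjI)
    show "conv_in_distribution M
           (\<lambda>t \<omega>. \<beta> * (ln (4 * t / ((norm r\<^sub>0)\<^sup>2 * exp euler_mascheroni)))\<^sup>2 / (8 * \<Theta> t \<omega>))
           (gamma_distribution (1/2) (1/2)) at_top"
      unfolding recip by (rule A)
    show "conv_in_distribution M
           (\<lambda>t \<omega>. 8 * \<Theta> t \<omega> / (\<beta> * (ln (4 * t / ((norm r\<^sub>0)\<^sup>2 * exp euler_mascheroni)))\<^sup>2))
           (density lborel (\<lambda>x. ennreal (limit_density x))) at_top"
      using B unfolding X_def [abs_def] limit_law_def .
  qed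
qed

end
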